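(* Let $\Omega\subset\mathbb{R}^n$ be a bounded, Lipschitz, open set. Let $\{s_j\}_j\subset(0,\frac12)$ be a sequence such that $s_j\to(1/2)^-$, and let $\{H_j\}_j\subset L^\infty(\Omega)$ be such that $\sup_j\|H_j\|_{L^\infty(\Omega)}<+\infty$ and $H_j\to H$ in $L^1(\Omega)$. Let $\{E_j\}_j$ be a sequence of sets such that $E_j$ is a local minimizer for $\mathscr{J}_{s_j,\Omega}^{H_j}$ for every $j$, and $E_j\to E$ in $L^1_{\rm loc}(\mathbb{R}^n)$ for some set $E\subseteq\mathbb{R}^n$. Then $$\limsup_{j\to+\infty}(1-2s_j)\,\mathscr{J}_{s_j,K}^{H_j}(E_j)<+\infty\qquad\text{for every }K\subset\subset\Omega.$$ Moreover, $E$ is a local minimizer for the classical Massari functional $\mathscr{J}_\Omega^H$, and $$\lim_{j\to+\infty}(1-2s_j)\,\mathscr{J}_{s_j,K}^{H_j}(E_j)=\omega_{n-1}\mathscr{J}_{K}^{H}(E)$$ for every $K\subset\subset\Omega$ such that $\operatorname{Per}(E,\partial K)=0$.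
   Context: All subsets of $\mathbb{R}^n$ are assumed Lebesgue-measurable; $E^c$ is the complement of $E$; $K\subset\subset\Omega$ means that $\overline K$ is compact and contained in $\Omega$; $\omega_{n-1}$ is the volume of the unit ball of $\mathbb{R}^{n-1}$. Convergence $E_j\to E$ in $L^1_{\rm loc}(\mathbb{R}^n)$ means $\chi_{E_j}\to\chi_E$ in $L^1_{\rm loc}(\mathbb{R}^n)$. For a set $A\subseteq\Omega$, the classical Massari functional is $$\mathscr{J}_{A}^H(E):=\operatorname{Per}(E,A)+\frac1{\omega_{n-1}}\int_{A\cap E}H\,dx,$$ where $\operatorname{Per}(E,A)$ is the variational perimeter of $E$ in $A$ when $A$ is open, extended to general sets by $\operatorname{Per}(E,A)=\inf\{\operatorname{Per}(E,U): U\supseteq A \text{ open}\}$ (i.e. the total variation measure of $D\chi_E$). For $s\in(0,\frac12)$ and disjoint sets $A,B$, $\mathcal{L}(A,B):=\int_A\int_B\frac{dx\,dy}{|x-y|^{n+2s}}$, $$\operatorname{Per}_s(E,A):=\mathcal{L}(E\cap A,E^c\cap A)+\mathcal{L}(E\cap A,E^c\cap A^c)+\mathcal{L}(E\cap A^c,E^c\cap A),$$ and the non-local Massari functional is $$\mathscr{J}_{s,A}^H(E):=\operatorname{Per}_s(E,A)+\frac1{1-2s}\int_{A\cap E}H\,dx.$$ Local minimizer: $E$ is a local minimizer for $\mathscr{J}_{s,\Omega}^H$ (resp. for $\mathscr{J}_\Omega^H$) if $\mathscr{J}_{s,\Omega'}^H(E)\le\mathscr{J}_{s,\Omega'}^H(F)$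 (resp. $\mathscr{J}_{\Omega'}^H(E)\le\mathscr{J}_{\Omega'}^H(F)$) whenever $\Omega'$ is open and $E\Delta F\subset\subset\Omega'\subset\subset\Omega$.
   Formalization: A local minimizer is additionally required to have finite energy on every open Ω' ⊂⊂ Ω; otherwise a set with infinite fractional perimeter in every ball is vacuously a local minimizer and the limsup bound fails. *)

theory Defs
  imports "HOL-Analysis.Analysis" "HOL-Probability.Essential_Supremum"
begin

section \<open>Sets and convergence\<close>

definition compactly_contained :: "'a::topological_space set \<Rightarrow> 'a set \<Rightarrow> bool"
  where "compactly_contained K \<Omega> \<longleftrightarrow> compact (closure K) \<and> closure K \<subseteq> \<Omega>"

text \<open>Near each boundary point, after a rotation, the set is the part of the ball on one side of the
  graph of a Lipschitz function.  The rotation is encoded by the unit vector \<open>e\<close> (the vertical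
  direction), and the function \<open>\<gamma>\<close> of \<open>n - 1\<close> variables by a function on the hyperplane orthogonal
  to \<open>e\<close>.\<close>

definition lipschitz_open :: "(real^'n) set \<Rightarrow> bool"
  where "lipschitz_open \<Omega> \<longleftrightarrow> open \<Omega> \<and>
    (\<forall>p\<in>frontier \<Omega>. \<exists>r>0. \<exists>e \<gamma> C. norm e = 1 \<and> C-lipschitz_on {v. v \<bullet> e = 0} \<gamma> \<and>
       \<Omega> \<inter> ball p r = {x \<in> ball p r. x \<bullet> e > \<gamma> (x - (x \<bullet> e) *\<^sub>R e)})"

definition Linfty_norm :: "(real^'n) set \<Rightarrow> (real^'n \<Rightarrow> real) \<Rightarrow> ereal"
  where "Linfty_norm S f = esssup (lebesgue_on S) (\<lambda>x. ereal \<bar>f x\<bar>)"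

definition Linfty :: "(real^'n) set \<Rightarrow> (real^'n \<Rightarrow> real) set"
  where "Linfty S = {f \<in> borel_measurable (lebesgue_on S). Linfty_norm S f < \<infinity>}"

definition L1_convergent_on ::
    "(real^'n) set \<Rightarrow> (nat \<Rightarrow> real^'n \<Rightarrow> real) \<Rightarrow> (real^'n \<Rightarrow> real) \<Rightarrow> bool"
  where "L1_convergent_on S f g \<longleftrightarrow>
    (\<forall>j. integrable (lebesgue_on S) (f j)) \<and> integrable (lebesgue_on S) g \<and>
    (\<lambda>j. \<integral>x. \<bar>f j x - g x\<bar> \<partial>lebesgue_on S) \<longlonglongrightarrow> 0"

definition L1_loc_convergent_sets :: "(nat \<Rightarrow> (real^'n) set) \<Rightarrow> (real^'n) set \<Rightarrow> bool"
  where "L1_loc_convergent_sets E F \<longleftrightarrow>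
    (\<forall>K. compact K \<longrightarrow> L1_convergent_on K (\<lambda>j. indicator (E j)) (indicator F))"

section \<open>The classical perimeter and Massari functional\<close>

definition divergence :: "(real^'n \<Rightarrow> real^'n) \<Rightarrow> real^'n \<Rightarrow> real"
  where "divergence \<phi> x = (\<Sum>i\<in>UNIV. frechet_derivative \<phi> (at x) (axis i 1) $ i)"

definition C1_compact_support :: "(real^'n) set \<Rightarrow> (real^'n \<Rightarrow> real^'n) set"
  where "C1_compact_support U = {\<phi>. (\<forall>x. \<phi> differentiable (at x)) \<and>
    (\<forall>v. continuous_on UNIV (\<lambda>x. frechet_derivative \<phi> (at x) v)) \<and>
    compactly_contained {x. \<phi> x \<noteq> 0} U}"

definition Per_open :: "(real^'n) set \<Rightarrow> (real^'n) set \<Rightarrow> ereal"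
  where "Per_open E U =
    (SUP \<phi>\<in>{\<phi> \<in> C1_compact_support U. \<forall>x. norm (\<phi> x) \<le> 1}. ereal (LINT x:E|lebesgue. divergence \<phi> x))"

definition Per :: "(real^'n) set \<Rightarrow> (real^'n) set \<Rightarrow> ereal"
  where "Per E A = (INF U\<in>{U. open U \<and> A \<subseteq> U}. Per_open E U)"

lemma Per_open_mono: "U \<subseteq> V \<Longrightarrow> Per_open E U \<le> Per_open E V"
  unfolding Per_open_def
  by (rule SUP_subset_mono) (auto simp: C1_compact_support_def compactly_contained_def)

lemma Per_eq_Per_open: "open A \<Longrightarrow> Per E A = Per_open E A"
  unfolding Per_def
  by (rule antisym) (auto intro!: INF_lower INF_greatest Per_open_mono)

text \<open>The dimension is \<open>n = CARD('n)\<close>, and \<open>\<omega>\<^sub>n\<^sub>-\<^sub>1\<close> is \<open>unit_ball_vol (CARD('n) - 1)\<close>;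
  for \<open>n = 1\<close> this is \<open>1\<close>.\<close>

definition Massari :: "(real^'n \<Rightarrow> real) \<Rightarrow> (real^'n) set \<Rightarrow> (real^'n) set \<Rightarrow> ereal"
  where "Massari H A E = Per E A +
    ereal (1 / unit_ball_vol (real (CARD('n) - 1)) * (LINT x:A \<inter> E|lebesgue. H x))"

section \<open>The nonlocal perimeter and Massari functional\<close>

definition interaction :: "real \<Rightarrow> (real^'n) set \<Rightarrow> (real^'n) set \<Rightarrow> ennreal"
  where "interaction s A B =
    (\<integral>\<^sup>+x\<in>A. (\<integral>\<^sup>+y\<in>B. ennreal (1 / norm (x - y) powr (real CARD('n) + 2 * s)) \<partial>lebesgue) \<partial>lebesgue)"

definition Per_s :: "real \<Rightarrow> (real^'n) set \<Rightarrow> (real^'n) set \<Rightarrow> ennreal"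
  where "Per_s s E A =
    interaction s (E \<inter> A) (- E \<inter> A) + interaction s (E \<inter> A) (- E \<inter> - A) +
    interaction s (E \<inter> - A) (- E \<inter> A)"

definition Massari_s ::
    "real \<Rightarrow> (real^'n \<Rightarrow> real) \<Rightarrow> (real^'n) set \<Rightarrow> (real^'n) set \<Rightarrow> ereal"
  where "Massari_s s H A E = enn2ereal (Per_s s E A) +
    ereal (1 / (1 - 2 * s) * (LINT x:A \<inter> E|lebesgue. H x))"

section \<open>Local minimizers\<close>

text \<open>The functional \<open>J\<close> takes the region and the set, in this order.  Minimality is understood with
  finite minimal value: with \<open>J \<Omega>' E = \<infinity>\<close> allowed, a set that has infinite energy in every ball
  would be a local minimizer, because all its compactly supported perturbations have infinite energy
  as well.\<close>

definition local_minimizer ::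
    "((real^'n) set \<Rightarrow> (real^'n) set \<Rightarrow> ereal) \<Rightarrow> (real^'n) set \<Rightarrow> (real^'n) set \<Rightarrow> bool"
  where "local_minimizer J \<Omega> E \<longleftrightarrow>
    (\<forall>\<Omega>'. open \<Omega>' \<and> compactly_contained \<Omega>' \<Omega> \<longrightarrow>
       J \<Omega>' E < \<infinity> \<and>
       (\<forall>F\<in>sets lebesgue. compactly_contained (sym_diff E F) \<Omega>' \<longrightarrow> J \<Omega>' E \<le> J \<Omega>' F))"

end

theory Submission
  imports Defs "HOL-Probability.Distributions"
begin

text \<open>
  For a set of finite perimeter, translating by \<open>h\<close> costs at most the variation of \<open>\<chi>\<^sub>E\<close> in the
  direction \<open>h\<close>, so integrating against the kernel over \<open>{\<bar>h\<bar> < \<delta>}\<close> bounds the short-range part of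
  \<open>(1 - 2 s) Per\<^sub>s\<close> by \<open>\<omega>\<^sub>n\<^sub>-\<^sub>1 \<delta>\<^bsup>1 - 2 s\<^esup> Per\<close>; the long-range part is \<open>O(1)\<close> and vanishes after
  multiplication by \<open>1 - 2 s\<close>.  Conversely, for the mollified sets a first order Taylor expansion of
  the difference quotients bounds their total variation by the short-range energy, with an error
  that does not depend on \<open>s\<close>; this gives the liminf inequality without any compactness argument.

  For the upper bounds a competitor is glued to \<open>E\<^sub>j\<close> across a level set \<open>{d = t}\<close> of a distance
  function.  The cost of gluing is the interaction across the level set of the regions where the two
  sets differ; averaging over \<open>t\<close> turns the kernel into \<open>\<bar>h\<bar>\<close> times the kernel, whose integral is
  \<open>O(1 / (1 - 2 s))\<close>, so that the rescaled cost is controlled by the volume of \<open>E\<^sub>j \<triangle> E\<close> and tends to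
  zero.  Gluing with the empty set bounds the energies, gluing with \<open>E\<close> gives the limsup inequality,
  and gluing with a competitor of \<open>E\<close> gives the minimality of \<open>E\<close>.  A shell in which the competitor has small
  perimeter exists by the pigeonhole principle.
\<close>

section \<open>Integrals of the fractional kernel\<close>

text \<open>The liminf bound avoids compactness through the order of its limits: test field,
  mollifier and cut-off \<delta> are fixed first, and the Taylor constant of a mollified set depends
  on the mollifier alone, so one constant serves every E_j and is removed by the factor 1 - 2 s_j.
  The limit constant comes from the integral of |v . h| |h|^(-n-2s) over the ball of radius
  \<delta>, equal to 2 omega_(n-1) |v| \<delta>^(1-2s) / (1-2s); the 2 disappears because the
  short-range energy counts ordered pairs. The perimeter is only a supremum over test fields, with
  no measure at hand. Just its subadditivity on open covers and its superadditivity on disjoint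
  regions are used, and this is why shells of small perimeter take the place of levels that carry no
  perimeter. Cancelling the interactions common to E_j and a competitor requires finite energy,
  which the definition of local minimizer supplies. The estimates are made for Borel sets. Null sets
  are treated at the end and with care, since compact containment of a symmetric difference is
  sensitive to them.\<close>

lemma nn_integral_lborel_shift:
  fixes g :: "'a::euclidean_space \<Rightarrow> ennreal"
  assumes [measurable]: "g \<in> borel_measurable borel"
  shows "(\<integral>\<^sup>+x. g (x + c) \<partial>lborel) = (\<integral>\<^sup>+x. g x \<partial>lborel)"
proof -
  have "(\<integral>\<^sup>+x. g x \<partial>lborel) = (\<integral>\<^sup>+x. g x \<partial>distr lborel borel ((+) c))"
    by (simp add: lborel_distr_plus)
  also have "\<dots> = (\<integral>\<^sup>+x. g (x + c) \<partial>lborel)"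
    by (subst nn_integral_distr) (auto simp: add.commute)
  finally show ?thesis ..
qed

lemma nn_integral_lborel_scale:
  fixes g :: "'a::euclidean_space \<Rightarrow> ennreal"
  assumes [measurable]: "g \<in> borel_measurable borel" and "c \<noteq> 0"
  shows "(\<integral>\<^sup>+x. g x \<partial>lborel) = ennreal (\<bar>c\<bar> ^ DIM('a)) * (\<integral>\<^sup>+x. g (c *\<^sub>R x) \<partial>lborel)"
proof -
  have "(\<integral>\<^sup>+x. g x \<partial>lborel) = (\<integral>\<^sup>+x. g x \<partial>density (distr lborel borel (\<lambda>x. 0 + c *\<^sub>R x)) (\<lambda>_. \<bar>c\<bar>^DIM('a)))"
    using lborel_affine[OF \<open>c \<noteq> 0\<close>, of "0::'a"] by simp
  also have "\<dots> = ennreal (\<bar>c\<bar> ^ DIM('a)) * (\<integral>\<^sup>+x. g (c *\<^sub>R x) \<partial>lborel)"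
    by (subst nn_integral_density) (auto simp: nn_integral_distr nn_integral_cmult)
  finally show ?thesis .
qed

lemma nn_integral_lborel_uminus:
  fixes g :: "'a::euclidean_space \<Rightarrow> ennreal"
  assumes [measurable]: "g \<in> borel_measurable borel"
  shows "(\<integral>\<^sup>+x. g (- x) \<partial>lborel) = (\<integral>\<^sup>+x. g x \<partial>lborel)"
  using nn_integral_lborel_scale[of g "-1"] by simp

text \<open>Uniqueness of Haar measure, up to a factor that the unit ball shows to be one.\<close>

lemma nn_integral_lborel_orthogonal:
  fixes f :: "'a::euclidean_space \<Rightarrow> 'a" and g :: "'a \<Rightarrow> ennreal"
  assumes f: "orthogonal_transformation f" and [measurable]: "g \<in> borel_measurable borel"
  shows "(\<integral>\<^sup>+x. g (f x) \<partial>lborel) = (\<integral>\<^sup>+x. g x \<partial>lborel)"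
proof -
  have lin: "linear f" and nf: "\<And>x. norm (f x) = norm x"
    using f by (auto simp: orthogonal_transformation)
  have [measurable]: "f \<in> borel_measurable borel"
    using lin by (intro borel_measurable_continuous_onI linear_continuous_on linear_linear[THEN iffD2])
  obtain h where h: "\<And>y. f (h y) = y"
    using surj_f_inv_f[OF linear_inj_imp_surj[OF lin orthogonal_transformation_inj[OF f]]] by blast
  have shift: "(\<integral>\<^sup>+x. G (f x + c) \<partial>lborel) = (\<integral>\<^sup>+x. G (f x) \<partial>lborel)"
    if [measurable]: "G \<in> borel_measurable borel" for G :: "'a \<Rightarrow> ennreal" and c
  proof -
    have "(\<integral>\<^sup>+x. G (f x + c) \<partial>lborel) = (\<integral>\<^sup>+x. G (f (x + h c)) \<partial>lborel)"
      by (simp add: linear_add[OF lin] h)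
    also have "\<dots> = (\<integral>\<^sup>+x. G (f x) \<partial>lborel)"
      by (rule nn_integral_lborel_shift) simp
    finally show ?thesis .
  qed
  define u :: "'a \<Rightarrow> ennreal" where "u = indicator (ball 0 1)"
  have [measurable]: "u \<in> borel_measurable borel"
    unfolding u_def by (intro borel_measurable_indicator borel_open open_ball)
  have uf: "u (- f x) = u x" for x by (simp add: u_def nf indicator_def)
  have U: "(\<integral>\<^sup>+x. u x \<partial>lborel) = ennreal (unit_ball_vol (real DIM('a)))"
    by (simp add: u_def emeasure_ball)
  \<comment> \<open>Translating \<open>y\<close> by \<open>- f x\<close>, exchanging the integrals
    and translating \<open>x\<close> by a preimage of \<open>y\<close> frees \<open>g\<close> from
    \<open>f\<close>, because the unit ball is invariant under \<open>- f\<close>. The positive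
    finite volume of the ball is then cancelled.\<close>
  have "(\<integral>\<^sup>+x. g (f x) \<partial>lborel) * (\<integral>\<^sup>+y. u y \<partial>lborel)
      = (\<integral>\<^sup>+x. (\<integral>\<^sup>+y. g (f x) * u y \<partial>lborel) \<partial>lborel)"
    by (simp add: nn_integral_multc nn_integral_cmult)
  also have "\<dots> = (\<integral>\<^sup>+x. (\<integral>\<^sup>+y. g (f x) * u (y + (- f x)) \<partial>lborel) \<partial>lborel)"
    by (simp add: nn_integral_cmult nn_integral_lborel_shift[of u] del: add_uminus_conv_diff)
  also have "\<dots> = (\<integral>\<^sup>+y. (\<integral>\<^sup>+x. g (f x) * u (y + (- f x)) \<partial>lborel) \<partial>lborel)"
    by (rule lborel_pair.Fubini') simp
  also have "\<dots> = (\<integral>\<^sup>+y. (\<integral>\<^sup>+x. g (f x + y) * u (- f x) \<partial>lborel) \<partial>lborel)"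
  proof (rule nn_integral_cong)
    fix y :: 'a
    show "(\<integral>\<^sup>+x. g (f x) * u (y + (- f x)) \<partial>lborel) = (\<integral>\<^sup>+x. g (f x + y) * u (- f x) \<partial>lborel)"
      using shift[of "\<lambda>x. g x * u (y + (- x))" y] by (simp add: algebra_simps)
  qed
  also have "\<dots> = (\<integral>\<^sup>+x. (\<integral>\<^sup>+y. g (f x + y) * u (- f x) \<partial>lborel) \<partial>lborel)"
    by (rule lborel_pair.Fubini') simp
  also have "\<dots> = (\<integral>\<^sup>+x. (\<integral>\<^sup>+y. g y \<partial>lborel) * u x \<partial>lborel)"
    by (simp add: nn_integral_multc uf add.commute[of "f _"] nn_integral_lborel_shift)
  also have "\<dots> = (\<integral>\<^sup>+y. g y \<partial>lborel) * (\<integral>\<^sup>+x. u x \<partial>lborel)"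
    by (simp add: nn_integral_cmult)
  finally show ?thesis
    unfolding U
    by (smt (verit) ennreal_less_zero_iff ennreal_mult_cancel_left ennreal_neq_top mult.commute
        nless_le of_nat_0_le_iff unit_ball_vol_pos)
qed

lemma nn_integral_power_Ioo:
  assumes "q \<ge> 1" "(0::real) \<le> t"
  shows "(\<integral>\<^sup>+x. ennreal (real q * x ^ (q - 1)) * indicator {0<..<t} x \<partial>lborel) = ennreal (t ^ q)"
proof -
  have "(\<integral>\<^sup>+x. ennreal (real q * x ^ (q - 1)) * indicator {0<..<t} x \<partial>lborel)
      = (\<integral>\<^sup>+x. ennreal (real q * x ^ (q - 1)) * indicator {0..t} x \<partial>lborel)"
    using AE_lborel_singleton[of 0] AE_lborel_singleton[of t]
    by (intro nn_integral_cong_AE) (auto split: split_indicator elim!: eventually_elim2)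
  also have "\<dots> = ennreal (t ^ q - 0 ^ q)"
    using assms by (intro nn_integral_FTC_Icc) (auto intro!: derivative_eq_intros)
  finally show ?thesis using assms by simp
qed

text \<open>The push-forward of the weight \<open>f\<close> under the norm is determined by its values on the
  intervals below \<open>t\<close>, which are computed by scaling; this replaces polar coordinates.\<close>

lemma nn_integral_homogeneous_radial:
  fixes f :: "'a::euclidean_space \<Rightarrow> ennreal"
  assumes [measurable]: "f \<in> borel_measurable borel" "g \<in> borel_measurable borel"
    and hom: "\<And>t x. t > 0 \<Longrightarrow> f (t *\<^sub>R x) = ennreal (t ^ p) * f x"
    and m: "(\<integral>\<^sup>+x. f x * indicator (ball 0 1) x \<partial>lborel) = ennreal m" "m \<ge> 0"
    and q: "q = DIM('a) + p"
  shows "(\<integral>\<^sup>+x. f x * g (norm x) \<partial>lborel)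
    = ennreal (m * q) * (\<integral>\<^sup>+t. ennreal (t ^ (q - 1)) * g t * indicator {0<..} t \<partial>lborel)"
proof -
  have q1: "q \<ge> 1" using q by (simp add: Suc_leI trans_le_add1)
  define M where "M = distr (density lborel f) borel (norm :: 'a \<Rightarrow> real)"
  define N where "N = density lborel (\<lambda>t::real. ennreal (m * q * t ^ (q - 1)) * indicator {0<..} t)"
  have ball: "emeasure M {..<t} = ennreal (m * t ^ q)" if "t > 0" for t
  proof -
    have "emeasure M {..<t} = (\<integral>\<^sup>+x. f x * indicator (ball 0 t) x \<partial>lborel)"
      unfolding M_def by (simp add: emeasure_distr emeasure_density vimage_def ball_def lessThan_def)
    also have "\<dots> = ennreal (t ^ DIM('a)) * (\<integral>\<^sup>+x. f (t *\<^sub>R x) * indicator (ball 0 t) (t *\<^sub>R x) \<partial>lborel)"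
      using that by (intro nn_integral_lborel_scale[where c=t, THEN trans] borel_measurable_times_ennreal
          borel_measurable_indicator) auto
    also have "\<dots> = ennreal (t ^ DIM('a)) * (\<integral>\<^sup>+x. ennreal (t ^ p) * (f x * indicator (ball 0 1) x) \<partial>lborel)"
      using that by (intro arg_cong[where f="\<lambda>z. ennreal (t ^ DIM('a)) * z"] nn_integral_cong)
        (auto simp: hom mult.assoc split: split_indicator)
    also have "\<dots> = ennreal (m * t ^ q)"
      using that m by (subst nn_integral_cmult)
        (auto simp: ennreal_mult[symmetric] q power_add mult_ac
           intro!: borel_measurable_times_ennreal borel_measurable_indicator)
    finally show ?thesis .
  qed
  have Nball: "emeasure N {..<t} = ennreal (m * t ^ q)" if "t > 0" for t
  proof -
    have "emeasure N {..<t} = (\<integral>\<^sup>+x. ennreal m * (ennreal (real q * x ^ (q - 1)) * indicator {0<..<t} x) \<partial>lborel)"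
      unfolding N_def using m(2) by (subst emeasure_density)
        (auto intro!: nn_integral_cong simp: indicator_def ennreal_mult' mult.assoc)
    also have "\<dots> = ennreal (m * t ^ q)"
      using that m(2) q1 nn_integral_power_Ioo[of q t]
      by (subst nn_integral_cmult) (auto simp: ennreal_mult)
    finally show ?thesis .
  qed
  have neg: "emeasure M {..<t} = 0 \<and> emeasure N {..<t} = 0" if "t \<le> 0" for t
  proof -
    have "\<not> norm x < t" for x :: 'a using that norm_ge_zero[of x] by linarith
    then have "norm -` {..<t} = ({}::'a set)" by auto
    moreover have "ennreal (m * q * x ^ (q - 1)) * indicator {0<..} x * indicator {..<t} x = 0" for x :: real
      using that by (auto simp: indicator_def)
    ultimately show ?thesis
      unfolding M_def N_def by (simp add: emeasure_distr emeasure_density del: mult_eq_0_iff)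
  qed
  have "M = N"
  proof (rule measure_eqI_generator_eq[where A="\<lambda>i. {..<real i}" and E="range lessThan" and \<Omega>=UNIV])
    show "Int_stable (range (lessThan :: real \<Rightarrow> real set))"
    proof -
      have "{..<a} \<inter> {..<b} = {..<min a b}" for a b :: real by auto
      then show ?thesis by (auto simp: Int_stable_def simp del: lessThan_Int_lessThan)
    qed
    show "emeasure M X = emeasure N X" if "X \<in> range lessThan" for X
      using that ball Nball neg by (metis image_iff linorder_not_less)
    show "sets M = sigma_sets UNIV (range lessThan)" "sets N = sigma_sets UNIV (range lessThan)"
      by (auto simp: M_def N_def borel_Iio)
    show "(\<Union>i. {..<real i}) = UNIV" using reals_Archimedean2 by auto
    show "emeasure M {..<real i} \<noteq> \<infinity>" for i
      using ball[of "real i"] neg[of "real i"] by (cases "i = 0") auto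
  qed auto
  have "(\<integral>\<^sup>+x. f x * g (norm x) \<partial>lborel) = (\<integral>\<^sup>+t. g t \<partial>M)"
    by (simp add: M_def nn_integral_distr nn_integral_density)
  also have "\<dots> = (\<integral>\<^sup>+t. ennreal (m * q * t ^ (q - 1)) * indicator {0<..} t * g t \<partial>lborel)"
    unfolding \<open>M = N\<close> by (simp add: N_def nn_integral_density)
  also have "\<dots> = (\<integral>\<^sup>+t. ennreal (m * q) * (ennreal (t ^ (q - 1)) * g t * indicator {0<..} t) \<partial>lborel)"
    using m(2) by (intro nn_integral_cong) (auto simp: indicator_def ennreal_mult' mult_ac)
  also have "\<dots> = ennreal (m * q) * (\<integral>\<^sup>+t. ennreal (t ^ (q - 1)) * g t * indicator {0<..} t \<partial>lborel)"
    by (simp add: nn_integral_cmult)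
  finally show ?thesis .
qed

section \<open>Gaussian moments and the constant of the linear weight\<close>

lemma Gamma_half_odd: "Gamma (real k + 1/2) = sqrt pi * (fact (2 * k) / (2 ^ (2 * k) * fact k))"
proof (induction k)
  case 0
  then show ?case by (simp add: Gamma_one_half_real)
next
  case (Suc k)
  have "Gamma (real (Suc k) + 1/2) = Gamma ((real k + 1/2) + 1)" by (simp add: algebra_simps)
  also have "\<dots> = (real k + 1/2) * Gamma (real k + 1/2)"
    by (rule Gamma_plus1) (metis add_nonneg_pos half_gt_zero_iff nonpos_Ints_nonpos not_le of_nat_0_le_iff zero_less_one)
  also have "\<dots> = sqrt pi * ((2 * real k + 1) / 2 * (fact (2 * k) / (2 ^ (2 * k) * fact k)))"
    unfolding Suc by (simp add: field_simps)
  also have "(2 * real k + 1) / 2 * (fact (2 * k) / (2 ^ (2 * k) * fact k)) = fact (2 * Suc k) / (2 ^ (2 * Suc k) * fact (Suc k))"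
    by (simp add: divide_simps) (simp add: algebra_simps)
  finally show ?case .
qed

lemma has_bochner_integral_nn_integral_eq:
  assumes "has_bochner_integral M f x" "\<And>x. 0 \<le> f x"
  shows "(\<integral>\<^sup>+x. ennreal (f x) \<partial>M) = ennreal x"
  using assms nn_integral_eq_integral[of M f] by (auto simp: has_bochner_integral_iff)

text \<open>Even powers come from moments stated with factorials, which are rewritten as Gamma
  values at half-integers; for odd powers the Gamma value is itself a factorial.\<close>

lemma nn_integral_gaussian_moment:
  "(\<integral>\<^sup>+t. ennreal (t ^ k) * ennreal (exp (- t\<^sup>2)) * indicator {0<..} t \<partial>lborel)
    = ennreal (Gamma ((real k + 1) / 2) / 2)"
proof -
  have *: "has_bochner_integral lborel (\<lambda>x::real. indicator {0..} x *\<^sub>R (exp (-x\<^sup>2)*x^k)) (Gamma ((real k + 1) / 2) / 2)"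
  proof (cases "even k")
    case True
    then obtain j where j: "k = 2 * j" by auto
    have "(real k + 1) / 2 = real j + 1/2" by (simp add: j add_divide_distrib)
    then show ?thesis
      using gaussian_moment_even_pos[of j] unfolding \<open>(real k + 1) / 2 = real j + 1/2\<close> Gamma_half_odd
      by (simp add: j mult.commute mult.left_commute)
  next
    case False
    then obtain j where j: "k = 2 * j + 1" by (auto elim: oddE)
    have "(real k + 1) / 2 = 1 + real j" by (simp add: j add_divide_distrib)
    then show ?thesis
      using gaussian_moment_odd_pos[of j] unfolding \<open>(real k + 1) / 2 = 1 + real j\<close> Gamma_fact
      by (simp add: j)
  qed
  have "(\<integral>\<^sup>+t. ennreal (t ^ k) * ennreal (exp (- t\<^sup>2)) * indicator {0<..} t \<partial>lborel)
      = (\<integral>\<^sup>+x. ennreal (indicator {0..} x *\<^sub>R (exp (-x\<^sup>2)*x^k)) \<partial>lborel)"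
    using AE_lborel_singleton[of 0]
    by (intro nn_integral_cong_AE) (auto simp: indicator_def ennreal_mult'[symmetric] mult.commute elim!: eventually_mono)
  also have "\<dots> = ennreal (Gamma ((real k + 1) / 2) / 2)"
    using * by (intro has_bochner_integral_nn_integral_eq) (auto simp: indicator_def)
  finally show ?thesis .
qed

text \<open>The integrand factorizes over the coordinates: the coordinate that carries the weight
  contributes 1, each of the other n - 1 contributes sqrt pi.\<close>

lemma gaussian_first_moment:
  fixes i :: "'n::finite"
  shows "(\<integral>\<^sup>+x. ennreal \<bar>x $ i\<bar> * ennreal (exp (- (norm x)\<^sup>2)) \<partial>(lborel :: (real^'n) measure))
    = ennreal (pi powr ((real CARD('n) - 1) / 2))"
proof -
  define e :: "real^'n" where "e = axis i 1"
  have e: "e \<in> Basis" by (simp add: e_def)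
  define f :: "real^'n \<Rightarrow> real \<Rightarrow> ennreal"
    where "f = (\<lambda>b t. ennreal ((if b = e then \<bar>t\<bar> else 1) * exp (- t\<^sup>2)))"
  have sq: "(norm x)\<^sup>2 = (\<Sum>b\<in>Basis. (x \<bullet> b)\<^sup>2)" for x :: "real^'n"
    by (metis (no_types, lifting) euclidean_inner power2_eq_square power2_norm_eq_inner sum.cong)
  have "ennreal \<bar>x $ i\<bar> * ennreal (exp (- (norm x)\<^sup>2)) = (\<Prod>b\<in>Basis. f b (x \<bullet> b))" for x :: "real^'n"
  proof -
    have "(\<Prod>b\<in>Basis. (if b = e then \<bar>x \<bullet> b\<bar> else 1)) = \<bar>x \<bullet> e\<bar>"
      using e by (simp add: prod.delta)
    then show ?thesis
      by (simp add: f_def prod_ennreal prod.distrib exp_sum[symmetric] sum_negf sq ennreal_mult'[symmetric] e_def inner_axis)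
  qed
  then have "(\<integral>\<^sup>+x. ennreal \<bar>x $ i\<bar> * ennreal (exp (- (norm x)\<^sup>2)) \<partial>(lborel :: (real^'n) measure))
      = (\<integral>\<^sup>+x. (\<Prod>b\<in>Basis. f b (x \<bullet> b)) \<partial>lborel)" by simp
  also have "\<dots> = (\<Prod>b\<in>Basis. \<integral>\<^sup>+t. f b t \<partial>lborel)"
    by (rule nn_integral_lborel_prod) (auto simp: f_def)
  also have "\<dots> = (\<Prod>b\<in>Basis. ennreal (if b = e then 1 else sqrt pi))"
  proof (intro prod.cong refl)
    fix b :: "real^'n"
    have A: "has_bochner_integral lborel (\<lambda>x::real. exp (- x\<^sup>2)) (sqrt pi)"
      using has_bochner_integral_even_function[OF gaussian_moment_0] by simp
    have "has_bochner_integral lborel (\<lambda>x::real. indicator {0..} x *\<^sub>R (exp (-x\<^sup>2)*\<bar>x\<bar>)) (1 / 2)"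
      by (rule has_bochner_integral_cong[THEN iffD1, OF _ _ _ gaussian_moment_1]) auto
    from has_bochner_integral_even_function[OF this]
    have B: "has_bochner_integral lborel (\<lambda>x::real. exp (-x\<^sup>2)*\<bar>x\<bar>) 1"
      by simp
    show "(\<integral>\<^sup>+t. f b t \<partial>lborel) = ennreal (if b = e then 1 else sqrt pi)"
      using has_bochner_integral_nn_integral_eq[OF A] has_bochner_integral_nn_integral_eq[OF B]
      by (simp add: f_def mult.commute)
  qed
  also have "\<dots> = ennreal (sqrt pi ^ (CARD('n) - 1))"
  proof -
    have "(\<Prod>b\<in>Basis. (if b = e then 1 else sqrt pi)) = (\<Prod>b\<in>Basis - {e}. sqrt pi)"
      using e by (subst prod.remove[OF _ e]) (auto intro!: prod.cong)
    then show ?thesis using e by (simp add: prod_ennreal card_Diff_singleton)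
  qed
  also have "sqrt pi ^ (CARD('n) - 1) = pi powr ((real CARD('n) - 1) / 2)"
    by (simp add: powr_half_sqrt[symmetric] powr_power of_nat_diff Suc_leI)
  finally show ?thesis .
qed

text \<open>A rotation turns \<open>v\<close> into a multiple of a coordinate vector. The weight
  |x_i| is homogeneous of degree 1, so the integral is a constant times a one-dimensional integral;
  the constant is the same for all profiles \<open>g\<close> and is found from a Gaussian
  one.\<close>

lemma nn_integral_linear_radial:
  fixes v :: "real^'n"
  assumes [measurable]: "g \<in> borel_measurable borel"
  shows "(\<integral>\<^sup>+x. ennreal \<bar>v \<bullet> x\<bar> * g (norm x) \<partial>lborel)
    = ennreal (2 * unit_ball_vol (real (CARD('n) - 1)) * norm v) *
      (\<integral>\<^sup>+t. ennreal (t ^ CARD('n)) * g t * indicator {0<..} t \<partial>lborel)"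
proof -
  define i :: 'n where "i = undefined"
  have rot: "(\<integral>\<^sup>+x. ennreal \<bar>v \<bullet> x\<bar> * g (norm x) \<partial>lborel)
      = ennreal (norm v) * (\<integral>\<^sup>+x. ennreal \<bar>x $ i\<bar> * g (norm x) \<partial>lborel)"
    if [measurable]: "g \<in> borel_measurable borel" for g :: "real \<Rightarrow> ennreal"
  proof -
    obtain f :: "real^'n \<Rightarrow> real^'n" where f: "orthogonal_transformation f" "f (norm v *\<^sub>R axis i 1) = v"
      by (rule orthogonal_transformation_exists[of "norm v *\<^sub>R axis i 1" v]) simp_all
    have "v \<bullet> f x = norm v * (x $ i)" for x
    proof -
      have "v \<bullet> f x = (norm v *\<^sub>R axis i 1) \<bullet> x"
        using f(1) unfolding orthogonal_transformation_def by (subst f(2)[symmetric]) blast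
      then show ?thesis by (simp add: inner_axis')
    qed
    moreover have "norm (f x) = norm x" for x
      using f(1) by (simp add: orthogonal_transformation_norm)
    ultimately have "(\<integral>\<^sup>+x. ennreal \<bar>v \<bullet> f x\<bar> * g (norm (f x)) \<partial>lborel)
       = (\<integral>\<^sup>+x. ennreal (norm v) * (ennreal \<bar>x $ i\<bar> * g (norm x)) \<partial>lborel)"
      by (simp add: abs_mult ennreal_mult' mult.assoc)
    then show ?thesis
      using nn_integral_lborel_orthogonal[OF f(1), of "\<lambda>x. ennreal \<bar>v \<bullet> x\<bar> * g (norm x)"]
      by (simp add: nn_integral_cmult)
  qed
  define n where "n = CARD('n)"
  have n: "n \<ge> 1" by (simp add: n_def Suc_leI)
  have "(\<integral>\<^sup>+x. ennreal \<bar>x $ i\<bar> * indicator (ball 0 1) x \<partial>(lborel :: (real^'n) measure))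
      \<le> (\<integral>\<^sup>+x. indicator (ball 0 1) x \<partial>(lborel :: (real^'n) measure))"
  proof (intro nn_integral_mono)
    fix x :: "real^'n"
    show "ennreal \<bar>x $ i\<bar> * indicator (ball 0 1) x \<le> indicator (ball 0 1) x"
      using component_le_norm_cart[of x i] by (auto simp: indicator_def)
  qed
  also have "\<dots> < \<infinity>" using emeasure_lborel_ball_finite[of "0::real^'n" 1] by simp
  finally obtain m where m: "m \<ge> 0"
    "(\<integral>\<^sup>+x. ennreal \<bar>x $ i\<bar> * indicator (ball 0 1) x \<partial>(lborel :: (real^'n) measure)) = ennreal m"
    by (cases "(\<integral>\<^sup>+x. ennreal \<bar>x $ i\<bar> * indicator (ball 0 1) x \<partial>(lborel :: (real^'n) measure))") auto
  have rad: "(\<integral>\<^sup>+x. ennreal \<bar>x $ i\<bar> * g (norm x) \<partial>(lborel :: (real^'n) measure))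
      = ennreal (m * (n + 1)) * (\<integral>\<^sup>+t. ennreal (t ^ n) * g t * indicator {0<..} t \<partial>lborel)"
    if [measurable]: "g \<in> borel_measurable borel" for g :: "real \<Rightarrow> ennreal"
    using nn_integral_homogeneous_radial[of "\<lambda>x::real^'n. ennreal \<bar>x $ i\<bar>" g 1 m "n + 1"] m
    by (simp add: abs_mult ennreal_mult' n_def)
  \<comment> \<open>The profile exp(-t^2) makes both sides explicit and so identifies the unknown
    \<open>m * (n + 1)\<close> as twice the volume of the unit ball in dimension n - 1.\<close>
  have "pi powr ((real n - 1) / 2) = m * (n + 1) * (Gamma ((real n + 1) / 2) / 2)"
    using rad[of "\<lambda>t. ennreal (exp (- t\<^sup>2))"] m(1) gaussian_first_moment[of i]
    by (simp add: nn_integral_gaussian_moment n_def[symmetric] ennreal_mult'[symmetric] Gamma_real_nonneg)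
  moreover have "unit_ball_vol (real (n - 1)) = pi powr ((real n - 1) / 2) / Gamma ((real n + 1) / 2)"
    using n by (simp add: unit_ball_vol_def of_nat_diff field_simps)
  moreover have "Gamma ((real n + 1) / 2) > 0" by (rule Gamma_real_pos) simp
  moreover have "P = k * (G / 2) \<Longrightarrow> U = P / G \<Longrightarrow> G > 0 \<Longrightarrow> k = 2 * U" for P k G U :: real
    using mult_left_cancel[of G k "2 * U"] by (auto simp: field_simps)
  ultimately have "m * (n + 1) = 2 * unit_ball_vol (real (n - 1))" by blast
  then have "ennreal (norm v) * ennreal (m * (n + 1)) = ennreal (2 * unit_ball_vol (real (n - 1)) * norm v)"
    by (simp only: ennreal_mult'[symmetric] norm_ge_zero mult.commute)
  then show ?thesis
    unfolding rot[OF assms] rad[OF assms] mult.assoc[symmetric] by (simp only: n_def)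
qed

lemma nn_integral_radial:
  fixes g :: "real \<Rightarrow> ennreal"
  assumes [measurable]: "g \<in> borel_measurable borel"
  shows "(\<integral>\<^sup>+x. g (norm x) \<partial>(lborel :: 'a::euclidean_space measure))
    = ennreal (DIM('a) * unit_ball_vol (DIM('a))) *
      (\<integral>\<^sup>+t. ennreal (t ^ (DIM('a) - 1)) * g t * indicator {0<..} t \<partial>lborel)"
  using nn_integral_homogeneous_radial[of "\<lambda>x::'a. 1" g 0 "unit_ball_vol (DIM('a))" "DIM('a)"]
  by (simp add: emeasure_ball mult.commute)

section \<open>Power integrals and the fractional kernel\<close>

lemma nn_integral_powr_below:
  fixes a d :: real
  assumes "a > -1" "d > 0"
  shows "(\<integral>\<^sup>+t. ennreal (t powr a) * indicator {0<..<d} t \<partial>lborel) = ennreal (d powr (a + 1) / (a + 1))"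
proof -
  have "(\<integral>\<^sup>+t. ennreal (t powr a) * indicator {0<..<d} t \<partial>lborel)
      = (\<integral>\<^sup>+t. ennreal (indicator {0..d} t * t powr a) \<partial>lborel)"
    using AE_lborel_singleton[of 0] AE_lborel_singleton[of d]
    by (intro nn_integral_cong_AE) (auto split: split_indicator elim!: eventually_elim2)
  also have "\<dots> = ennreal (d powr (a + 1) / (a + 1))"
    using assms by (intro nn_integral_has_integral_lebesgue has_integral_powr_from_0) auto
  finally show ?thesis .
qed

lemma nn_integral_powr_above:
  fixes a d :: real
  assumes "a < -1" "d > 0"
  shows "(\<integral>\<^sup>+t. ennreal (t powr a) * indicator {d..} t \<partial>lborel) = ennreal (d powr (a + 1) / (- a - 1))"
proof -
  have "(\<integral>\<^sup>+t. ennreal (t powr a) * indicator {d..} t \<partial>lborel)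
      = (\<integral>\<^sup>+t. ennreal (indicator {d..} t * t powr a) \<partial>lborel)"
    by (intro nn_integral_cong) (auto split: split_indicator)
  also have "\<dots> = ennreal (- (d powr (a + 1)) / (a + 1))"
    using assms by (intro nn_integral_has_integral_lebesgue has_integral_powr_to_inf) auto
  also have "- (d powr (a + 1)) / (a + 1) = d powr (a + 1) / (- a - 1)"
  proof -
    have eq: "- a - 1 = - (a + 1)" by simp
    show ?thesis unfolding eq by (simp only: divide_minus_right minus_divide_left)
  qed
  finally show ?thesis .
qed

text \<open>At the origin the quotient has the default value 0, so the kernel is finite everywhere;
  this is used when an error tending to zero is multiplied by it pointwise.\<close>

definition riesz_kernel :: "real \<Rightarrow> real^'n \<Rightarrow> ennreal"
  where "riesz_kernel s h = ennreal (1 / norm h powr (real CARD('n) + 2 * s))"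

lemma kernel_measurable [measurable]: "riesz_kernel s \<in> borel_measurable borel"
  unfolding riesz_kernel_def[abs_def] by measurable

lemma kernel_minus: "riesz_kernel s (x - y) = riesz_kernel s (y - x)"
  by (simp add: riesz_kernel_def norm_minus_commute)

text \<open>The weight leaves the radial factor t^(-2s), integrable at 0 exactly because 2 s < 1.
  The resulting blow-up 1 / (1 - 2 s) is what the rescaling by 1 - 2 s compensates.\<close>

lemma nn_integral_kernel_linear:
  fixes v :: "real^'n"
  assumes "s < 1/2" "d > 0"
  shows "(\<integral>\<^sup>+h. ennreal \<bar>v \<bullet> h\<bar> * riesz_kernel s h * indicator (ball 0 d) h \<partial>lborel)
    = ennreal (2 * unit_ball_vol (real (CARD('n) - 1)) * norm v * (d powr (1 - 2 * s) / (1 - 2 * s)))"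
proof -
  define g :: "real \<Rightarrow> ennreal"
    where "g t = ennreal (1 / t powr (real CARD('n) + 2 * s)) * indicator {..<d} t" for t
  have [measurable]: "g \<in> borel_measurable borel" unfolding g_def[abs_def] by measurable
  have "(\<integral>\<^sup>+h. ennreal \<bar>v \<bullet> h\<bar> * riesz_kernel s h * indicator (ball 0 d) h \<partial>lborel)
      = (\<integral>\<^sup>+h. ennreal \<bar>v \<bullet> h\<bar> * g (norm h) \<partial>lborel)"
    by (intro nn_integral_cong) (auto simp: g_def riesz_kernel_def split: split_indicator)
  also have "\<dots> = ennreal (2 * unit_ball_vol (real (CARD('n) - 1)) * norm v) *
      (\<integral>\<^sup>+t. ennreal (t ^ CARD('n)) * g t * indicator {0<..} t \<partial>lborel)"
    by (rule nn_integral_linear_radial) simp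
  also have "(\<integral>\<^sup>+t. ennreal (t ^ CARD('n)) * g t * indicator {0<..} t \<partial>lborel)
      = (\<integral>\<^sup>+t. ennreal (t powr (- 2 * s)) * indicator {0<..<d} t \<partial>lborel)"
  proof (rule nn_integral_cong)
    fix t :: real
    have "t ^ CARD('n) * (1 / t powr (real CARD('n) + 2 * s)) = t powr (- 2 * s)" if "t > 0"
      using that by (simp add: powr_realpow[symmetric] powr_add powr_minus field_simps)
    then show "ennreal (t ^ CARD('n)) * g t * indicator {0<..} t = ennreal (t powr (- 2 * s)) * indicator {0<..<d} t"
      by (auto simp: g_def ennreal_mult'[symmetric] split: split_indicator)
  qed
  also have "\<dots> = ennreal (d powr (- 2 * s + 1) / (- 2 * s + 1))"
    using assms by (intro nn_integral_powr_below) auto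
  also have "- 2 * s + 1 = 1 - 2 * s" by simp
  finally show ?thesis using assms by (simp add: ennreal_mult'[symmetric])
qed

text \<open>The case p = 1 blows up like 1 / (1 - 2 s) and prices the gluing of sets; the case p = 2
  stays bounded as s tends to 1/2 and measures Taylor errors.\<close>

lemma nn_integral_kernel_near:
  assumes "s < 1/2" "d > 0" "p \<ge> 1"
  shows "(\<integral>\<^sup>+h. ennreal (norm h ^ p) * riesz_kernel s h * indicator (ball 0 d) h \<partial>(lborel :: (real^'n) measure))
    = ennreal (real CARD('n) * unit_ball_vol (real CARD('n)) * (d powr (real p - 2 * s) / (real p - 2 * s)))"
proof -
  define g :: "real \<Rightarrow> ennreal"
    where "g t = ennreal (t ^ p) * ennreal (1 / t powr (real CARD('n) + 2 * s)) * indicator {..<d} t" for t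
  have [measurable]: "g \<in> borel_measurable borel" unfolding g_def[abs_def] by measurable
  have p: "real p \<ge> 1" using assms by simp
  have "(\<integral>\<^sup>+h. ennreal (norm h ^ p) * riesz_kernel s h * indicator (ball 0 d) h \<partial>(lborel :: (real^'n) measure))
      = (\<integral>\<^sup>+h. g (norm h) \<partial>(lborel :: (real^'n) measure))"
    by (intro nn_integral_cong) (auto simp: g_def riesz_kernel_def split: split_indicator)
  also have "\<dots> = ennreal (real CARD('n) * unit_ball_vol (real CARD('n))) *
      (\<integral>\<^sup>+t. ennreal (t ^ (CARD('n) - 1)) * g t * indicator {0<..} t \<partial>lborel)"
    by (subst nn_integral_radial) auto
  also have "(\<integral>\<^sup>+t. ennreal (t ^ (CARD('n) - 1)) * g t * indicator {0<..} t \<partial>lborel)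
      = (\<integral>\<^sup>+t. ennreal (t powr (real p - 1 - 2 * s)) * indicator {0<..<d} t \<partial>lborel)"
  proof (rule nn_integral_cong)
    fix t :: real
    have "t ^ (CARD('n) - 1) * (t ^ p * (1 / t powr (real CARD('n) + 2 * s))) = t powr (real p - 1 - 2 * s)" if "t > 0"
    proof -
      have "t ^ (CARD('n) - 1) = t powr (real CARD('n) - 1)"
        using that by (simp add: powr_realpow[symmetric] of_nat_diff Suc_leI)
      then show ?thesis
        using that by (simp add: powr_realpow[symmetric] powr_add powr_diff field_simps)
    qed
    then show "ennreal (t ^ (CARD('n) - 1)) * g t * indicator {0<..} t
        = ennreal (t powr (real p - 1 - 2 * s)) * indicator {0<..<d} t"
      by (auto simp: g_def ennreal_mult'[symmetric] mult.assoc split: split_indicator)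
  qed
  also have "\<dots> = ennreal (d powr (real p - 1 - 2 * s + 1) / (real p - 1 - 2 * s + 1))"
    using assms p by (intro nn_integral_powr_below) auto
  also have "real p - 1 - 2 * s + 1 = real p - 2 * s" by simp
  finally show ?thesis using assms p by (simp add: ennreal_mult'[symmetric])
qed

lemma nn_integral_kernel_far:
  assumes "s > 0" "d > 0"
  shows "(\<integral>\<^sup>+h. riesz_kernel s h * indicator (- ball 0 d) h \<partial>(lborel :: (real^'n) measure))
    = ennreal (real CARD('n) * unit_ball_vol (real CARD('n)) * (d powr (- 2 * s) / (2 * s)))"
proof -
  define g :: "real \<Rightarrow> ennreal"
    where "g t = ennreal (1 / t powr (real CARD('n) + 2 * s)) * indicator {d..} t" for t
  have [measurable]: "g \<in> borel_measurable borel" unfolding g_def[abs_def] by measurable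
  have "(\<integral>\<^sup>+h. riesz_kernel s h * indicator (- ball 0 d) h \<partial>(lborel :: (real^'n) measure))
      = (\<integral>\<^sup>+h. g (norm h) \<partial>(lborel :: (real^'n) measure))"
    by (intro nn_integral_cong) (auto simp: g_def riesz_kernel_def split: split_indicator)
  also have "\<dots> = ennreal (real CARD('n) * unit_ball_vol (real CARD('n))) *
      (\<integral>\<^sup>+t. ennreal (t ^ (CARD('n) - 1)) * g t * indicator {0<..} t \<partial>lborel)"
    by (subst nn_integral_radial) auto
  also have "(\<integral>\<^sup>+t. ennreal (t ^ (CARD('n) - 1)) * g t * indicator {0<..} t \<partial>lborel)
      = (\<integral>\<^sup>+t. ennreal (t powr (- 1 - 2 * s)) * indicator {d..} t \<partial>lborel)"
  proof (rule nn_integral_cong)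
    fix t :: real
    have "t ^ (CARD('n) - 1) * (1 / t powr (real CARD('n) + 2 * s)) = t powr (- 1 - 2 * s)" if "t > 0"
    proof -
      have "t ^ (CARD('n) - 1) = t powr (real CARD('n) - 1)"
        using that by (simp add: powr_realpow[symmetric] of_nat_diff Suc_leI)
      then show ?thesis
        using that by (simp add: powr_add powr_diff powr_minus field_simps)
    qed
    then show "ennreal (t ^ (CARD('n) - 1)) * g t * indicator {0<..} t
        = ennreal (t powr (- 1 - 2 * s)) * indicator {d..} t"
      using assms by (auto simp: g_def ennreal_mult'[symmetric] split: split_indicator)
  qed
  also have "\<dots> = ennreal (d powr (- 1 - 2 * s + 1) / (- (- 1 - 2 * s) - 1))"
    using assms by (intro nn_integral_powr_above) auto
  also have "- 1 - 2 * s + 1 = - 2 * s" by simp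
  also have "- (- 1 - 2 * s) - 1 = 2 * s" by simp
  finally show ?thesis using assms by (simp add: ennreal_mult'[symmetric])
qed

section \<open>Mollification of sets\<close>

lemma integrable_bounded_support:
  fixes f :: "'a::euclidean_space \<Rightarrow> 'b::{banach, second_countable_topology}"
  assumes [measurable]: "f \<in> borel_measurable borel"
    and "\<And>x. norm (f x) \<le> C" "\<And>x. x \<notin> S \<Longrightarrow> f x = 0" "bounded S"
  shows "integrable lborel f"
proof -
  obtain R where R: "\<And>x. x \<in> S \<Longrightarrow> norm x \<le> R" using \<open>bounded S\<close> by (auto simp: bounded_iff)
  have "integrable lborel (indicator (cball 0 R) :: 'a \<Rightarrow> real)"
    by (intro integrable_real_indicator emeasure_lborel_cball_finite) simp
  then have "integrable lborel (\<lambda>x. C * indicator (cball (0::'a) R) x :: real)" by simp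
  then show ?thesis
  proof (rule Bochner_Integration.integrable_bound)
    show "AE x in lborel. norm (f x) \<le> norm (C * indicator (cball 0 R) x :: real)"
    proof (rule AE_I2)
      fix x
      show "norm (f x) \<le> norm (C * indicator (cball 0 R) x :: real)"
        using assms(2)[of x] assms(3)[of x] R[of x] by (cases "x \<in> S") (auto simp: indicator_def)
    qed
  qed simp
qed

lemma integrable_const_indicator:
  fixes A :: "'a::euclidean_space set"
  assumes "A \<in> sets borel" "bounded A"
  shows "integrable lborel (\<lambda>x. c * indicator A x :: real)"
  using assms emeasure_bounded_finite[of A]
  by (intro integrable_mult_right integrable_real_indicator) auto

lemma continuous_compact_support_bounded:
  fixes f :: "'a::euclidean_space \<Rightarrow> 'b::real_normed_vector"
  assumes "continuous_on UNIV f" "\<And>x. x \<notin> S \<Longrightarrow> f x = 0" "bounded S"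
  shows "\<exists>C\<ge>0. \<forall>x. norm (f x) \<le> C"
proof -
  have "compact (f ` closure S)"
    using assms by (intro compact_continuous_image continuous_on_subset[OF assms(1)]) (auto simp: compact_closure)
  then obtain C where C: "\<And>y. y \<in> f ` closure S \<Longrightarrow> norm y \<le> C"
    using compact_imp_bounded bounded_iff by metis
  have "norm (f x) \<le> max C 0" for x
    using C[of "f x"] assms(2)[of x] closure_subset[of S] by (cases "x \<in> S") (auto simp: le_max_iff_disj)
  then show ?thesis by (intro exI[of _ "max C 0"]) simp
qed

lemma has_derivative_quadratic_remainder:
  fixes f :: "'a::real_normed_vector \<Rightarrow> 'b::real_normed_vector"
  assumes F: "bounded_linear F"
    and K: "\<And>h. norm h \<le> 1 \<Longrightarrow> norm (f (y + h) - f y - F h) \<le> K * (norm h)\<^sup>2"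
  shows "(f has_derivative F) (at y)"
  unfolding has_derivative_at
proof (intro conjI F)
  show "(\<lambda>h. norm (f (y + h) - f y - F h) / norm h) \<midarrow>0\<rightarrow> 0"
  proof (rule Lim_null_comparison)
    show "\<forall>\<^sub>F h in at 0. norm (norm (f (y + h) - f y - F h) / norm h) \<le> K * norm h"
      unfolding eventually_at
    proof (intro exI[of _ 1] conjI ballI impI)
      fix h :: 'a assume "h \<noteq> 0 \<and> dist h 0 < 1"
      then have "norm h > 0" "norm (f (y + h) - f y - F h) \<le> (K * norm h) * norm h"
        using K[of h] by (auto simp: power2_eq_square mult.assoc)
      then show "norm (norm (f (y + h) - f y - F h) / norm h) \<le> K * norm h"
        by (simp only: real_norm_def abs_divide abs_norm_cancel pos_divide_le_eq)
    qed (rule zero_less_one)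
    show "(\<lambda>h::'a. K * norm h) \<midarrow>0\<rightarrow> 0"
      by (rule tendsto_eq_rhs[OF tendsto_mult[OF tendsto_const tendsto_norm[OF tendsto_ident_at]]]) simp
  qed
qed

text \<open>\<open>D\<close> plays the role of the gradient of \<open>\<rho>\<close>. Only a
  quadratic Taylor remainder is asked for; its constant \<open>L\<close> is uniform in
  \<open>z\<close>, so it passes to the convolution with any set, with a constant independent of
  that set.\<close>

locale mollifier =
  fixes \<epsilon> :: real and \<rho> :: "real^'n \<Rightarrow> real" and D :: "real^'n \<Rightarrow> real^'n" and L :: real
  assumes eps: "\<epsilon> > 0"
    and rho_nonneg: "0 \<le> \<rho> z"
    and rho_zero: "\<epsilon> \<le> norm z \<Longrightarrow> \<rho> z = 0"
    and D_zero: "\<epsilon> \<le> norm z \<Longrightarrow> D z = 0"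
    and rho_cont: "continuous_on UNIV \<rho>"
    and D_cont: "continuous_on UNIV D"
    and rho_integral: "(\<integral>z. \<rho> z \<partial>lborel) = 1"
    and L: "0 \<le> L"
    and remainder: "norm h \<le> 1 \<Longrightarrow> \<bar>\<rho> (z + h) - \<rho> z - D z \<bullet> h\<bar> \<le> L * (norm h)\<^sup>2"

text \<open>The function t -> (max 0 t)^2 has the Lipschitz derivative 2 max 0 t, and its Taylor
  remainder is at most that of t^2. The four cases are the signs of the two points.\<close>

lemma positive_part_square_remainder:
  "\<bar>(max 0 b)\<^sup>2 - (max 0 a)\<^sup>2 - 2 * max 0 a * (b - a)\<bar> \<le> (b - a)\<^sup>2" for a b :: real
proof (cases "a \<ge> 0"; cases "b \<ge> 0")
  assume "a \<ge> 0" "b \<ge> 0"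
  moreover have "b\<^sup>2 - a\<^sup>2 - 2 * a * (b - a) = (b - a)\<^sup>2" by (simp add: power2_eq_square algebra_simps)
  ultimately show ?thesis by simp
next
  assume ab: "a \<ge> 0" "\<not> b \<ge> 0"
  then have "a * b \<le> 0" by (simp add: mult_nonneg_nonpos)
  moreover have "(b - a)\<^sup>2 = b\<^sup>2 + a\<^sup>2 - 2 * (a * b)" "2 * a * (b - a) = 2 * (a * b) - 2 * a\<^sup>2"
    by (simp_all add: power2_eq_square algebra_simps)
  moreover have "0 \<le> a\<^sup>2" "0 \<le> b\<^sup>2" by simp_all
  ultimately have "\<bar>0 - a\<^sup>2 - 2 * a * (b - a)\<bar> \<le> (b - a)\<^sup>2" by linarith
  then show ?thesis using ab by (simp add: max_def)
next
  assume ab: "\<not> a \<ge> 0" "b \<ge> 0"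
  then have "a * b \<le> 0" by (simp add: mult_nonpos_nonneg)
  moreover have "(b - a)\<^sup>2 = b\<^sup>2 + a\<^sup>2 - 2 * (a * b)"
    by (simp add: power2_eq_square algebra_simps)
  moreover have "0 \<le> a\<^sup>2" "0 \<le> b\<^sup>2" by simp_all
  ultimately have "\<bar>b\<^sup>2\<bar> \<le> (b - a)\<^sup>2" by linarith
  then show ?thesis using ab by (simp add: max_def)
next
  assume "\<not> a \<ge> 0" "\<not> b \<ge> 0" then show ?thesis by (simp add: max_def)
qed

lemma mollifier_exists:
  assumes "\<epsilon> > 0"
  shows "\<exists>\<rho> (D :: real^'n \<Rightarrow> real^'n) L. mollifier \<epsilon> \<rho> D L"
proof -
  \<comment> \<open>The bump is the normalized square of the positive part of \<epsilon>^2 - |z|^2,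
    whose gradient -4 w z is continuous across the sphere of radius \<epsilon>.\<close>
  define w where "w z = max 0 (\<epsilon>\<^sup>2 - (norm z)\<^sup>2)" for z :: "real^'n"
  define b where "b z = (w z)\<^sup>2" for z
  define c where "c = (\<integral>z. b z \<partial>lborel)"
  \<comment> \<open>The first summand covers the squared increment of |z|^2, which is at most ((2
    \<epsilon> + 3) |h|)^2 for |z| \<le> \<epsilon> + 1 and |h| \<le> 1. The second covers the term
    2 w |h|^2 left from that increment, since w \<le> \<epsilon>^2.\<close>
  define L where "L = (2 * \<epsilon> + 3)\<^sup>2 + 2 * \<epsilon>\<^sup>2"
  have w0: "w z = 0" if "\<epsilon> \<le> norm z" for z
    using that assms power_mono[of \<epsilon> "norm z" 2] by (simp add: w_def)
  have w1: "0 \<le> w z" "w z \<le> \<epsilon>\<^sup>2" for z by (auto simp: w_def)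
  have bc: "continuous_on UNIV b" unfolding b_def w_def by (intro continuous_intros)
  then have [measurable]: "b \<in> borel_measurable borel" by (rule borel_measurable_continuous_onI)
  have bi: "integrable lborel b"
  proof (rule integrable_bounded_support[where C="(\<epsilon>\<^sup>2)\<^sup>2" and S="ball 0 \<epsilon>"])
    show "norm (b x) \<le> (\<epsilon>\<^sup>2)\<^sup>2" for x unfolding b_def using power_mono[OF w1(2)[of x] w1(1)[of x], of 2] by simp
  qed (auto simp: b_def[of x for x] w0)
  have rem: "\<bar>b (z + h) - b z - (- 4 * w z) *\<^sub>R z \<bullet> h\<bar> \<le> L * (norm h)\<^sup>2" if h: "norm h \<le> 1" for z h
  proof (cases "norm z \<le> \<epsilon> + 1")
    case True
    define p q where "p = \<epsilon>\<^sup>2 - (norm z)\<^sup>2" and "q = \<epsilon>\<^sup>2 - (norm (z + h))\<^sup>2"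
    have qp: "q - p = - 2 * (z \<bullet> h) - (norm h)\<^sup>2"
      by (simp add: p_def q_def power2_norm_eq_inner inner_add inner_commute)
    have "\<bar>q - p\<bar> \<le> 2 * (norm z * norm h) + (norm h)\<^sup>2"
      using Cauchy_Schwarz_ineq2[of z h] zero_le_power2[of "norm h"] unfolding qp by linarith
    also have "\<dots> \<le> 2 * ((\<epsilon> + 1) * norm h) + norm h * 1"
      unfolding power2_eq_square using h True by (intro add_mono mult_left_mono mult_right_mono) auto
    also have "\<dots> = (2 * \<epsilon> + 3) * norm h" by (simp add: algebra_simps)
    finally have "\<bar>q - p\<bar>\<^sup>2 \<le> ((2 * \<epsilon> + 3) * norm h)\<^sup>2" by (intro power_mono) auto
    then have "(q - p)\<^sup>2 \<le> (2 * \<epsilon> + 3)\<^sup>2 * (norm h)\<^sup>2" by (simp add: power_mult_distrib)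
    moreover have "\<bar>(max 0 q)\<^sup>2 - (max 0 p)\<^sup>2 - 2 * max 0 p * (q - p)\<bar> \<le> (q - p)\<^sup>2"
      by (rule positive_part_square_remainder)
    moreover have "2 * max 0 p * (norm h)\<^sup>2 \<le> 2 * \<epsilon>\<^sup>2 * (norm h)\<^sup>2"
      using w1[of z] by (intro mult_right_mono) (auto simp: w_def p_def)
    moreover have "0 \<le> 2 * max 0 p * (norm h)\<^sup>2" by simp
    moreover have "b (z + h) - b z - (- 4 * w z) *\<^sub>R z \<bullet> h
        = ((max 0 q)\<^sup>2 - (max 0 p)\<^sup>2 - 2 * max 0 p * (q - p)) - 2 * max 0 p * (norm h)\<^sup>2"
      unfolding qp by (simp add: b_def w_def p_def q_def algebra_simps)
    ultimately have "\<bar>b (z + h) - b z - (- 4 * w z) *\<^sub>R z \<bullet> h\<bar> \<le> (2 * \<epsilon> + 3)\<^sup>2 * (norm h)\<^sup>2 + 2 * \<epsilon>\<^sup>2 * (norm h)\<^sup>2"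
      by linarith
    then show ?thesis unfolding L_def by (simp add: distrib_right)
  next
    case False
    then have "norm (z + h) \<ge> \<epsilon>" using norm_diff_triangle_ineq[of z h 0 h] norm_triangle_ineq2[of z "-h"] h by simp
    then show ?thesis using False assms by (simp add: b_def w0 L_def)
  qed
  have c: "c > 0"
  proof -
    have "0 < (\<integral>z. (3/4 * \<epsilon>\<^sup>2)\<^sup>2 * indicator (ball 0 (\<epsilon>/2)) z \<partial>(lborel :: (real^'n) measure))"
      using assms content_ball_pos[of "\<epsilon>/2" "0::real^'n"] by simp
    also have "\<dots> \<le> c" unfolding c_def
    proof (rule integral_mono)
      show "integrable lborel (\<lambda>z::real^'n. (3/4 * \<epsilon>\<^sup>2)\<^sup>2 * indicator (ball 0 (\<epsilon>/2)) z :: real)"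
        by (intro integrable_const_indicator) auto
      show "(3/4 * \<epsilon>\<^sup>2)\<^sup>2 * indicator (ball 0 (\<epsilon>/2)) z \<le> b z" for z
      proof (cases "norm z < \<epsilon>/2")
        case True
        then have "(norm z)\<^sup>2 \<le> (\<epsilon>/2)\<^sup>2" by (intro power_mono) auto
        then have "3/4 * \<epsilon>\<^sup>2 \<le> \<epsilon>\<^sup>2 - (norm z)\<^sup>2" by (simp add: power_divide)
        then have "3/4 * \<epsilon>\<^sup>2 \<le> w z" unfolding w_def by linarith
        then show ?thesis using True by (auto simp: b_def intro!: power_mono)
      qed (simp add: b_def)
    qed (rule bi)
    finally show ?thesis .
  qed
  have m: "mollifier \<epsilon> (\<lambda>z. b z / c) (\<lambda>z. (- 4 * w z / c) *\<^sub>R z) (L / c)"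
  proof
    show "continuous_on UNIV (\<lambda>z. b z / c)" using c by (intro continuous_intros bc) auto
    show "continuous_on UNIV (\<lambda>z. (- 4 * w z / c) *\<^sub>R z)"
      using c unfolding w_def by (intro continuous_intros) auto
    show "(\<integral>z. b z / c \<partial>lborel) = 1" using c by (simp add: c_def)
    show "\<bar>b (z + h) / c - b z / c - (- 4 * w z / c) *\<^sub>R z \<bullet> h\<bar> \<le> L / c * (norm h)\<^sup>2" if "norm h \<le> 1" for z h
    proof -
      have "b (z + h) / c - b z / c - (- 4 * w z / c) *\<^sub>R z \<bullet> h = (b (z + h) - b z - (- 4 * w z) *\<^sub>R z \<bullet> h) / c"
        using c by (simp add: divide_simps algebra_simps)
      then show ?thesis using rem[OF that, of z] c by (simp add: abs_divide divide_right_mono)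
    qed
  qed (use assms c w0 in \<open>auto simp: b_def L_def\<close>)
  show ?thesis by (rule exI, rule exI, rule exI, rule m)
qed

context mollifier
begin

lemma rho_measurable [measurable]: "\<rho> \<in> borel_measurable borel"
  using rho_cont by (rule borel_measurable_continuous_onI)

lemma D_measurable [measurable]: "D \<in> borel_measurable borel"
  using D_cont by (rule borel_measurable_continuous_onI)

lemma rho_bound: "\<exists>C\<ge>0. \<forall>z. norm (\<rho> z) \<le> C"
proof (rule continuous_compact_support_bounded[OF rho_cont, of "ball 0 \<epsilon>"])
  show "\<rho> x = 0" if "x \<notin> ball 0 \<epsilon>" for x using that by (simp add: rho_zero)
qed (rule bounded_ball)

lemma D_bound: "\<exists>C\<ge>0. \<forall>z. norm (D z) \<le> C"
proof (rule continuous_compact_support_bounded[OF D_cont, of "ball 0 \<epsilon>"])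
  show "D x = 0" if "x \<notin> ball 0 \<epsilon>" for x using that by (simp add: D_zero)
qed (rule bounded_ball)

lemma rho_nn_integral: "(\<integral>\<^sup>+z. ennreal (\<rho> z) \<partial>lborel) = 1"
proof -
  obtain C where "C \<ge> 0" and "\<And>z. norm (\<rho> z) \<le> C" using rho_bound by blast
  then have "integrable lborel \<rho>"
    by (intro integrable_bounded_support[where S="ball 0 \<epsilon>" and C=C]) (auto simp: rho_zero)
  then show ?thesis using nn_integral_eq_integral[of lborel \<rho>] rho_nonneg rho_integral by simp
qed

lemma rho_nn_integral_shift: "(\<integral>\<^sup>+y. ennreal (\<rho> (x - y)) \<partial>lborel) = 1" "(\<integral>\<^sup>+x. ennreal (\<rho> (x - y)) \<partial>lborel) = 1"
proof -
  have "(\<integral>\<^sup>+y. ennreal (\<rho> (x - y)) \<partial>lborel) = (\<integral>\<^sup>+y. ennreal (\<rho> (x + y)) \<partial>lborel)"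
    using nn_integral_lborel_uminus[of "\<lambda>y. ennreal (\<rho> (x + y))"] by simp
  then show "(\<integral>\<^sup>+y. ennreal (\<rho> (x - y)) \<partial>lborel) = 1"
    using nn_integral_lborel_shift[of "\<lambda>y. ennreal (\<rho> y)" x] rho_nn_integral by (simp add: add.commute)
  show "(\<integral>\<^sup>+x. ennreal (\<rho> (x - y)) \<partial>lborel) = 1"
    using nn_integral_lborel_shift[of "\<lambda>y. ennreal (\<rho> y)" "-y"] rho_nn_integral by simp
qed

lemma integrable_rho_mult:
  fixes f :: "real^'n \<Rightarrow> 'b::{banach, second_countable_topology}"
  assumes [measurable]: "f \<in> borel_measurable borel" and B: "\<And>x. norm (f x) \<le> B"
  shows "integrable lborel (\<lambda>y. \<rho> (x - y) *\<^sub>R f y)" "integrable lborel (\<lambda>y. \<rho> (y - x) *\<^sub>R f y)"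
proof -
  obtain C where C: "C \<ge> 0" "\<And>z. norm (\<rho> z) \<le> C" using rho_bound by blast
  have n: "norm (\<rho> z *\<^sub>R f y) \<le> C * B" for z y
    using C(2)[of z] B[of y] C(1) by (auto intro!: mult_mono)
  have z: "\<rho> (x - y) = 0" "\<rho> (y - x) = 0" if "y \<notin> ball x \<epsilon>" for y
    using that by (simp_all add: rho_zero dist_norm norm_minus_commute[of y])
  show "integrable lborel (\<lambda>y. \<rho> (x - y) *\<^sub>R f y)"
  proof (rule integrable_bounded_support[where S="ball x \<epsilon>" and C="C * B"])
    show "\<rho> (x - y) *\<^sub>R f y = 0" if "y \<notin> ball x \<epsilon>" for y using z[OF that] by simp
    show "(\<lambda>y. \<rho> (x - y) *\<^sub>R f y) \<in> borel_measurable borel" by measurable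
    show "norm (\<rho> (x - y) *\<^sub>R f y) \<le> C * B" for y by (rule n)
  qed (rule bounded_ball)
  show "integrable lborel (\<lambda>y. \<rho> (y - x) *\<^sub>R f y)"
  proof (rule integrable_bounded_support[where S="ball x \<epsilon>" and C="C * B"])
    show "\<rho> (y - x) *\<^sub>R f y = 0" if "y \<notin> ball x \<epsilon>" for y using z[OF that] by simp
    show "(\<lambda>y. \<rho> (y - x) *\<^sub>R f y) \<in> borel_measurable borel" by measurable
    show "norm (\<rho> (y - x) *\<^sub>R f y) \<le> C * B" for y by (rule n)
  qed (rule bounded_ball)
qed

lemma integrable_D_mult:
  assumes [measurable]: "f \<in> borel_measurable borel" and B: "\<And>x. norm (f x) \<le> B"
  shows "integrable lborel (\<lambda>y. (f y :: real) *\<^sub>R D (x - y))" "integrable lborel (\<lambda>y. f y *\<^sub>R D (y - x))"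
proof -
  obtain C where C: "C \<ge> 0" "\<And>z. norm (D z) \<le> C" using D_bound by blast
  have n: "norm (f y *\<^sub>R D z) \<le> B * C" for z y
    unfolding norm_scaleR using C(2)[of z] B[of y] order_trans[OF norm_ge_zero B[of y]]
    by (intro mult_mono) auto
  have z: "D (x - y) = 0" "D (y - x) = 0" if "y \<notin> ball x \<epsilon>" for y
    using that by (simp_all add: D_zero dist_norm norm_minus_commute[of y])
  show "integrable lborel (\<lambda>y. f y *\<^sub>R D (x - y))"
  proof (rule integrable_bounded_support[where S="ball x \<epsilon>" and C="B * C"])
    show "f y *\<^sub>R D (x - y) = 0" if "y \<notin> ball x \<epsilon>" for y using z[OF that] by simp
    show "(\<lambda>y. f y *\<^sub>R D (x - y)) \<in> borel_measurable borel" by measurable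
    show "norm (f y *\<^sub>R D (x - y)) \<le> B * C" for y by (rule n)
  qed (rule bounded_ball)
  show "integrable lborel (\<lambda>y. f y *\<^sub>R D (y - x))"
  proof (rule integrable_bounded_support[where S="ball x \<epsilon>" and C="B * C"])
    show "f y *\<^sub>R D (y - x) = 0" if "y \<notin> ball x \<epsilon>" for y using z[OF that] by simp
    show "(\<lambda>y. f y *\<^sub>R D (y - x)) \<in> borel_measurable borel" by measurable
    show "norm (f y *\<^sub>R D (y - x)) \<le> B * C" for y by (rule n)
  qed (rule bounded_ball)
qed

definition smooth :: "(real^'n) set \<Rightarrow> real^'n \<Rightarrow> real"
  where "smooth E x = (\<integral>y. \<rho> (x - y) * indicator E y \<partial>lborel)"

definition grad :: "(real^'n) set \<Rightarrow> real^'n \<Rightarrow> real^'n"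
  where "grad E x = (\<integral>y. indicator E y *\<^sub>R D (x - y) \<partial>lborel)"

lemma smooth_measurable [measurable]:
  assumes [measurable]: "E \<in> sets borel"
  shows "smooth E \<in> borel_measurable borel"
  unfolding smooth_def[abs_def] by measurable

lemma grad_measurable [measurable]:
  assumes [measurable]: "E \<in> sets borel"
  shows "grad E \<in> borel_measurable borel"
  unfolding grad_def[abs_def] by measurable

lemma grad_bound: "\<exists>C. \<forall>E\<in>sets borel. \<forall>x. norm (grad E x) \<le> C"
proof -
  obtain C where C: "C \<ge> 0" "\<And>z. norm (D z) \<le> C" using D_bound by blast
  have "norm (grad E x) \<le> C * measure lborel (ball (0::real^'n) \<epsilon>)" if [measurable]: "E \<in> sets borel" for E x
  proof -
    have "norm (grad E x) \<le> (\<integral>y. norm (indicator E y *\<^sub>R D (x - y) :: real^'n) \<partial>lborel)"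
      unfolding grad_def by (rule integral_norm_bound)
    also have "\<dots> \<le> (\<integral>y. C * indicator (ball x \<epsilon>) y \<partial>lborel)"
    proof (rule integral_mono)
      show "integrable lborel (\<lambda>y. norm (indicator E y *\<^sub>R D (x - y)))"
        by (intro integrable_norm integrable_D_mult(1)[where B=1]) (auto simp: indicator_def)
      show "integrable lborel (\<lambda>y. C * indicator (ball x \<epsilon>) y)"
        by (intro integrable_const_indicator) auto
      show "norm (indicator E y *\<^sub>R D (x - y)) \<le> C * indicator (ball x \<epsilon>) y" for y
        using C(1) C(2)[of "x - y"] D_zero[of "x - y"] by (auto simp: indicator_def dist_norm)
    qed
    also have "\<dots> = C * measure lborel (ball (0::real^'n) \<epsilon>)"
      using content_ball_conv_unit_ball[of \<epsilon> x] content_ball_conv_unit_ball[of \<epsilon> "0::real^'n"] eps by simp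
    finally show ?thesis .
  qed
  then show ?thesis by blast
qed

text \<open>The remainder of \<open>\<rho>\<close> is integrated over the points where
  \<open>\<rho>\<close> or its translate by a vector of length at most 1 can be nonzero, whence the
  radius \<epsilon> + 1 in the constant. One \<open>K\<close> serves all Borel sets, hence a whole
  sequence of them.\<close>

lemma smooth_remainder:
  "\<exists>K\<ge>0. \<forall>E\<in>sets borel. \<forall>x h. norm h \<le> 1 \<longrightarrow>
    \<bar>smooth E (x + h) - smooth E x - grad E x \<bullet> h\<bar> \<le> K * (norm h)\<^sup>2"
proof -
  define K where "K = L * measure lborel (cball (0::real^'n) (\<epsilon> + 1))"
  have "\<bar>smooth E (x + h) - smooth E x - grad E x \<bullet> h\<bar> \<le> K * (norm h)\<^sup>2"
    if [measurable]: "E \<in> sets borel" and h: "norm h \<le> 1" for E x h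
  proof -
    have i1: "integrable lborel (\<lambda>y. \<rho> (z - y) * indicator E y)" for z
      using integrable_rho_mult(1)[of "indicator E :: _ \<Rightarrow> real" 1 z] by (auto simp: indicator_def)
    have i2: "integrable lborel (\<lambda>y. indicator E y *\<^sub>R D (x - y))"
      by (rule integrable_D_mult(1)[where B=1]) (auto simp: indicator_def)
    have i3: "integrable lborel (\<lambda>y. (indicator E y *\<^sub>R D (x - y)) \<bullet> h)"
      using i2 by (rule integrable_inner_left)
    have i4: "(\<integral>y. (indicator E y *\<^sub>R D (x - y)) \<bullet> h \<partial>lborel) = grad E x \<bullet> h"
      unfolding grad_def by (rule integral_inner_left) (rule i2)
    have eq: "smooth E (x + h) - smooth E x - grad E x \<bullet> h
       = (\<integral>y. \<rho> (x + h - y) * indicator E y - \<rho> (x - y) * indicator E y - (indicator E y *\<^sub>R D (x - y)) \<bullet> h \<partial>lborel)"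
      unfolding smooth_def i4[symmetric] using i1 i3
      by (simp only: Bochner_Integration.integral_diff Bochner_Integration.integrable_diff)
    have "\<bar>smooth E (x + h) - smooth E x - grad E x \<bullet> h\<bar>
        \<le> (\<integral>y. \<bar>\<rho> (x + h - y) * indicator E y - \<rho> (x - y) * indicator E y - (indicator E y *\<^sub>R D (x - y)) \<bullet> h\<bar> \<partial>lborel)"
      unfolding eq by (rule integral_abs_bound)
    also have "\<dots> \<le> (\<integral>y. (L * (norm h)\<^sup>2) * indicator (cball x (\<epsilon> + 1)) y \<partial>lborel)"
    proof (rule integral_mono)
      show "integrable lborel (\<lambda>y. \<bar>\<rho> (x + h - y) * indicator E y - \<rho> (x - y) * indicator E y - (indicator E y *\<^sub>R D (x - y)) \<bullet> h\<bar>)"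
        by (intro integrable_abs Bochner_Integration.integrable_diff i1 i3)
      show "integrable lborel (\<lambda>y. (L * (norm h)\<^sup>2) * indicator (cball x (\<epsilon> + 1)) y)"
        by (intro integrable_const_indicator) auto
      show "\<bar>\<rho> (x + h - y) * indicator E y - \<rho> (x - y) * indicator E y - (indicator E y *\<^sub>R D (x - y)) \<bullet> h\<bar>
          \<le> (L * (norm h)\<^sup>2) * indicator (cball x (\<epsilon> + 1)) y" for y
      proof (cases "dist x y \<le> \<epsilon> + 1")
        case True
        then show ?thesis using remainder[OF h, of "x - y"] L by (auto simp: indicator_def algebra_simps)
      next
        case False
        then have "norm (x - y) \<ge> \<epsilon>" "norm (x + h - y) \<ge> \<epsilon>"
          using h norm_triangle_ineq2[of "x - y" "- h"] by (auto simp: dist_norm algebra_simps)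
        then show ?thesis using L by (simp add: rho_zero D_zero)
      qed
    qed
    also have "\<dots> = K * (norm h)\<^sup>2"
      using eps by (simp add: K_def content_cball)
    finally show ?thesis .
  qed
  moreover have "K \<ge> 0" by (simp add: K_def L)
  ultimately show ?thesis by blast
qed

end

section \<open>Compactly supported test fields\<close>

lemma borel_measurable_vec_nth [measurable (raw)]:
  fixes f :: "'a \<Rightarrow> real^'n"
  assumes "f \<in> borel_measurable M"
  shows "(\<lambda>x. f x $ i) \<in> borel_measurable M"
  by (rule borel_measurable_continuous_on[OF _ assms, of "\<lambda>v. v $ i"]) (intro continuous_intros)

lemma integral_lborel_shift:
  fixes g :: "'a::euclidean_space \<Rightarrow> 'b::{banach, second_countable_topology}"
  assumes [measurable]: "g \<in> borel_measurable borel"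
  shows "(\<integral>x. g (x + c) \<partial>lborel) = (\<integral>x. g x \<partial>lborel)"
proof -
  have "(\<integral>x. g x \<partial>lborel) = (\<integral>x. g x \<partial>distr lborel borel ((+) c))"
    by (simp add: lborel_distr_plus)
  also have "\<dots> = (\<integral>x. g (x + c) \<partial>lborel)"
    by (subst integral_distr) (auto simp: add.commute)
  finally show ?thesis ..
qed

lemma
  assumes "\<phi> \<in> C1_compact_support U"
  shows C1_has_derivative: "(\<phi> has_derivative frechet_derivative \<phi> (at x)) (at x)"
    and C1_continuous: "continuous_on UNIV \<phi>"
    and C1_derivative_continuous: "continuous_on UNIV (\<lambda>x. frechet_derivative \<phi> (at x) v)"
    and C1_support: "compact (closure {x. \<phi> x \<noteq> 0})" "closure {x. \<phi> x \<noteq> 0} \<subseteq> U"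
    and C1_derivative_zero: "x \<notin> closure {x. \<phi> x \<noteq> 0} \<Longrightarrow> frechet_derivative \<phi> (at x) v = 0"
proof -
  show d: "(\<phi> has_derivative frechet_derivative \<phi> (at x)) (at x)" for x
    using assms by (simp add: C1_compact_support_def frechet_derivative_works)
  show "continuous_on UNIV \<phi>"
    using d by (auto intro!: continuous_at_imp_continuous_on has_derivative_continuous)
  show "continuous_on UNIV (\<lambda>x. frechet_derivative \<phi> (at x) v)"
    and "compact (closure {x. \<phi> x \<noteq> 0})" "closure {x. \<phi> x \<noteq> 0} \<subseteq> U"
    using assms by (simp_all add: C1_compact_support_def compactly_contained_def)
  show "frechet_derivative \<phi> (at x) v = 0" if x: "x \<notin> closure {x. \<phi> x \<noteq> 0}"
  proof -
    have "(\<phi> has_derivative (\<lambda>_. 0)) (at x)"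
    proof (rule has_derivative_transform_within_open[where f="\<lambda>_. 0" and s="- closure {x. \<phi> x \<noteq> 0}"])
      show "0 = \<phi> y" if "y \<in> - closure {x. \<phi> x \<noteq> 0}" for y
        using that closure_subset[of "{x. \<phi> x \<noteq> 0}"] by auto
    qed (use x in auto)
    then have "(\<lambda>_. 0) = frechet_derivative \<phi> (at x)" by (rule frechet_derivative_at)
    then show ?thesis by metis
  qed
qed

lemma C1_zero: "x \<notin> closure {x. \<phi> x \<noteq> 0} \<Longrightarrow> \<phi> x = 0"
  using closure_subset[of "{x. \<phi> x \<noteq> 0}"] by auto

lemma C1_measurable:
  assumes "\<phi> \<in> C1_compact_support U"
  shows "\<phi> \<in> borel_measurable borel" "(\<lambda>x. frechet_derivative \<phi> (at x) v) \<in> borel_measurable borel"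
    "divergence \<phi> \<in> borel_measurable borel"
proof -
  show "\<phi> \<in> borel_measurable borel"
    using C1_continuous[OF assms] by (rule borel_measurable_continuous_onI)
  show "(\<lambda>x. frechet_derivative \<phi> (at x) v) \<in> borel_measurable borel" for v
    using C1_derivative_continuous[OF assms] by (rule borel_measurable_continuous_onI)
  have "continuous_on UNIV (divergence \<phi>)"
    unfolding divergence_def[abs_def]
    by (intro continuous_on_sum continuous_on_component C1_derivative_continuous[OF assms])
  then show "divergence \<phi> \<in> borel_measurable borel" by (rule borel_measurable_continuous_onI)
qed

lemma divergence_continuous:
  assumes "\<phi> \<in> C1_compact_support U"
  shows "continuous_on UNIV (divergence \<phi>)"
  unfolding divergence_def[abs_def]
  by (intro continuous_on_sum continuous_on_component C1_derivative_continuous[OF assms])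

lemma divergence_zero:
  assumes "\<phi> \<in> C1_compact_support U" "x \<notin> closure {x. \<phi> x \<noteq> 0}"
  shows "divergence \<phi> x = 0"
  using C1_derivative_zero[OF assms] by (simp add: divergence_def)

lemma C1_bounds:
  assumes "\<phi> \<in> C1_compact_support U"
  shows "\<exists>C\<ge>0. \<forall>x. norm (\<phi> x) \<le> C" "\<exists>C\<ge>0. \<forall>x. norm (frechet_derivative \<phi> (at x) v) \<le> C"
    "\<exists>C\<ge>0. \<forall>x. norm (divergence \<phi> x) \<le> C"
proof -
  have b: "bounded (closure {x. \<phi> x \<noteq> 0})"
    using C1_support(1)[OF assms] by (rule compact_imp_bounded)
  show "\<exists>C\<ge>0. \<forall>x. norm (\<phi> x) \<le> C"
    using C1_zero by (rule continuous_compact_support_bounded[OF C1_continuous[OF assms] _ b])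
  show "\<exists>C\<ge>0. \<forall>x. norm (frechet_derivative \<phi> (at x) v) \<le> C"
    using C1_derivative_zero[OF assms]
    by (rule continuous_compact_support_bounded[OF C1_derivative_continuous[OF assms] _ b])
  show "\<exists>C\<ge>0. \<forall>x. norm (divergence \<phi> x) \<le> C"
    using divergence_zero[OF assms]
    by (rule continuous_compact_support_bounded[OF divergence_continuous[OF assms] _ b])
qed

lemma inv_Suc_tendsto: "(\<lambda>m. 1 / real (Suc m)) \<longlonglongrightarrow> 0"
  using LIMSEQ_inverse_real_of_nat by (simp add: inverse_eq_divide)

text \<open>The mean value theorem gives the domination, and differentiability the pointwise limit,
  needed to pass difference quotients to the limit under an integral.\<close>

lemma C1_component_difference:
  fixes \<phi> :: "real^'n \<Rightarrow> real^'n"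
  assumes "\<phi> \<in> C1_compact_support U"
  shows "\<exists>C\<ge>0. \<forall>x t. t > 0 \<longrightarrow> \<bar>(\<phi> (x + t *\<^sub>R v) $ i - \<phi> x $ i) / t\<bar> \<le> C"
    and "(\<lambda>m. (\<phi> (x + (1 / real (Suc m)) *\<^sub>R v) $ i - \<phi> x $ i) / (1 / real (Suc m)))
      \<longlonglongrightarrow> frechet_derivative \<phi> (at x) v $ i"
proof -
  have der: "((\<lambda>t. \<phi> (x + t *\<^sub>R v) $ i) has_real_derivative frechet_derivative \<phi> (at (x + t *\<^sub>R v)) v $ i) (at t)" for x t
  proof -
    have "((\<lambda>t. \<phi> (x + t *\<^sub>R v)) has_derivative (\<lambda>h. frechet_derivative \<phi> (at (x + t *\<^sub>R v)) (h *\<^sub>R v))) (at t)"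
      by (rule has_derivative_compose[where g=\<phi> and f="\<lambda>t. x + t *\<^sub>R v" and f'="\<lambda>h. h *\<^sub>R v"])
        (auto intro!: derivative_eq_intros C1_has_derivative[OF assms])
    then have "((\<lambda>t. \<phi> (x + t *\<^sub>R v) $ i) has_derivative (\<lambda>h. frechet_derivative \<phi> (at (x + t *\<^sub>R v)) (h *\<^sub>R v) $ i)) (at t)"
      by (rule bounded_linear.has_derivative[OF bounded_linear_vec_nth])
    moreover have "(\<lambda>h. frechet_derivative \<phi> (at (x + t *\<^sub>R v)) (h *\<^sub>R v) $ i) = (*) (frechet_derivative \<phi> (at (x + t *\<^sub>R v)) v $ i)"
      using linear_cmul[OF has_derivative_linear[OF C1_has_derivative[OF assms]]] by (auto simp: fun_eq_iff)
    ultimately show ?thesis by (simp add: has_field_derivative_def)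
  qed
  obtain C where C: "C \<ge> 0" "\<And>x. norm (frechet_derivative \<phi> (at x) v) \<le> C"
    using C1_bounds(2)[OF assms] by blast
  have "\<bar>(\<phi> (x + t *\<^sub>R v) $ i - \<phi> x $ i) / t\<bar> \<le> C" if "t > 0" for x t
  proof -
    obtain z where "\<phi> (x + t *\<^sub>R v) $ i - \<phi> (x + 0 *\<^sub>R v) $ i = (t - 0) * (frechet_derivative \<phi> (at (x + z *\<^sub>R v)) v $ i)"
      using MVT2[OF \<open>t > 0\<close>, of "\<lambda>t. \<phi> (x + t *\<^sub>R v) $ i" "\<lambda>t. frechet_derivative \<phi> (at (x + t *\<^sub>R v)) v $ i"] der
      by blast
    then have "(\<phi> (x + t *\<^sub>R v) $ i - \<phi> x $ i) / t = frechet_derivative \<phi> (at (x + z *\<^sub>R v)) v $ i"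
      using that by simp
    then show ?thesis
      using C(2)[of "x + z *\<^sub>R v"] component_le_norm_cart[of "frechet_derivative \<phi> (at (x + z *\<^sub>R v)) v" i] by simp
  qed
  then show "\<exists>C\<ge>0. \<forall>x t. t > 0 \<longrightarrow> \<bar>(\<phi> (x + t *\<^sub>R v) $ i - \<phi> x $ i) / t\<bar> \<le> C"
    using C(1) by blast
  have "((\<lambda>t. (\<phi> (x + t *\<^sub>R v) $ i - \<phi> x $ i) / t) \<longlongrightarrow> frechet_derivative \<phi> (at x) v $ i) (at 0)"
    using der[of x 0] by (simp add: DERIV_def)
  moreover have "filterlim (\<lambda>m. 1 / real (Suc m)) (at 0) sequentially"
    unfolding filterlim_at using inv_Suc_tendsto by auto
  ultimately show "(\<lambda>m. (\<phi> (x + (1 / real (Suc m)) *\<^sub>R v) $ i - \<phi> x $ i) / (1 / real (Suc m)))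
      \<longlonglongrightarrow> frechet_derivative \<phi> (at x) v $ i"
    by (rule filterlim_compose)
qed

section \<open>Integration by parts against the mollifier\<close>

context mollifier
begin

text \<open>Discrete integration by parts: difference quotients of the field converge by dominated
  convergence, and after a translation the same integrals carry the quotient on
  \<open>\<rho>\<close>, where the quadratic remainder gives the limit with an explicit
  rate.\<close>

lemma mollified_partial:
  fixes \<phi> :: "real^'n \<Rightarrow> real^'n"
  assumes phi: "\<phi> \<in> C1_compact_support U"
  shows "(\<integral>x. \<rho> (x - y) * (frechet_derivative \<phi> (at x) v $ i) \<partial>lborel) = - (\<integral>x. (D (x - y) \<bullet> v) * \<phi> x $ i \<partial>lborel)"
proof -
  define u where "u x = \<phi> x $ i" for x
  define t where "t m = 1 / real (Suc m)" for m
  define A where "A m = (\<integral>x. \<rho> (x - y) * ((u (x + t m *\<^sub>R v) - u x) / t m) \<partial>lborel)" for m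
  have t: "t m > 0" for m by (simp add: t_def)
  note [measurable] = C1_measurable[OF phi]
  have [measurable]: "u \<in> borel_measurable borel" unfolding u_def[abs_def] by measurable
  obtain Cu where Cu: "Cu \<ge> 0" "\<And>x. norm (\<phi> x) \<le> Cu" using C1_bounds(1)[OF phi] by blast
  have un: "norm (u x) \<le> Cu" for x
    using Cu(2)[of x] component_le_norm_cart[of "\<phi> x" i] by (simp add: u_def)
  obtain C where C: "C \<ge> 0" "\<And>x t. t > 0 \<Longrightarrow> \<bar>(u (x + t *\<^sub>R v) - u x) / t\<bar> \<le> C"
    using C1_component_difference(1)[OF phi, of v i] unfolding u_def by blast
  obtain Cd where Cd: "Cd \<ge> 0" "\<And>z. norm (D z) \<le> Cd" using D_bound by blast
  have iu: "integrable lborel u"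
  proof (rule integrable_bounded_support[where S="closure {x. \<phi> x \<noteq> 0}" and C=Cu])
    show "u x = 0" if "x \<notin> closure {x. \<phi> x \<noteq> 0}" for x using C1_zero[OF that] by (simp add: u_def)
    show "bounded (closure {x. \<phi> x \<noteq> 0})" using C1_support(1)[OF phi] by (rule compact_imp_bounded)
    show "norm (u x) \<le> Cu" for x by (rule un)
  qed simp
  have lim1: "A \<longlonglongrightarrow> (\<integral>x. \<rho> (x - y) * (frechet_derivative \<phi> (at x) v $ i) \<partial>lborel)"
    unfolding A_def
  proof (rule integral_dominated_convergence[where w="\<lambda>x. \<rho> (x - y) * C"])
    show "integrable lborel (\<lambda>x. \<rho> (x - y) * C)"
      using integrable_rho_mult(2)[of "\<lambda>_. C" "norm C" y] by simp
    show "AE x in lborel. (\<lambda>m. \<rho> (x - y) * ((u (x + t m *\<^sub>R v) - u x) / t m)) \<longlonglongrightarrow> \<rho> (x - y) * (frechet_derivative \<phi> (at x) v $ i)"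
      using C1_component_difference(2)[OF phi] unfolding u_def t_def
      by (intro AE_I2 tendsto_mult tendsto_const)
    show "AE x in lborel. norm (\<rho> (x - y) * ((u (x + t m *\<^sub>R v) - u x) / t m)) \<le> \<rho> (x - y) * C" for m
    proof (rule AE_I2)
      fix x
      show "norm (\<rho> (x - y) * ((u (x + t m *\<^sub>R v) - u x) / t m)) \<le> \<rho> (x - y) * C"
        unfolding real_norm_def abs_mult abs_of_nonneg[OF rho_nonneg]
        by (intro mult_left_mono C(2) t rho_nonneg)
    qed
  qed measurable
  have iD: "integrable lborel (\<lambda>x. (D (x - y) \<bullet> v) * u x)"
  proof (rule integrable_bounded_support[where S="ball y \<epsilon>" and C="Cd * norm v * Cu"])
    show "(D (x - y) \<bullet> v) * u x = 0" if "x \<notin> ball y \<epsilon>" for x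
      using that by (simp add: D_zero dist_norm norm_minus_commute)
    show "norm ((D (x - y) \<bullet> v) * u x) \<le> Cd * norm v * Cu" for x
    proof -
      have "\<bar>D (x - y) \<bullet> v\<bar> \<le> Cd * norm v"
        using Cauchy_Schwarz_ineq2[of "D (x - y)" v] mult_right_mono[OF Cd(2)[of "x - y"] norm_ge_zero[of v]] by linarith
      then show ?thesis
        using un[of x] Cu(1) Cd(1) unfolding real_norm_def abs_mult by (intro mult_mono) auto
    qed
    show "(\<lambda>x. (D (x - y) \<bullet> v) * u x) \<in> borel_measurable borel" by measurable
  qed (rule bounded_ball)
  have ir: "integrable lborel (\<lambda>x. \<rho> (x - z) * u x)" for z
    using integrable_rho_mult(2)[of u Cu z] un by simp
  have irs: "integrable lborel (\<lambda>x. \<rho> (x - y) * u (x + t m *\<^sub>R v))" for m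
    using integrable_rho_mult(2)[of "\<lambda>x. u (x + t m *\<^sub>R v)" Cu y] un by simp
  have est: "norm (A m - - (\<integral>x. (D (x - y) \<bullet> v) * u x \<partial>lborel)) \<le> t m * (L * (norm v)\<^sup>2 * (\<integral>x. norm (u x) \<partial>lborel))"
    if m: "norm (t m *\<^sub>R v) \<le> 1" for m
  proof -
    define a where "a = t m *\<^sub>R v"
    \<comment> \<open>The change of variables moves the increment from the field to the
      mollifier.\<close>
    have "(\<integral>x. \<rho> (x - y) * u (x + a) \<partial>lborel) = (\<integral>x. \<rho> (x - (y + a)) * u x \<partial>lborel)"
      using integral_lborel_shift[of "\<lambda>x. \<rho> (x - (y + a)) * u x" a] by (simp add: algebra_simps)
    then have "A m = ((\<integral>x. \<rho> (x - (y + a)) * u x \<partial>lborel) - (\<integral>x. \<rho> (x - y) * u x \<partial>lborel)) / t m"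
      unfolding A_def using ir[of y] irs[of m]
      by (simp add: right_diff_distrib diff_divide_distrib a_def)
    then have eq: "A m - - (\<integral>x. (D (x - y) \<bullet> v) * u x \<partial>lborel)
        = (\<integral>x. (\<rho> (x - (y + a)) * u x - \<rho> (x - y) * u x) / t m + (D (x - y) \<bullet> v) * u x \<partial>lborel)"
      using ir[of y] ir[of "y + a"] iD by simp
    have "norm (A m - - (\<integral>x. (D (x - y) \<bullet> v) * u x \<partial>lborel))
        \<le> (\<integral>x. norm ((\<rho> (x - (y + a)) * u x - \<rho> (x - y) * u x) / t m + (D (x - y) \<bullet> v) * u x) \<partial>lborel)"
      unfolding eq by (rule integral_norm_bound)
    also have "\<dots> \<le> (\<integral>x. (t m * (L * (norm v)\<^sup>2)) * norm (u x) \<partial>lborel)"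
    proof (rule integral_mono)
      show "integrable lborel (\<lambda>x. norm ((\<rho> (x - (y + a)) * u x - \<rho> (x - y) * u x) / t m + (D (x - y) \<bullet> v) * u x))"
        by (intro integrable_norm Bochner_Integration.integrable_add integrable_divide
            Bochner_Integration.integrable_diff ir iD)
      show "integrable lborel (\<lambda>x. (t m * (L * (norm v)\<^sup>2)) * norm (u x))"
        by (intro integrable_mult_right integrable_norm iu)
      show "norm ((\<rho> (x - (y + a)) * u x - \<rho> (x - y) * u x) / t m + (D (x - y) \<bullet> v) * u x) \<le> (t m * (L * (norm v)\<^sup>2)) * norm (u x)" for x
      proof -
        have "(\<rho> (x - (y + a)) * u x - \<rho> (x - y) * u x) / t m + (D (x - y) \<bullet> v) * u x
            = (\<rho> ((x - y) + (- a)) - \<rho> (x - y) - D (x - y) \<bullet> (- a)) / t m * u x"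
          using t[of m] by (simp add: a_def divide_simps algebra_simps)
        moreover have "\<bar>\<rho> ((x - y) + (- a)) - \<rho> (x - y) - D (x - y) \<bullet> (- a)\<bar> \<le> L * (norm (- a))\<^sup>2"
          using m by (intro remainder) (simp add: a_def)
        then have "\<bar>\<rho> ((x - y) + (- a)) - \<rho> (x - y) - D (x - y) \<bullet> (- a)\<bar> / t m \<le> t m * (L * (norm v)\<^sup>2)"
          using t[of m] by (simp add: a_def power_mult_distrib divide_le_eq power2_eq_square mult_ac)
        moreover have "\<bar>q / t m * w\<bar> \<le> K * \<bar>w\<bar>" if "\<bar>q\<bar> / t m \<le> K" for q w K :: real
          using that t[of m] unfolding abs_mult abs_divide by (intro mult_right_mono) auto
        ultimately show ?thesis unfolding real_norm_def by simp
      qed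
    qed
    also have "\<dots> = t m * (L * (norm v)\<^sup>2 * (\<integral>x. norm (u x) \<partial>lborel))"
      by (simp add: mult.assoc)
    finally show ?thesis .
  qed
  have "A \<longlonglongrightarrow> - (\<integral>x. (D (x - y) \<bullet> v) * u x \<partial>lborel)"
  proof (rule LIM_zero_cancel, rule Lim_null_comparison)
    have "(\<lambda>m. norm (t m *\<^sub>R v)) \<longlonglongrightarrow> 0 * norm v"
      using t unfolding norm_scaleR t_def by (intro tendsto_intros tendsto_rabs_zero inv_Suc_tendsto)
    then have "\<forall>\<^sub>F m in sequentially. norm (t m *\<^sub>R v) < 1" by (intro order_tendstoD(2)) auto
    then show "\<forall>\<^sub>F m in sequentially. norm (A m - - (\<integral>x. (D (x - y) \<bullet> v) * u x \<partial>lborel)) \<le> t m * (L * (norm v)\<^sup>2 * (\<integral>x. norm (u x) \<partial>lborel))"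
      by (rule eventually_mono) (rule est, simp)
    have "(\<lambda>m. t m * (L * (norm v)\<^sup>2 * (\<integral>x. norm (u x) \<partial>lborel))) \<longlonglongrightarrow> 0 * (L * (norm v)\<^sup>2 * (\<integral>x. norm (u x) \<partial>lborel))"
      unfolding t_def by (intro tendsto_mult inv_Suc_tendsto tendsto_const)
    then show "(\<lambda>m. t m * (L * (norm v)\<^sup>2 * (\<integral>x. norm (u x) \<partial>lborel))) \<longlonglongrightarrow> 0" by (simp only: mult_zero_left)
  qed
  from LIMSEQ_unique[OF lim1 this] show ?thesis by (simp only: u_def)
qed

lemma mollified_divergence:
  fixes \<phi> :: "real^'n \<Rightarrow> real^'n"
  assumes phi: "\<phi> \<in> C1_compact_support U"
  shows "(\<integral>x. \<rho> (x - y) * divergence \<phi> x \<partial>lborel) = - (\<integral>x. D (x - y) \<bullet> \<phi> x \<partial>lborel)"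
proof -
  note [measurable] = C1_measurable[OF phi]
  obtain Cu where Cu: "Cu \<ge> 0" "\<And>x. norm (\<phi> x) \<le> Cu" using C1_bounds(1)[OF phi] by blast
  obtain Cd where Cd: "Cd \<ge> 0" "\<And>z. norm (D z) \<le> Cd" using D_bound by blast
  have i1: "integrable lborel (\<lambda>x. \<rho> (x - y) * (frechet_derivative \<phi> (at x) v $ i))" for v i
  proof -
    obtain C where C: "C \<ge> 0" "\<And>x. norm (frechet_derivative \<phi> (at x) v) \<le> C"
      using C1_bounds(2)[OF phi] by blast
    have "norm (frechet_derivative \<phi> (at x) v $ i) \<le> C" for x
      using C(2)[of x] component_le_norm_cart[of "frechet_derivative \<phi> (at x) v" i] by simp
    moreover have "(\<lambda>x. frechet_derivative \<phi> (at x) v $ i) \<in> borel_measurable borel" by measurable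
    ultimately show ?thesis using integrable_rho_mult(2)[of "\<lambda>x. frechet_derivative \<phi> (at x) v $ i" C y] by simp
  qed
  have i2: "integrable lborel (\<lambda>x. (D (x - y) \<bullet> axis i 1) * \<phi> x $ i)" for i
  proof (rule integrable_bounded_support[where S="ball y \<epsilon>" and C="Cd * Cu"])
    show "(D (x - y) \<bullet> axis i 1) * \<phi> x $ i = 0" if "x \<notin> ball y \<epsilon>" for x
      using that by (simp add: D_zero dist_norm norm_minus_commute)
    have "\<bar>D z $ i\<bar> \<le> Cd" "\<bar>\<phi> x $ i\<bar> \<le> Cu" for z x
      using component_le_norm_cart[of "D z" i] Cd(2)[of z] component_le_norm_cart[of "\<phi> x" i] Cu(2)[of x] by auto
    then show "norm ((D (x - y) \<bullet> axis i 1) * \<phi> x $ i) \<le> Cd * Cu" for x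
      unfolding norm_mult by (intro mult_mono) (auto simp: Cd inner_axis)
    show "(\<lambda>x. (D (x - y) \<bullet> axis i 1) * \<phi> x $ i) \<in> borel_measurable borel" by measurable
  qed (rule bounded_ball)
  have "(\<integral>x. \<rho> (x - y) * divergence \<phi> x \<partial>lborel)
      = (\<Sum>i\<in>UNIV. (\<integral>x. \<rho> (x - y) * (frechet_derivative \<phi> (at x) (axis i 1) $ i) \<partial>lborel))"
    unfolding divergence_def sum_distrib_left by (rule Bochner_Integration.integral_sum) (rule i1)
  also have "\<dots> = (\<Sum>i\<in>UNIV. - (\<integral>x. (D (x - y) \<bullet> axis i 1) * \<phi> x $ i \<partial>lborel))"
    by (simp only: mollified_partial[OF phi])
  also have "\<dots> = - (\<integral>x. (\<Sum>i\<in>UNIV. (D (x - y) \<bullet> axis i 1) * \<phi> x $ i) \<partial>lborel)"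
    using i2 by (simp only: sum_negf Bochner_Integration.integral_sum)
  also have "(\<lambda>x. \<Sum>i\<in>UNIV. (D (x - y) \<bullet> axis i 1) * \<phi> x $ i) = (\<lambda>x. D (x - y) \<bullet> \<phi> x)"
    by (simp add: inner_vec_def[of "D _" "\<phi> _"] inner_axis)
  finally show ?thesis .
qed

text \<open>The field only has to be bounded and measurable: besides test fields, the sign of the
  gradient is going to be inserted.\<close>

lemma grad_Fubini:
  fixes \<psi> :: "real^'n \<Rightarrow> real^'n"
  assumes [measurable]: "E \<in> sets borel" "\<psi> \<in> borel_measurable borel"
    and n: "\<And>x. norm (\<psi> x) \<le> C" and supp: "\<And>x. x \<notin> B \<Longrightarrow> \<psi> x = 0" "bounded B"
  shows "(\<integral>y. indicator E y * (\<integral>x. D (x - y) \<bullet> \<psi> x \<partial>lborel) \<partial>lborel) = (\<integral>x. grad E x \<bullet> \<psi> x \<partial>lborel)"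
proof -
  define f where "f x y = indicator E y * (D (x - y) \<bullet> \<psi> x)" for x y
  obtain R where R: "\<And>x. x \<in> B \<Longrightarrow> norm x \<le> R" using supp(2) by (auto simp: bounded_iff)
  obtain Cd where Cd: "Cd \<ge> 0" "\<And>z. norm (D z) \<le> Cd" using D_bound by blast
  have C: "C \<ge> 0" using n[of 0] norm_ge_zero order_trans by blast
  have [measurable]: "case_prod f \<in> borel_measurable (borel \<Otimes>\<^sub>M borel)"
    unfolding f_def[abs_def] by measurable
  have int: "integrable (lborel :: ((real^'n) \<times> (real^'n)) measure) (case_prod f)"
  proof (rule integrable_bounded_support[where S="cball 0 R \<times> cball 0 (R + \<epsilon>)" and C="Cd * C"])
    show "case_prod f \<in> borel_measurable borel" by (simp add: borel_prod[symmetric])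
    show "norm (case_prod f p) \<le> Cd * C" for p
    proof (cases p)
      case (Pair x y)
      have "\<bar>D (x - y) \<bullet> \<psi> x\<bar> \<le> Cd * C"
        using mult_mono[OF Cd(2)[of "x - y"] n[of x] Cd(1) norm_ge_zero] Cauchy_Schwarz_ineq2[of "D (x - y)" "\<psi> x"] by linarith
      then show ?thesis using Cd(1) C by (auto simp: f_def Pair indicator_def)
    qed
    show "case_prod f p = 0" if p: "p \<notin> cball 0 R \<times> cball 0 (R + \<epsilon>)" for p
    proof (cases p)
      case (Pair x y)
      show ?thesis
      proof (cases "x \<in> B \<and> norm (x - y) < \<epsilon>")
        case True
        then have "norm x \<le> R" "norm y \<le> R + \<epsilon>" using R[of x] norm_triangle_ineq2[of y x] by (auto simp: norm_minus_commute)
        then show ?thesis using p Pair by simp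
      next
        case False
        then show ?thesis using supp(1)[of x] D_zero[of "x - y"] by (auto simp: f_def Pair)
      qed
    qed
    show "bounded (cball (0::real^'n) R \<times> cball (0::real^'n) (R + \<epsilon>))" by (intro bounded_Times bounded_cball)
  qed
  have "(\<integral>y. (\<integral>x. f x y \<partial>lborel) \<partial>lborel) = (\<integral>x. (\<integral>y. f x y \<partial>lborel) \<partial>lborel)"
    by (rule lborel_pair.Fubini_integral) (simp only: lborel_prod int)
  moreover have "(\<integral>x. f x y \<partial>lborel) = indicator E y * (\<integral>x. D (x - y) \<bullet> \<psi> x \<partial>lborel)" for y
    by (simp add: f_def)
  moreover have "(\<integral>y. f x y \<partial>lborel) = grad E x \<bullet> \<psi> x" for x
  proof -
    have "integrable lborel (\<lambda>y. indicator E y *\<^sub>R D (x - y))"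
      by (rule integrable_D_mult(1)[where B=1]) (auto simp: indicator_def)
    then have "(\<integral>y. (indicator E y *\<^sub>R D (x - y)) \<bullet> \<psi> x \<partial>lborel) = grad E x \<bullet> \<psi> x"
      unfolding grad_def by (rule integral_inner_left)
    then show ?thesis by (simp add: f_def)
  qed
  ultimately show ?thesis by (simp only:)
qed

lemma mollified_divergence_set:
  fixes \<phi> :: "real^'n \<Rightarrow> real^'n"
  assumes "E \<in> sets borel" and phi: "\<phi> \<in> C1_compact_support U"
  shows "(\<integral>y. indicator E y * (\<integral>x. \<rho> (x - y) * divergence \<phi> x \<partial>lborel) \<partial>lborel) = - (\<integral>x. grad E x \<bullet> \<phi> x \<partial>lborel)"
proof -
  obtain Cu where Cu: "Cu \<ge> 0" "\<And>x. norm (\<phi> x) \<le> Cu" using C1_bounds(1)[OF phi] by blast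
  have "(\<integral>y. indicator E y * (\<integral>x. D (x - y) \<bullet> \<phi> x \<partial>lborel) \<partial>lborel) = (\<integral>x. grad E x \<bullet> \<phi> x \<partial>lborel)"
    using C1_zero compact_imp_bounded[OF C1_support(1)[OF phi]]
    by (rule grad_Fubini[OF assms(1) C1_measurable(1)[OF phi] Cu(2)])
  then show ?thesis unfolding mollified_divergence[OF phi] by simp
qed


text \<open>Makes an admissible test field out of a merely measurable one. The integral is over the
  first argument of \<open>\<rho> (x - y)\<close>, so that differentiating in \<open>y\<close>
  produces \<open>- D\<close> and the divergence matches \<open>grad_Fubini\<close>.\<close>

lemma mollified_field:
  fixes \<psi> :: "real^'n \<Rightarrow> real^'n"
  assumes m [measurable]: "\<psi> \<in> borel_measurable borel" and n: "\<And>x. norm (\<psi> x) \<le> 1"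
    and supp: "\<And>x. x \<notin> B \<Longrightarrow> \<psi> x = 0" and B: "bounded B" "\<And>x. x \<in> B \<Longrightarrow> ball x r \<subseteq> U" and r: "\<epsilon> < r"
  defines "\<phi> \<equiv> (\<lambda>y. \<integral>x. \<rho> (x - y) *\<^sub>R \<psi> x \<partial>lborel)"
  shows "\<phi> \<in> C1_compact_support U" "norm (\<phi> y) \<le> 1"
    "divergence \<phi> y = - (\<integral>x. D (x - y) \<bullet> \<psi> x \<partial>lborel)"
proof -
  obtain R where R: "\<And>x. x \<in> B \<Longrightarrow> norm x \<le> R" using B(1) by (auto simp: bounded_iff)
  obtain Cd where Cd: "Cd \<ge> 0" "\<And>z. norm (D z) \<le> Cd" using D_bound by blast
  define F where "F y h = - (\<integral>x. (D (x - y) \<bullet> h) *\<^sub>R \<psi> x \<partial>lborel)" for y h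
  have Dh: "\<bar>D z \<bullet> h\<bar> \<le> Cd * norm h" for z h
    using Cauchy_Schwarz_ineq2[of "D z" h] mult_right_mono[OF Cd(2)[of z] norm_ge_zero[of h]] by linarith
  have bd: "norm ((D (x - y) \<bullet> h) *\<^sub>R \<psi> x) \<le> (Cd * norm h) * indicator (cball 0 R) x" for x y h
  proof (cases "x \<in> B")
    case True
    have "norm ((D (x - y) \<bullet> h) *\<^sub>R \<psi> x) \<le> (Cd * norm h) * 1"
      unfolding norm_scaleR by (intro mult_mono Dh n) (auto simp: Cd)
    then show ?thesis using R[OF True] by simp
  next
    case False
    then show ?thesis using supp[OF False] Cd(1) by simp
  qed
  have J: "integrable lborel (\<lambda>x. (D (x - y) \<bullet> h) *\<^sub>R \<psi> x)" for y h
  proof (rule Bochner_Integration.integrable_bound)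
    show "integrable lborel (\<lambda>x. (Cd * norm h) * indicator (cball (0::real^'n) R) x :: real)"
      by (intro integrable_const_indicator) auto
    show "(\<lambda>x. (D (x - y) \<bullet> h) *\<^sub>R \<psi> x) \<in> borel_measurable lborel" by measurable
    show "AE x in lborel. norm ((D (x - y) \<bullet> h) *\<^sub>R \<psi> x) \<le> norm ((Cd * norm h) * indicator (cball (0::real^'n) R) x :: real)"
    proof (rule AE_I2)
      fix x
      show "norm ((D (x - y) \<bullet> h) *\<^sub>R \<psi> x) \<le> norm ((Cd * norm h) * indicator (cball (0::real^'n) R) x :: real)"
        using bd[of x y h] unfolding real_norm_def by linarith
    qed
  qed
  have linF: "bounded_linear (F y)" for y
  proof (rule linear_conv_bounded_linear[THEN iffD1], rule linearI)
    show "F y (a + b) = F y a + F y b" for a b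
      unfolding F_def inner_add_right scaleR_add_left using J by simp
    show "F y (c *\<^sub>R a) = c *\<^sub>R F y a" for c a
      unfolding F_def inner_scaleR_right by (simp only: scaleR_scaleR[symmetric] integral_scaleR_right scaleR_minus_right)
  qed
  have ir: "integrable lborel (\<lambda>x. \<rho> (x - y) *\<^sub>R \<psi> x)" for y
    by (rule integrable_rho_mult(2)[OF m n])
  have der: "(\<phi> has_derivative F y) (at y)" for y
  proof (rule has_derivative_quadratic_remainder[OF linF])
    fix h :: "real^'n" assume h: "norm h \<le> 1"
    have eq: "\<phi> (y + h) - \<phi> y - F y h
        = (\<integral>x. \<rho> (x - (y + h)) *\<^sub>R \<psi> x - \<rho> (x - y) *\<^sub>R \<psi> x + (D (x - y) \<bullet> h) *\<^sub>R \<psi> x \<partial>lborel)"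
      unfolding \<phi>_def F_def using ir[of y] ir[of "y + h"] J[of y h] by simp
    have "norm (\<phi> (y + h) - \<phi> y - F y h)
        \<le> (\<integral>x. norm (\<rho> (x - (y + h)) *\<^sub>R \<psi> x - \<rho> (x - y) *\<^sub>R \<psi> x + (D (x - y) \<bullet> h) *\<^sub>R \<psi> x) \<partial>lborel)"
      unfolding eq by (rule integral_norm_bound)
    also have "\<dots> \<le> (\<integral>x. (L * (norm h)\<^sup>2) * indicator (cball (0::real^'n) R) x \<partial>lborel)"
    proof (rule integral_mono)
      show "integrable lborel (\<lambda>x. norm (\<rho> (x - (y + h)) *\<^sub>R \<psi> x - \<rho> (x - y) *\<^sub>R \<psi> x + (D (x - y) \<bullet> h) *\<^sub>R \<psi> x))"
        by (intro integrable_norm Bochner_Integration.integrable_add Bochner_Integration.integrable_diff ir J)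
      show "integrable lborel (\<lambda>x. (L * (norm h)\<^sup>2) * indicator (cball (0::real^'n) R) x)"
        by (intro integrable_const_indicator) auto
      show "norm (\<rho> (x - (y + h)) *\<^sub>R \<psi> x - \<rho> (x - y) *\<^sub>R \<psi> x + (D (x - y) \<bullet> h) *\<^sub>R \<psi> x)
          \<le> (L * (norm h)\<^sup>2) * indicator (cball (0::real^'n) R) x" for x
      proof (cases "x \<in> B")
        case True
        have "\<rho> (x - (y + h)) *\<^sub>R \<psi> x - \<rho> (x - y) *\<^sub>R \<psi> x + (D (x - y) \<bullet> h) *\<^sub>R \<psi> x
            = (\<rho> ((x - y) + (- h)) - \<rho> (x - y) - D (x - y) \<bullet> (- h)) *\<^sub>R \<psi> x"
          by (simp add: algebra_simps)
        moreover have "\<bar>\<rho> ((x - y) + (- h)) - \<rho> (x - y) - D (x - y) \<bullet> (- h)\<bar> \<le> L * (norm (- h))\<^sup>2"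
          using h by (intro remainder) simp
        moreover have "\<bar>w\<bar> * norm (\<psi> x) \<le> K * 1" if "\<bar>w\<bar> \<le> K" for w K
          using that n[of x] by (intro mult_mono) auto
        ultimately have "norm (\<rho> (x - (y + h)) *\<^sub>R \<psi> x - \<rho> (x - y) *\<^sub>R \<psi> x + (D (x - y) \<bullet> h) *\<^sub>R \<psi> x) \<le> L * (norm (- h))\<^sup>2 * 1"
          by (simp only: norm_scaleR)
        then show ?thesis using R[OF True] by simp
      next
        case False
        then show ?thesis using supp[OF False] L by simp
      qed
    qed
    also have "\<dots> = (L * measure lborel (cball (0::real^'n) R)) * (norm h)\<^sup>2" by simp
    finally show "norm (\<phi> (y + h) - \<phi> y - F y h) \<le> (L * measure lborel (cball (0::real^'n) R)) * (norm h)\<^sup>2" .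
  qed
  have fd: "frechet_derivative \<phi> (at y) = F y" for y
    using der by (rule frechet_derivative_at[symmetric])
  have contF: "continuous_on UNIV (\<lambda>y. F y v)" for v
  proof (rule continuous_at_imp_continuous_on, rule ballI)
    fix y :: "real^'n"
    show "isCont (\<lambda>y. F y v) y"
      unfolding continuous_at_sequentially comp_def
    proof (intro allI impI)
      fix ys assume ys: "ys \<longlonglongrightarrow> y"
      have "(\<lambda>k. \<integral>x. (D (x - ys k) \<bullet> v) *\<^sub>R \<psi> x \<partial>lborel) \<longlonglongrightarrow> (\<integral>x. (D (x - y) \<bullet> v) *\<^sub>R \<psi> x \<partial>lborel)"
      proof (rule integral_dominated_convergence[where w="\<lambda>x. (Cd * norm v) * indicator (cball (0::real^'n) R) x"])
        show "integrable lborel (\<lambda>x. (Cd * norm v) * indicator (cball (0::real^'n) R) x :: real)"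
          by (intro integrable_const_indicator) auto
        show "AE x in lborel. (\<lambda>k. (D (x - ys k) \<bullet> v) *\<^sub>R \<psi> x) \<longlonglongrightarrow> (D (x - y) \<bullet> v) *\<^sub>R \<psi> x"
        proof (rule AE_I2)
          fix x
          have "isCont D (x - y)" using D_cont by (simp add: continuous_on_eq_continuous_at)
          then have "(\<lambda>k. D (x - ys k)) \<longlonglongrightarrow> D (x - y)"
            by (rule isCont_tendsto_compose) (intro tendsto_intros ys)
          then show "(\<lambda>k. (D (x - ys k) \<bullet> v) *\<^sub>R \<psi> x) \<longlonglongrightarrow> (D (x - y) \<bullet> v) *\<^sub>R \<psi> x"
            by (intro tendsto_intros)
        qed
        show "AE x in lborel. norm ((D (x - ys k) \<bullet> v) *\<^sub>R \<psi> x) \<le> (Cd * norm v) * indicator (cball (0::real^'n) R) x" for k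
          by (intro AE_I2 bd)
      qed measurable
      then show "(\<lambda>k. F (ys k) v) \<longlonglongrightarrow> F y v" unfolding F_def by (rule tendsto_minus)
    qed
  qed
  have nz: "\<exists>x\<in>B. norm (x - y) < \<epsilon>" if "\<phi> y \<noteq> 0" for y
  proof (rule ccontr)
    assume "\<not> ?thesis"
    then have "\<rho> (x - y) *\<^sub>R \<psi> x = 0" for x
      using supp[of x] rho_zero[of "x - y"] by (cases "x \<in> B") auto
    then have "\<phi> y = 0" unfolding \<phi>_def by (simp only: integral_zero)
    then show False using that by simp
  qed
  \<comment> \<open>The field vanishes farther than \<epsilon> from \<open>B\<close>; the remaining
    margin r - \<epsilon> accommodates the closure.\<close>
  have cc: "compactly_contained {y. \<phi> y \<noteq> 0} U"
    unfolding compactly_contained_def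
  proof
    have "norm y \<le> R + \<epsilon>" if y: "\<phi> y \<noteq> 0" for y
    proof -
      obtain x where "x \<in> B" "norm (x - y) < \<epsilon>" using nz[OF y] by blast
      then show ?thesis using R[of x] norm_triangle_ineq2[of y x] by (simp add: norm_minus_commute)
    qed
    then have "bounded {y. \<phi> y \<noteq> 0}" unfolding bounded_iff by blast
    then show "compact (closure {y. \<phi> y \<noteq> 0})" by (simp add: compact_closure)
    show "closure {y. \<phi> y \<noteq> 0} \<subseteq> U"
    proof
      fix y assume "y \<in> closure {y. \<phi> y \<noteq> 0}"
      then obtain y' where y': "\<phi> y' \<noteq> 0" "dist y' y < r - \<epsilon>"
        using r unfolding closure_approachable by (metis diff_gt_0_iff_gt mem_Collect_eq)
      obtain x where x: "x \<in> B" "norm (x - y') < \<epsilon>" using nz[OF y'(1)] by blast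
      have "dist x y < r" using dist_triangle[of x y y'] x(2) y'(2) by (simp add: dist_norm)
      then show "y \<in> U" using B(2)[OF x(1)] by auto
    qed
  qed
  show "\<phi> \<in> C1_compact_support U"
    unfolding C1_compact_support_def fd mem_Collect_eq
    using der contF cc by (auto simp: differentiable_def)
  show "norm (\<phi> y) \<le> 1"
  proof -
    have "norm (\<phi> y) \<le> (\<integral>x. norm (\<rho> (x - y) *\<^sub>R \<psi> x) \<partial>lborel)"
      unfolding \<phi>_def by (rule integral_norm_bound)
    also have "\<dots> \<le> (\<integral>x. \<rho> (x - y) \<partial>lborel)"
    proof (rule integral_mono)
      show "integrable lborel (\<lambda>x. norm (\<rho> (x - y) *\<^sub>R \<psi> x))" by (intro integrable_norm ir)
      show "integrable lborel (\<lambda>x. \<rho> (x - y))"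
        using integrable_rho_mult(2)[of "\<lambda>_. 1::real" 1 y] by simp
      show "norm (\<rho> (x - y) *\<^sub>R \<psi> x) \<le> \<rho> (x - y)" for x
        using mult_left_mono[OF n[of x] rho_nonneg[of "x - y"]] rho_nonneg[of "x - y"] by simp
    qed
    also have "\<dots> = 1" using integral_lborel_shift[of \<rho> "- y"] rho_integral by simp
    finally show ?thesis .
  qed
  have "F y (axis i 1) $ i = - (\<integral>x. D (x - y) $ i * \<psi> x $ i \<partial>lborel)" for i
    using integral_bounded_linear[OF bounded_linear_vec_nth[of i] J[of y "axis i 1"]]
    by (simp add: F_def inner_axis)
  moreover have "integrable lborel (\<lambda>x. D (x - y) $ i * \<psi> x $ i)" for i
    using integrable_bounded_linear[OF bounded_linear_vec_nth[of i] J[of y "axis i 1"]] by (simp add: inner_axis)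
  ultimately show "divergence \<phi> y = - (\<integral>x. D (x - y) \<bullet> \<psi> x \<partial>lborel)"
    unfolding divergence_def fd inner_vec_def[of "D _"] by (simp add: sum_negf)
qed

text \<open>Duality: the perimeter is tested with the mollified direction of the gradient on
  \<open>B\<close>. Mollifying set and field with the same kernel makes the test value the total
  variation of the mollified set over \<open>B\<close>.\<close>

lemma grad_le_Per_open:
  fixes E :: "(real^'n) set"
  assumes [measurable]: "E \<in> sets borel" "B \<in> sets borel"
    and B: "bounded B" "\<And>x. x \<in> B \<Longrightarrow> ball x r \<subseteq> U" and r: "\<epsilon> < r"
  shows "(\<integral>\<^sup>+x. ennreal (norm (grad E x)) * indicator B x \<partial>lborel) \<le> e2ennreal (Per_open E U)"
proof -
  \<comment> \<open>The minus sign offsets the one in the divergence of the mollified field.\<close>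
  define \<psi> where "\<psi> x = - (indicator B x *\<^sub>R sgn (grad E x))" for x
  have [measurable]: "\<psi> \<in> borel_measurable borel"
    unfolding \<psi>_def[abs_def] sgn_div_norm by measurable
  have n: "norm (\<psi> x) \<le> 1" for x by (simp add: \<psi>_def norm_sgn indicator_def)
  have supp: "\<psi> x = 0" if "x \<notin> B" for x using that by (simp add: \<psi>_def)
  define \<phi> where "\<phi> = (\<lambda>y. \<integral>x. \<rho> (x - y) *\<^sub>R \<psi> x \<partial>lborel)"
  have phi: "\<phi> \<in> C1_compact_support U" "\<And>y. norm (\<phi> y) \<le> 1"
    "\<And>y. divergence \<phi> y = - (\<integral>x. D (x - y) \<bullet> \<psi> x \<partial>lborel)"
    unfolding \<phi>_def using mollified_field[of \<psi>, OF _ n supp B r] by simp_all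
  obtain C where C: "\<And>x. norm (grad E x) \<le> C" using grad_bound assms(1) by blast
  have int: "integrable lborel (\<lambda>x. norm (grad E x) * indicator B x :: real)"
  proof (rule integrable_bounded_support[where S=B and C=C])
    show "norm (norm (grad E x) * indicator B x :: real) \<le> C" for x
      using C[of x] norm_ge_zero[of "grad E x"] by (auto simp: indicator_def simp del: norm_ge_zero intro: order_trans)
  qed (auto simp: B)
  have "(LINT y:E|lebesgue. divergence \<phi> y) = (\<integral>y. indicator E y * divergence \<phi> y \<partial>lborel)"
    unfolding set_lebesgue_integral_def using C1_measurable(3)[OF phi(1)] by (simp add: integral_completion)
  also have "\<dots> = - (\<integral>y. indicator E y * (\<integral>x. D (x - y) \<bullet> \<psi> x \<partial>lborel) \<partial>lborel)"
    by (simp add: phi(3))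
  also have "\<dots> = - (\<integral>x. grad E x \<bullet> \<psi> x \<partial>lborel)"
    using n supp B(1) by (subst grad_Fubini) auto
  also have "\<dots> = (\<integral>x. norm (grad E x) * indicator B x \<partial>lborel)"
  proof -
    have "grad E x \<bullet> \<psi> x = - (norm (grad E x) * indicator B x)" for x
      by (cases "grad E x = 0") (auto simp: \<psi>_def sgn_div_norm indicator_def dot_square_norm power2_eq_square)
    then show ?thesis by simp
  qed
  finally have eq: "(LINT y:E|lebesgue. divergence \<phi> y) = (\<integral>x. norm (grad E x) * indicator B x \<partial>lborel)" .
  have le: "ereal (LINT y:E|lebesgue. divergence \<phi> y) \<le> Per_open E U"
    unfolding Per_open_def by (rule SUP_upper) (simp add: phi)
  have "(\<integral>\<^sup>+x. ennreal (norm (grad E x)) * indicator B x \<partial>lborel) = (\<integral>\<^sup>+x. ennreal (norm (grad E x) * indicator B x) \<partial>lborel)"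
    by (intro nn_integral_cong) (simp add: indicator_def)
  also have "\<dots> = ennreal (\<integral>x. norm (grad E x) * indicator B x \<partial>lborel)"
    using int by (intro nn_integral_eq_integral) auto
  also have "\<dots> = e2ennreal (ereal (LINT y:E|lebesgue. divergence \<phi> y))"
    unfolding eq by (simp add: e2ennreal_ereal)
  also have "\<dots> \<le> e2ennreal (Per_open E U)" using le by (rule e2ennreal_mono)
  finally show ?thesis .
qed

end

section \<open>Short-range energy and perimeter\<close>

definition jump :: "'a set \<Rightarrow> 'a \<Rightarrow> 'a \<Rightarrow> ennreal"
  where "jump E x y = ennreal \<bar>indicator E x - indicator E y\<bar>"

lemma jump_if: "jump E x y = (if x \<in> E \<longleftrightarrow> y \<in> E then 0 else 1)"
  by (simp add: jump_def indicator_def)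

lemma jump_measurable [measurable (raw)]:
  assumes [measurable]: "E \<in> sets borel" "f \<in> borel_measurable M" "g \<in> borel_measurable M"
  shows "(\<lambda>p. jump E (f p) (g p)) \<in> borel_measurable M"
  unfolding jump_def by measurable

text \<open>Only the base point \<open>x\<close> is confined to \<open>B\<close>;
  \<open>x + h\<close> may leave it. Pairs are ordered, so a pair with both points in
  \<open>B\<close> is counted twice.\<close>

definition near_energy :: "real \<Rightarrow> real \<Rightarrow> (real^'n) set \<Rightarrow> (real^'n) set \<Rightarrow> ennreal"
  where "near_energy s \<delta> E B =
    (\<integral>\<^sup>+x. (\<integral>\<^sup>+h. jump E x (x + h) * (riesz_kernel s h * indicator (ball 0 \<delta>) h) \<partial>lborel) * indicator B x \<partial>lborel)"

text \<open>The integral of \<open>\<bar>v \<bullet> h\<bar> riesz_kernel s h\<close> over \<open>ball 0 \<delta>\<close>, for a unit vector \<open>v\<close>.\<close>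

definition linear_const :: "'n::finite itself \<Rightarrow> real \<Rightarrow> real \<Rightarrow> real"
  where "linear_const _ s \<delta> = 2 * unit_ball_vol (real (CARD('n) - 1)) * (\<delta> powr (1 - 2 * s) / (1 - 2 * s))"

lemma linear_const_nonneg: "s < 1/2 \<Longrightarrow> 0 \<le> linear_const TYPE('n::finite) s \<delta>"
  by (simp add: linear_const_def)

lemma nn_integral_kernel_linear':
  fixes v :: "real^'n"
  assumes "s < 1/2" "\<delta> > 0"
  shows "(\<integral>\<^sup>+h. ennreal \<bar>v \<bullet> h\<bar> * (riesz_kernel s h * indicator (ball 0 \<delta>) h) \<partial>lborel)
    = ennreal (linear_const TYPE('n) s \<delta>) * ennreal (norm v)"
  using nn_integral_kernel_linear[OF assms, of v] assms
  by (simp add: linear_const_def ennreal_mult'[symmetric] mult_ac)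

lemma near_energy_mono: "B \<subseteq> B' \<Longrightarrow> near_energy s \<delta> E B \<le> near_energy s \<delta> E B'"
  unfolding near_energy_def by (intro nn_integral_mono mult_left_mono) (auto simp: indicator_def)

lemma borel_measurable_ball_indicator [measurable]:
  "(indicator (ball x r) :: 'a::euclidean_space \<Rightarrow> ennreal) \<in> borel_measurable borel"
  by (intro borel_measurable_indicator borel_open open_ball)

section \<open>Short-range energy bounded from below by the total variation\<close>

context mollifier
begin

lemma smooth_diff_le:
  assumes [measurable]: "E \<in> sets borel"
  shows "ennreal \<bar>smooth E (x + h) - smooth E x\<bar> \<le> (\<integral>\<^sup>+y. ennreal (\<rho> (x - y)) * jump E y (y + h) \<partial>lborel)"
proof -
  have i1: "integrable lborel (\<lambda>y. \<rho> (x - y) * indicator E y)"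
    using integrable_rho_mult(1)[of "indicator E :: _ \<Rightarrow> real" 1 x] by (auto simp: indicator_def)
  have i2: "integrable lborel (\<lambda>y. \<rho> (x - y) * indicator E (y + h))"
    using integrable_rho_mult(1)[of "\<lambda>y. indicator E (y + h) :: real" 1 x] by (auto simp: indicator_def)
  have "smooth E (x + h) = (\<integral>y. \<rho> (x - y) * indicator E (y + h) \<partial>lborel)"
    using integral_lborel_shift[of "\<lambda>y. \<rho> (x + h - y) * indicator E y" h] by (simp add: smooth_def)
  then have eq: "smooth E (x + h) - smooth E x = (\<integral>y. \<rho> (x - y) * indicator E (y + h) - \<rho> (x - y) * indicator E y \<partial>lborel)"
    using i1 i2 by (simp add: smooth_def)
  have i3: "integrable lborel (\<lambda>y. \<bar>\<rho> (x - y) * indicator E (y + h) - \<rho> (x - y) * indicator E y\<bar>)"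
    by (intro integrable_abs Bochner_Integration.integrable_diff i1 i2)
  have "ennreal \<bar>smooth E (x + h) - smooth E x\<bar>
      \<le> ennreal (\<integral>y. \<bar>\<rho> (x - y) * indicator E (y + h) - \<rho> (x - y) * indicator E y\<bar> \<partial>lborel)"
    unfolding eq by (intro ennreal_leI integral_abs_bound)
  also have "\<dots> = (\<integral>\<^sup>+y. ennreal \<bar>\<rho> (x - y) * indicator E (y + h) - \<rho> (x - y) * indicator E y\<bar> \<partial>lborel)"
    by (rule nn_integral_eq_integral[symmetric, OF i3]) simp
  also have "\<dots> = (\<integral>\<^sup>+y. ennreal (\<rho> (x - y)) * jump E y (y + h) \<partial>lborel)"
  proof (rule nn_integral_cong)
    fix y
    have "\<bar>\<rho> (x - y) * indicator E (y + h) - \<rho> (x - y) * indicator E y\<bar> = \<rho> (x - y) * \<bar>indicator E y - indicator E (y + h)\<bar>"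
      using rho_nonneg[of "x - y"] by (simp add: indicator_def)
    then show "ennreal \<bar>\<rho> (x - y) * indicator E (y + h) - \<rho> (x - y) * indicator E y\<bar> = ennreal (\<rho> (x - y)) * jump E y (y + h)"
      by (simp add: jump_def ennreal_mult rho_nonneg)
  qed
  finally show ?thesis .
qed

lemma rho_integral_indicator:
  "(\<integral>\<^sup>+x. ennreal (\<rho> (x - y)) * indicator S x \<partial>lborel) \<le> indicator (\<Union>x\<in>S. ball x \<epsilon>) y"
proof (cases "y \<in> (\<Union>x\<in>S. ball x \<epsilon>)")
  case True
  have "(\<integral>\<^sup>+x. ennreal (\<rho> (x - y)) * indicator S x \<partial>lborel) \<le> (\<integral>\<^sup>+x. ennreal (\<rho> (x - y)) \<partial>lborel)"
    by (intro nn_integral_mono) (auto simp: indicator_def)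
  then show ?thesis using True by (simp add: rho_nn_integral_shift)
next
  case False
  then have "ennreal (\<rho> (x - y)) * indicator S x = 0" for x
    using rho_zero[of "x - y"] by (auto simp: indicator_def dist_norm not_less)
  then show ?thesis by (simp del: mult_eq_0_iff)
qed

text \<open>Convolution averages translates of the jumps with total weight 1, so it does not
  increase the energy; the price is that the region of base points grows by \<epsilon>.\<close>

lemma smooth_energy_le_near_energy:
  assumes [measurable]: "E \<in> sets borel" "S \<in> sets borel"
  shows "(\<integral>\<^sup>+x. (\<integral>\<^sup>+h. ennreal \<bar>smooth E (x + h) - smooth E x\<bar> * (riesz_kernel s h * indicator (ball 0 \<delta>) h) \<partial>lborel) * indicator S x \<partial>lborel)
    \<le> near_energy s \<delta> E (\<Union>x\<in>S. ball x \<epsilon>)"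
proof -
  let ?k = "\<lambda>h. riesz_kernel s h * indicator (ball 0 \<delta>) h :: ennreal"
  have "(\<integral>\<^sup>+x. (\<integral>\<^sup>+h. ennreal \<bar>smooth E (x + h) - smooth E x\<bar> * ?k h \<partial>lborel) * indicator S x \<partial>lborel)
      \<le> (\<integral>\<^sup>+x. (\<integral>\<^sup>+h. (\<integral>\<^sup>+y. ennreal (\<rho> (x - y)) * jump E y (y + h) \<partial>lborel) * ?k h \<partial>lborel) * indicator S x \<partial>lborel)"
    by (intro nn_integral_mono mult_right_mono smooth_diff_le) auto
  also have "\<dots> = (\<integral>\<^sup>+x. (\<integral>\<^sup>+h. (\<integral>\<^sup>+y. ennreal (\<rho> (x - y)) * jump E y (y + h) * ?k h * indicator S x \<partial>lborel) \<partial>lborel) \<partial>lborel)"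
    by (simp add: nn_integral_multc)
  also have "\<dots> = (\<integral>\<^sup>+x. (\<integral>\<^sup>+y. (\<integral>\<^sup>+h. ennreal (\<rho> (x - y)) * jump E y (y + h) * ?k h * indicator S x \<partial>lborel) \<partial>lborel) \<partial>lborel)"
    by (intro nn_integral_cong lborel_pair.Fubini') measurable
  also have "\<dots> = (\<integral>\<^sup>+y. (\<integral>\<^sup>+x. (\<integral>\<^sup>+h. ennreal (\<rho> (x - y)) * jump E y (y + h) * ?k h * indicator S x \<partial>lborel) \<partial>lborel) \<partial>lborel)"
    by (rule lborel_pair.Fubini') measurable
  also have "\<dots> = (\<integral>\<^sup>+y. (\<integral>\<^sup>+x. (ennreal (\<rho> (x - y)) * indicator S x) * (\<integral>\<^sup>+h. jump E y (y + h) * ?k h \<partial>lborel) \<partial>lborel) \<partial>lborel)"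
  proof (intro nn_integral_cong)
    fix y x :: "real^'n"
    have "(\<integral>\<^sup>+h. ennreal (\<rho> (x - y)) * jump E y (y + h) * ?k h * indicator S x \<partial>lborel)
        = (\<integral>\<^sup>+h. (ennreal (\<rho> (x - y)) * indicator S x) * (jump E y (y + h) * ?k h) \<partial>lborel)"
      by (intro nn_integral_cong) (simp add: mult_ac)
    also have "\<dots> = (ennreal (\<rho> (x - y)) * indicator S x) * (\<integral>\<^sup>+h. jump E y (y + h) * ?k h \<partial>lborel)"
      by (rule nn_integral_cmult) measurable
    finally show "(\<integral>\<^sup>+h. ennreal (\<rho> (x - y)) * jump E y (y + h) * ?k h * indicator S x \<partial>lborel)
        = (ennreal (\<rho> (x - y)) * indicator S x) * (\<integral>\<^sup>+h. jump E y (y + h) * ?k h \<partial>lborel)" .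
  qed
  also have "\<dots> = (\<integral>\<^sup>+y. (\<integral>\<^sup>+x. ennreal (\<rho> (x - y)) * indicator S x \<partial>lborel) * (\<integral>\<^sup>+h. jump E y (y + h) * ?k h \<partial>lborel) \<partial>lborel)"
    by (intro nn_integral_cong nn_integral_multc) measurable
  also have "\<dots> \<le> (\<integral>\<^sup>+y. indicator (\<Union>x\<in>S. ball x \<epsilon>) y * (\<integral>\<^sup>+h. jump E y (y + h) * ?k h \<partial>lborel) \<partial>lborel)"
    by (intro nn_integral_mono mult_right_mono rho_integral_indicator) auto
  finally show ?thesis by (simp add: near_energy_def mult.commute)
qed

lemma mollified_divergence_le_grad:
  fixes \<phi> :: "real^'n \<Rightarrow> real^'n"
  assumes E [measurable]: "E \<in> sets borel" and phi: "\<phi> \<in> C1_compact_support U" "\<And>x. norm (\<phi> x) \<le> 1"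
  shows "ennreal (\<integral>y. indicator E y * (\<integral>x. \<rho> (x - y) * divergence \<phi> x \<partial>lborel) \<partial>lborel)
    \<le> (\<integral>\<^sup>+x. ennreal (norm (grad E x)) * indicator (closure {x. \<phi> x \<noteq> 0}) x \<partial>lborel)"
proof -
  define S where "S = closure {x. \<phi> x \<noteq> 0}"
  have S: "compact S" "bounded S" using C1_support(1)[OF phi(1)] by (auto simp: S_def compact_imp_bounded)
  have [measurable]: "S \<in> sets borel" using S(1) by (simp add: borel_compact)
  obtain C where C: "\<And>x. norm (grad E x) \<le> C" using grad_bound E by blast
  have igS: "integrable lborel (\<lambda>x. norm (grad E x) * indicator S x :: real)"
  proof (rule integrable_bounded_support[where S=S and C=C])
    show "norm (norm (grad E x) * indicator S x :: real) \<le> C" for x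
      using C[of x] norm_ge_zero[of "grad E x"] by (auto simp: indicator_def simp del: norm_ge_zero intro: order_trans)
  qed (auto simp: S)
  have ab: "\<bar>grad E x \<bullet> \<phi> x\<bar> \<le> norm (grad E x) * indicator S x" for x
  proof (cases "x \<in> S")
    case True
    then show ?thesis
      using Cauchy_Schwarz_ineq2[of "grad E x" "\<phi> x"] mult_left_mono[OF phi(2)[of x] norm_ge_zero[of "grad E x"]] by simp
  next
    case False
    then show ?thesis using C1_zero[of x \<phi>] by (simp add: S_def)
  qed
  have "(\<integral>y. indicator E y * (\<integral>x. \<rho> (x - y) * divergence \<phi> x \<partial>lborel) \<partial>lborel) = - (\<integral>x. grad E x \<bullet> \<phi> x \<partial>lborel)"
    using E phi(1) by (rule mollified_divergence_set)
  also have "\<dots> \<le> (\<integral>x. \<bar>grad E x \<bullet> \<phi> x\<bar> \<partial>lborel)"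
    using integral_abs_bound[of lborel "\<lambda>x. grad E x \<bullet> \<phi> x"] by linarith
  also have "\<dots> \<le> (\<integral>x. norm (grad E x) * indicator S x \<partial>lborel)"
    by (rule integral_mono'[OF igS ab]) simp
  finally have "ennreal (\<integral>y. indicator E y * (\<integral>x. \<rho> (x - y) * divergence \<phi> x \<partial>lborel) \<partial>lborel)
      \<le> ennreal (\<integral>x. norm (grad E x) * indicator S x \<partial>lborel)" by (rule ennreal_leI)
  also have "\<dots> = (\<integral>\<^sup>+x. ennreal (norm (grad E x) * indicator S x) \<partial>lborel)"
    by (rule nn_integral_eq_integral[symmetric, OF igS]) simp
  also have "\<dots> = (\<integral>\<^sup>+x. ennreal (norm (grad E x)) * indicator S x \<partial>lborel)"
    by (intro nn_integral_cong) (simp add: indicator_def)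
  finally show ?thesis unfolding S_def .
qed

text \<open>\<open>K\<close> is chosen before the set and before \<open>s\<close>: it collects the
  Taylor constant, the volume of the support of the field, and the spherical factor of the integral
  of |h|^2 times the kernel.\<close>

lemma mollified_divergence_le_near_energy:
  fixes \<phi> :: "real^'n \<Rightarrow> real^'n"
  assumes phi: "\<phi> \<in> C1_compact_support U" "\<And>x. norm (\<phi> x) \<le> 1" and \<delta>: "0 < \<delta>" "\<delta> \<le> 1"
  shows "\<exists>K\<ge>0. \<forall>E\<in>sets borel. \<forall>s. 0 < s \<and> s < 1/2 \<longrightarrow>
    ennreal (linear_const TYPE('n) s \<delta>) * ennreal (\<integral>y. indicator E y * (\<integral>x. \<rho> (x - y) * divergence \<phi> x \<partial>lborel) \<partial>lborel)
    \<le> near_energy s \<delta> E (\<Union>x\<in>closure {x. \<phi> x \<noteq> 0}. ball x \<epsilon>) + ennreal (K * (\<delta> powr (2 - 2 * s) / (2 - 2 * s)))"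
proof -
  define S where "S = closure {x. \<phi> x \<noteq> 0}"
  have S: "compact S" "bounded S" using C1_support(1)[OF phi(1)] by (auto simp: S_def compact_imp_bounded)
  have [measurable]: "S \<in> sets borel" using S(1) by (simp add: borel_compact)
  obtain K0 where K0: "K0 \<ge> 0" "\<And>E x h. E \<in> sets borel \<Longrightarrow> norm h \<le> 1 \<Longrightarrow>
    \<bar>smooth E (x + h) - smooth E x - grad E x \<bullet> h\<bar> \<le> K0 * (norm h)\<^sup>2"
    using smooth_remainder by blast
  define N where "N s = real CARD('n) * unit_ball_vol (real CARD('n)) * (\<delta> powr (2 - 2 * s) / (2 - 2 * s))" for s
  have fS: "emeasure lborel S = ennreal (measure lborel S)"
    using emeasure_bounded_finite[OF S(2)] by (simp add: emeasure_eq_ennreal_measure)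
  define K where "K = K0 * measure lborel S * (real CARD('n) * unit_ball_vol (real CARD('n)))"
  have K: "K \<ge> 0" using K0(1) by (simp add: K_def)
  have main: "ennreal (linear_const TYPE('n) s \<delta>) * ennreal (\<integral>y. indicator E y * (\<integral>x. \<rho> (x - y) * divergence \<phi> x \<partial>lborel) \<partial>lborel)
    \<le> near_energy s \<delta> E (\<Union>x\<in>S. ball x \<epsilon>) + ennreal (K * (\<delta> powr (2 - 2 * s) / (2 - 2 * s)))"
    if E [measurable]: "E \<in> sets borel" and s: "0 < s" "s < 1/2" for E s
  proof -
    let ?k = "\<lambda>h. riesz_kernel s h * indicator (ball 0 \<delta>) h :: ennreal"
    let ?c = "ennreal (linear_const TYPE('n) s \<delta>)"
    have "?c * ennreal (\<integral>y. indicator E y * (\<integral>x. \<rho> (x - y) * divergence \<phi> x \<partial>lborel) \<partial>lborel)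
        \<le> ?c * (\<integral>\<^sup>+x. ennreal (norm (grad E x)) * indicator S x \<partial>lborel)"
      unfolding S_def using E phi by (intro mult_left_mono mollified_divergence_le_grad) auto
    also have "\<dots> = (\<integral>\<^sup>+x. (?c * ennreal (norm (grad E x))) * indicator S x \<partial>lborel)"
      by (simp add: nn_integral_cmult[symmetric] mult.assoc)
    \<comment> \<open>The length of the gradient is written as an average of its directional
      increments, which the Taylor bound can compare with differences of
      \<open>smooth E\<close>.\<close>
    also have "\<dots> = (\<integral>\<^sup>+x. (\<integral>\<^sup>+h. ennreal \<bar>grad E x \<bullet> h\<bar> * ?k h \<partial>lborel) * indicator S x \<partial>lborel)"
      by (simp only: nn_integral_kernel_linear'[OF s(2) \<delta>(1)])
    also have "\<dots> \<le> (\<integral>\<^sup>+x. (\<integral>\<^sup>+h. ennreal \<bar>smooth E (x + h) - smooth E x\<bar> * ?k h + ennreal K0 * (ennreal ((norm h)\<^sup>2) * ?k h) \<partial>lborel) * indicator S x \<partial>lborel)"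
    proof (intro nn_integral_mono mult_right_mono)
      fix x h :: "real^'n"
      show "ennreal \<bar>grad E x \<bullet> h\<bar> * ?k h \<le> ennreal \<bar>smooth E (x + h) - smooth E x\<bar> * ?k h + ennreal K0 * (ennreal ((norm h)\<^sup>2) * ?k h)"
      proof (cases "h \<in> ball 0 \<delta>")
        case True
        then have "norm h \<le> 1" using \<delta> by simp
        then have "\<bar>grad E x \<bullet> h\<bar> \<le> \<bar>smooth E (x + h) - smooth E x\<bar> + K0 * (norm h)\<^sup>2"
          using K0(2)[OF E, of h x] by linarith
        then have "ennreal \<bar>grad E x \<bullet> h\<bar> \<le> ennreal \<bar>smooth E (x + h) - smooth E x\<bar> + ennreal K0 * ennreal ((norm h)\<^sup>2)"
          using K0(1) by (simp add: ennreal_mult[symmetric] ennreal_plus[symmetric] ennreal_leI del: ennreal_plus)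
        from mult_right_mono[OF this, of "?k h"] show ?thesis by (simp add: distrib_right mult.assoc)
      qed simp
    qed simp
    also have "\<dots> = (\<integral>\<^sup>+x. ((\<integral>\<^sup>+h. ennreal \<bar>smooth E (x + h) - smooth E x\<bar> * ?k h \<partial>lborel) + ennreal K0 * ennreal (N s)) * indicator S x \<partial>lborel)"
    proof -
      have "(\<integral>\<^sup>+h. ennreal ((norm h)\<^sup>2) * ?k h \<partial>(lborel :: (real^'n) measure)) = ennreal (N s)"
        using nn_integral_kernel_near[OF s(2) \<delta>(1), of 2, where 'n='n] by (simp add: N_def mult.assoc)
      then show ?thesis by (simp add: nn_integral_add nn_integral_cmult)
    qed
    also have "\<dots> = (\<integral>\<^sup>+x. (\<integral>\<^sup>+h. ennreal \<bar>smooth E (x + h) - smooth E x\<bar> * ?k h \<partial>lborel) * indicator S x \<partial>lborel)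
        + ennreal K0 * ennreal (N s) * emeasure lborel S"
      by (simp add: distrib_right nn_integral_add nn_integral_cmult)
    also have "\<dots> \<le> near_energy s \<delta> E (\<Union>x\<in>S. ball x \<epsilon>) + ennreal K0 * ennreal (N s) * emeasure lborel S"
      by (intro add_right_mono smooth_energy_le_near_energy) auto
    also have "ennreal K0 * ennreal (N s) * emeasure lborel S = ennreal (K * (\<delta> powr (2 - 2 * s) / (2 - 2 * s)))"
      using s K0(1) unfolding fS by (simp add: ennreal_mult[symmetric] N_def K_def mult_ac)
    finally show ?thesis .
  qed
  then show ?thesis using K unfolding S_def by blast
qed

end

text \<open>Subtraction in \<open>ennreal\<close> cancels only finite terms; this is ensured because
  \<open>b\<close> is eventually below 1.\<close>

lemma ennreal_le_liminf:
  fixes a b :: "nat \<Rightarrow> ennreal"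
  assumes le: "\<And>m. V \<le> a m + b m" and b: "b \<longlonglongrightarrow> 0" and V: "V < \<infinity>"
  shows "V \<le> liminf a"
proof -
  have "(\<lambda>m. V - b m) \<longlonglongrightarrow> V - 0"
    using V by (intro tendsto_diff_ennreal b tendsto_const) auto
  then have "V = liminf (\<lambda>m. V - b m)" by (simp add: lim_imp_Liminf)
  also have "\<dots> \<le> liminf a"
  proof (rule Liminf_mono)
    have "\<forall>\<^sub>F m in sequentially. b m < 1" using order_tendstoD(2)[OF b, of 1] by simp
    then show "\<forall>\<^sub>F m in sequentially. V - b m \<le> a m"
    proof (rule eventually_mono)
      fix m assume "b m < 1"
      then have "b m \<noteq> top" by auto
      then have "a m + b m - b m = a m" by simp
      moreover have "V - b m \<le> a m + b m - b m" by (intro ennreal_minus_mono le) simp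
      ultimately show "V - b m \<le> a m" by simp
    qed
  qed
  finally show ?thesis .
qed

lemma borel_measurable_cball_indicator [measurable]:
  "(indicator (cball x r) :: 'a::euclidean_space \<Rightarrow> ennreal) \<in> borel_measurable borel"
  by (intro borel_measurable_indicator borel_closed closed_cball)

section \<open>Short-range energy bounded from above by the perimeter\<close>

context mollifier
begin

text \<open>The segment from x to x + h is cut into N pieces. Each has Taylor error K |h|^2 / N^2,
  so the total error is of order 1 / N and vanishes; this replaces integrating the gradient along
  the segment.\<close>

lemma smooth_difference_integral_le:
  assumes E [measurable]: "E \<in> sets borel" and [measurable]: "B \<in> sets borel" and B: "bounded B" and h: "norm h < \<delta>"
  shows "(\<integral>\<^sup>+x. ennreal \<bar>smooth E (x + h) - smooth E x\<bar> * indicator B x \<partial>lborel)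
    \<le> (\<integral>\<^sup>+x. ennreal \<bar>grad E x \<bullet> h\<bar> * indicator (\<Union>x\<in>B. ball x \<delta>) x \<partial>lborel)" (is "?l \<le> ?X")
proof -
  obtain K where K: "K \<ge> 0" "\<And>E x h. E \<in> sets borel \<Longrightarrow> norm h \<le> 1 \<Longrightarrow>
    \<bar>smooth E (x + h) - smooth E x - grad E x \<bullet> h\<bar> \<le> K * (norm h)\<^sup>2"
    using smooth_remainder by blast
  have fB: "emeasure lborel B = ennreal (measure lborel B)"
    using emeasure_bounded_finite[OF B] by (simp add: emeasure_eq_ennreal_measure)
  have [measurable]: "(\<Union>x\<in>B. ball x \<delta>) \<in> sets borel" by (intro borel_open open_UN) auto
  have est: "?l \<le> ?X + ennreal (K * (norm h)\<^sup>2 * measure lborel B / real N)" if N: "N \<ge> 1" "norm h \<le> real N" for N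
  proof -
    have N0: "real N > 0" using N(1) by simp
    have pt: "ennreal \<bar>smooth E (x + h) - smooth E x\<bar>
        \<le> (\<Sum>i<N. ennreal (1 / real N) * ennreal \<bar>grad E (x + (real i / real N) *\<^sub>R h) \<bullet> h\<bar>) + ennreal (K * (norm h)\<^sup>2 / real N)" for x
    proof -
      define z where "z i = x + (real i / real N) *\<^sub>R h" for i
      have zS: "z (Suc i) = z i + (1 / real N) *\<^sub>R h" for i
        by (simp add: z_def add_divide_distrib scaleR_add_left add.assoc add.commute)
      have "smooth E (x + h) - smooth E x = (\<Sum>i<N. smooth E (z (Suc i)) - smooth E (z i))"
        using N0 by (subst sum_lessThan_telescope) (simp add: z_def)
      then have "\<bar>smooth E (x + h) - smooth E x\<bar> \<le> (\<Sum>i<N. \<bar>smooth E (z (Suc i)) - smooth E (z i)\<bar>)" by simp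
      also have "\<dots> \<le> (\<Sum>i<N. 1 / real N * \<bar>grad E (z i) \<bullet> h\<bar> + K * (norm h)\<^sup>2 / (real N)\<^sup>2)"
      proof (rule sum_mono)
        fix i
        have "norm ((1 / real N) *\<^sub>R h) \<le> 1" using N N0 by (simp add: divide_le_eq)
        from K(2)[OF E this, of "z i"]
        have "\<bar>smooth E (z (Suc i)) - smooth E (z i)\<bar> \<le> \<bar>grad E (z i) \<bullet> ((1 / real N) *\<^sub>R h)\<bar> + K * (norm ((1 / real N) *\<^sub>R h))\<^sup>2"
          unfolding zS by linarith
        then show "\<bar>smooth E (z (Suc i)) - smooth E (z i)\<bar> \<le> 1 / real N * \<bar>grad E (z i) \<bullet> h\<bar> + K * (norm h)\<^sup>2 / (real N)\<^sup>2"
          by (simp add: abs_mult power_divide)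
      qed
      also have "\<dots> = (\<Sum>i<N. 1 / real N * \<bar>grad E (z i) \<bullet> h\<bar>) + K * (norm h)\<^sup>2 / real N"
        using N0 by (simp add: sum.distrib power2_eq_square)
      finally have "ennreal \<bar>smooth E (x + h) - smooth E x\<bar>
        \<le> ennreal ((\<Sum>i<N. 1 / real N * \<bar>grad E (z i) \<bullet> h\<bar>) + K * (norm h)\<^sup>2 / real N)" by (rule ennreal_leI)
      also have "\<dots> = (\<Sum>i<N. ennreal (1 / real N) * ennreal \<bar>grad E (z i) \<bullet> h\<bar>) + ennreal (K * (norm h)\<^sup>2 / real N)"
        using K(1) N0 by (subst ennreal_plus) (auto simp: sum_nonneg ennreal_mult[symmetric])
      finally show ?thesis by (simp only: z_def)
    qed
    \<comment> \<open>All intermediate points stay within |h| < \<delta> of \<open>B\<close>, so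
      translating each integral back lands in the same enlarged region.\<close>
    have shift: "(\<integral>\<^sup>+x. ennreal \<bar>grad E (x + (real i / real N) *\<^sub>R h) \<bullet> h\<bar> * indicator B x \<partial>lborel) \<le> ?X" if i: "i < N" for i
    proof -
      define w where "w = (real i / real N) *\<^sub>R h"
      have "norm w \<le> 1 * norm h" unfolding w_def norm_scaleR using i N0 by (intro mult_right_mono) auto
      then have w: "norm w < \<delta>" using h by simp
      have "(\<integral>\<^sup>+x. ennreal \<bar>grad E (x + w) \<bullet> h\<bar> * indicator B x \<partial>lborel)
          = (\<integral>\<^sup>+x. ennreal \<bar>grad E x \<bullet> h\<bar> * indicator B (x - w) \<partial>lborel)"
        using nn_integral_lborel_shift[of "\<lambda>x. ennreal \<bar>grad E x \<bullet> h\<bar> * indicator B (x - w)" w] by simp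
      also have "\<dots> \<le> ?X"
      proof (intro nn_integral_mono mult_left_mono)
        fix x
        show "indicator B (x - w) \<le> (indicator (\<Union>x\<in>B. ball x \<delta>) x :: ennreal)"
        proof (cases "x - w \<in> B")
          case True
          moreover have "x \<in> ball (x - w) \<delta>" using w by (simp add: dist_norm)
          ultimately have "x \<in> (\<Union>x\<in>B. ball x \<delta>)" by blast
          then show ?thesis by (simp add: indicator_def)
        qed simp
      qed simp
      finally show ?thesis unfolding w_def .
    qed
    have "?l \<le> (\<integral>\<^sup>+x. ((\<Sum>i<N. ennreal (1 / real N) * ennreal \<bar>grad E (x + (real i / real N) *\<^sub>R h) \<bullet> h\<bar>) + ennreal (K * (norm h)\<^sup>2 / real N)) * indicator B x \<partial>lborel)"
      by (intro nn_integral_mono mult_right_mono pt) simp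
    also have "\<dots> = (\<integral>\<^sup>+x. (\<Sum>i<N. ennreal (1 / real N) * (ennreal \<bar>grad E (x + (real i / real N) *\<^sub>R h) \<bullet> h\<bar> * indicator B x)) + ennreal (K * (norm h)\<^sup>2 / real N) * indicator B x \<partial>lborel)"
      by (simp only: distrib_right sum_distrib_right mult.assoc)
    also have "\<dots> = (\<Sum>i<N. ennreal (1 / real N) * (\<integral>\<^sup>+x. ennreal \<bar>grad E (x + (real i / real N) *\<^sub>R h) \<bullet> h\<bar> * indicator B x \<partial>lborel)) + ennreal (K * (norm h)\<^sup>2 / real N) * emeasure lborel B"
      by (simp add: nn_integral_add nn_integral_sum nn_integral_cmult)
    also have "\<dots> \<le> (\<Sum>i<N. ennreal (1 / real N) * ?X) + ennreal (K * (norm h)\<^sup>2 / real N) * emeasure lborel B"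
      by (intro add_right_mono sum_mono mult_left_mono shift) auto
    also have "(\<Sum>i<N. ennreal (1 / real N) * ?X) = ?X"
    proof -
      have "of_nat N * ennreal (1 / real N) = 1"
        using N0 by (simp add: ennreal_of_nat_eq_real_of_nat ennreal_mult[symmetric])
      then show ?thesis by (simp add: mult.assoc[symmetric])
    qed
    also have "ennreal (K * (norm h)\<^sup>2 / real N) * emeasure lborel B = ennreal (K * (norm h)\<^sup>2 * measure lborel B / real N)"
      unfolding fB using K(1) by (simp add: ennreal_mult[symmetric])
    finally show ?thesis .
  qed
  have "(\<lambda>N. ?X + ennreal (K * (norm h)\<^sup>2 * measure lborel B / real N)) \<longlonglongrightarrow> ?X + ennreal 0"
    by (intro tendsto_add tendsto_const tendsto_ennrealI lim_const_over_n)
  moreover have "\<exists>N0. \<forall>N\<ge>N0. ?l \<le> ?X + ennreal (K * (norm h)\<^sup>2 * measure lborel B / real N)"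
  proof (intro exI[of _ "max 1 (nat \<lceil>norm h\<rceil>)"] allI impI)
    fix N assume "N \<ge> max 1 (nat \<lceil>norm h\<rceil>)"
    then have "N \<ge> 1" "norm h \<le> real N" by (auto simp: nat_le_iff ceiling_le_iff)
    then show "?l \<le> ?X + ennreal (K * (norm h)\<^sup>2 * measure lborel B / real N)" by (rule est)
  qed
  ultimately have "?l \<le> ?X + ennreal 0" by (rule LIMSEQ_le_const)
  then show ?thesis by simp
qed

text \<open>Two enlargements of \<open>B\<close> have to fit into \<open>U\<close>: by \<delta> for
  the translations by h and by \<epsilon> for the mollification, whence \<delta> + \<epsilon> < r.
  The integral in h then converts directional increments of the gradient into its length.\<close>

lemma smooth_energy_le_Per_open:
  fixes E :: "(real^'n) set"
  assumes E [measurable]: "E \<in> sets borel" and m [measurable]: "B \<in> sets borel" and B: "bounded B" "\<And>x. x \<in> B \<Longrightarrow> ball x r \<subseteq> U"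
    and \<delta>: "0 < \<delta>" "\<delta> + \<epsilon> < r" and s: "s < 1/2"
  shows "(\<integral>\<^sup>+h. (\<integral>\<^sup>+x. ennreal \<bar>smooth E (x + h) - smooth E x\<bar> * indicator B x \<partial>lborel) * (riesz_kernel s h * indicator (ball 0 \<delta>) h) \<partial>lborel)
    \<le> ennreal (linear_const TYPE('n) s \<delta>) * e2ennreal (Per_open E U)"
proof -
  let ?k = "\<lambda>h. riesz_kernel s h * indicator (ball 0 \<delta>) h :: ennreal"
  let ?c = "ennreal (linear_const TYPE('n) s \<delta>)"
  let ?B = "\<Union>x\<in>B. ball x \<delta>"
  have [measurable]: "?B \<in> sets borel" by (intro borel_open open_UN) auto
  obtain R where R: "\<And>x. x \<in> B \<Longrightarrow> norm x \<le> R" using B(1) by (auto simp: bounded_iff)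
  have bB: "bounded ?B"
  proof -
    have "norm y \<le> R + \<delta>" if y: "y \<in> ?B" for y
    proof -
      obtain x where "x \<in> B" "norm (x - y) < \<delta>" using y by (auto simp: dist_norm)
      then show ?thesis using R[of x] norm_triangle_ineq2[of y x] by (simp add: norm_minus_commute)
    qed
    then show ?thesis unfolding bounded_iff by blast
  qed
  have BU: "ball y (r - \<delta>) \<subseteq> U" if y: "y \<in> ?B" for y
  proof -
    obtain x where x: "x \<in> B" "dist x y < \<delta>" using y by auto
    have "z \<in> ball x r" if "z \<in> ball y (r - \<delta>)" for z
      using that x(2) dist_triangle[of x z y] by simp
    then show ?thesis using B(2)[OF x(1)] by blast
  qed
  have "(\<integral>\<^sup>+h. (\<integral>\<^sup>+x. ennreal \<bar>smooth E (x + h) - smooth E x\<bar> * indicator B x \<partial>lborel) * ?k h \<partial>lborel)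
      \<le> (\<integral>\<^sup>+h. (\<integral>\<^sup>+x. ennreal \<bar>grad E x \<bullet> h\<bar> * indicator ?B x \<partial>lborel) * ?k h \<partial>lborel)"
  proof (rule nn_integral_mono)
    fix h :: "real^'n"
    show "(\<integral>\<^sup>+x. ennreal \<bar>smooth E (x + h) - smooth E x\<bar> * indicator B x \<partial>lborel) * ?k h
        \<le> (\<integral>\<^sup>+x. ennreal \<bar>grad E x \<bullet> h\<bar> * indicator ?B x \<partial>lborel) * ?k h"
    proof (cases "h \<in> ball 0 \<delta>")
      case True
      then have "norm h < \<delta>" by simp
      then show ?thesis by (intro mult_right_mono smooth_difference_integral_le[OF E m B(1)]) auto
    qed simp
  qed
  also have "\<dots> = (\<integral>\<^sup>+h. (\<integral>\<^sup>+x. ennreal \<bar>grad E x \<bullet> h\<bar> * indicator ?B x * ?k h \<partial>lborel) \<partial>lborel)"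
    by (simp add: nn_integral_multc)
  also have "\<dots> = (\<integral>\<^sup>+x. (\<integral>\<^sup>+h. ennreal \<bar>grad E x \<bullet> h\<bar> * indicator ?B x * ?k h \<partial>lborel) \<partial>lborel)"
    by (rule lborel_pair.Fubini') measurable
  also have "\<dots> = (\<integral>\<^sup>+x. (\<integral>\<^sup>+h. ennreal \<bar>grad E x \<bullet> h\<bar> * ?k h \<partial>lborel) * indicator ?B x \<partial>lborel)"
    by (intro nn_integral_cong, subst nn_integral_multc[symmetric]) (auto intro!: nn_integral_cong simp: mult_ac)
  also have "\<dots> = ?c * (\<integral>\<^sup>+x. ennreal (norm (grad E x)) * indicator ?B x \<partial>lborel)"
    by (simp only: nn_integral_kernel_linear'[OF s \<delta>(1)] mult.assoc) (simp add: nn_integral_cmult)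
  also have "\<dots> \<le> ?c * e2ennreal (Per_open E U)"
    using \<delta>(2) by (intro mult_left_mono grad_le_Per_open[OF E _ bB BU]) auto
  finally show ?thesis .
qed

text \<open>A continuous \<open>u\<close> is inserted between the set and its mollification. Its
  distance from the indicator enters twice, once averaged by \<open>\<rho>\<close> and once
  directly; \<eta> bounds its oscillation at scale \<epsilon>.\<close>

lemma smooth_approx:
  assumes E [measurable]: "E \<in> sets borel" and u: "continuous_on UNIV u" and e1: "\<epsilon> \<le> 1"
    and unif: "\<And>x y. norm x \<le> R \<Longrightarrow> dist x y < \<epsilon> \<Longrightarrow> \<bar>u y - u x\<bar> \<le> \<eta>"
  shows "(\<integral>\<^sup>+x. ennreal \<bar>smooth E x - indicator E x\<bar> * indicator (cball 0 R) x \<partial>lborel)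
    \<le> 2 * (\<integral>\<^sup>+y. ennreal \<bar>indicator E y - u y\<bar> \<partial>lborel) + ennreal \<eta> * emeasure lborel (cball (0::real^'n) R)"
proof -
  have [measurable]: "u \<in> borel_measurable borel" using u by (rule borel_measurable_continuous_onI)
  define A where "A = (\<integral>\<^sup>+y. ennreal \<bar>indicator E y - u y\<bar> \<partial>lborel)"
  have i1: "integrable lborel (\<lambda>y. \<rho> (x - y) * indicator E y)" for x
    using integrable_rho_mult(1)[of "indicator E :: _ \<Rightarrow> real" 1 x] by (auto simp: indicator_def)
  have i2: "integrable lborel (\<lambda>y. \<rho> (x - y) * c)" for x and c :: real
    using integrable_rho_mult(1)[of "\<lambda>y. c" "norm c" x] by simp
  have r1: "(\<integral>y. \<rho> (x - y) \<partial>lborel) = 1" for x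
    using i2[of x 1] nn_integral_eq_integral[of lborel "\<lambda>y. \<rho> (x - y)"] rho_nn_integral_shift(1)[of x] rho_nonneg by simp
  have pt: "ennreal \<bar>smooth E x - indicator E x\<bar> \<le> (\<integral>\<^sup>+y. ennreal (\<rho> (x - y)) * ennreal \<bar>indicator E y - u y\<bar> \<partial>lborel) + ennreal \<eta> + ennreal \<bar>indicator E x - u x\<bar>"
    if x: "norm x \<le> R" for x
  proof -
    have eta: "0 \<le> \<eta>" using unif[OF x, of x] eps by simp
    have eq: "smooth E x - indicator E x = (\<integral>y. \<rho> (x - y) * indicator E y - \<rho> (x - y) * indicator E x \<partial>lborel)"
      using i1 i2 by (simp add: smooth_def r1)
    have i3: "integrable lborel (\<lambda>y. \<bar>\<rho> (x - y) * indicator E y - \<rho> (x - y) * indicator E x\<bar>)"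
      by (intro integrable_abs Bochner_Integration.integrable_diff i1 i2)
    have "ennreal \<bar>smooth E x - indicator E x\<bar> \<le> ennreal (\<integral>y. \<bar>\<rho> (x - y) * indicator E y - \<rho> (x - y) * indicator E x\<bar> \<partial>lborel)"
      unfolding eq by (intro ennreal_leI integral_abs_bound)
    also have "\<dots> = (\<integral>\<^sup>+y. ennreal \<bar>\<rho> (x - y) * indicator E y - \<rho> (x - y) * indicator E x\<bar> \<partial>lborel)"
      by (rule nn_integral_eq_integral[symmetric, OF i3]) simp
    also have "\<dots> \<le> (\<integral>\<^sup>+y. ennreal (\<rho> (x - y)) * ennreal \<bar>indicator E y - u y\<bar> + ennreal (\<rho> (x - y)) * (ennreal \<eta> + ennreal \<bar>indicator E x - u x\<bar>) \<partial>lborel)"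
    proof (rule nn_integral_mono)
      fix y
      have "\<bar>\<rho> (x - y) * indicator E y - \<rho> (x - y) * indicator E x\<bar> \<le> \<rho> (x - y) * (\<bar>indicator E y - u y\<bar> + (\<eta> + \<bar>indicator E x - u x\<bar>))"
      proof (cases "dist x y < \<epsilon>")
        case True
        have "\<bar>\<rho> (x - y) * indicator E y - \<rho> (x - y) * indicator E x\<bar> = \<rho> (x - y) * \<bar>indicator E y - indicator E x\<bar>"
          using rho_nonneg[of "x - y"] by (simp add: right_diff_distrib[symmetric] abs_mult)
        also have "\<dots> \<le> \<rho> (x - y) * (\<bar>indicator E y - u y\<bar> + (\<eta> + \<bar>indicator E x - u x\<bar>))"
          using unif[OF x True] by (intro mult_left_mono rho_nonneg) linarith
        finally show ?thesis .
      next
        case False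
        then have "\<rho> (x - y) = 0" by (simp add: rho_zero dist_norm)
        then show ?thesis by simp
      qed
      then have "ennreal \<bar>\<rho> (x - y) * indicator E y - \<rho> (x - y) * indicator E x\<bar> \<le> ennreal (\<rho> (x - y) * (\<bar>indicator E y - u y\<bar> + (\<eta> + \<bar>indicator E x - u x\<bar>)))"
        by (rule ennreal_leI)
      also have "\<dots> = ennreal (\<rho> (x - y)) * (ennreal \<bar>indicator E y - u y\<bar> + (ennreal \<eta> + ennreal \<bar>indicator E x - u x\<bar>))"
        using eta rho_nonneg[of "x - y"] by (simp only: ennreal_mult ennreal_plus add_nonneg_nonneg abs_ge_zero)
      also have "\<dots> = ennreal (\<rho> (x - y)) * ennreal \<bar>indicator E y - u y\<bar> + ennreal (\<rho> (x - y)) * (ennreal \<eta> + ennreal \<bar>indicator E x - u x\<bar>)"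
        by (rule distrib_left)
      finally show "ennreal \<bar>\<rho> (x - y) * indicator E y - \<rho> (x - y) * indicator E x\<bar> \<le> ennreal (\<rho> (x - y)) * ennreal \<bar>indicator E y - u y\<bar> + ennreal (\<rho> (x - y)) * (ennreal \<eta> + ennreal \<bar>indicator E x - u x\<bar>)" .
    qed
    also have "\<dots> = (\<integral>\<^sup>+y. ennreal (\<rho> (x - y)) * ennreal \<bar>indicator E y - u y\<bar> \<partial>lborel) + (ennreal \<eta> + ennreal \<bar>indicator E x - u x\<bar>)"
      by (simp add: nn_integral_add nn_integral_multc rho_nn_integral_shift)
    finally show ?thesis by (simp add: add.assoc)
  qed
  have "(\<integral>\<^sup>+x. ennreal \<bar>smooth E x - indicator E x\<bar> * indicator (cball 0 R) x \<partial>lborel)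
      \<le> (\<integral>\<^sup>+x. (\<integral>\<^sup>+y. ennreal (\<rho> (x - y)) * ennreal \<bar>indicator E y - u y\<bar> \<partial>lborel) + ennreal \<eta> * indicator (cball 0 R) x + ennreal \<bar>indicator E x - u x\<bar> \<partial>lborel)"
    using pt by (intro nn_integral_mono) (auto simp: indicator_def[of "cball 0 R"])
  also have "\<dots> = (\<integral>\<^sup>+x. (\<integral>\<^sup>+y. ennreal (\<rho> (x - y)) * ennreal \<bar>indicator E y - u y\<bar> \<partial>lborel) \<partial>lborel) + ennreal \<eta> * emeasure lborel (cball (0::real^'n) R) + A"
    by (simp add: nn_integral_add nn_integral_cmult A_def)
  also have "(\<integral>\<^sup>+x. (\<integral>\<^sup>+y. ennreal (\<rho> (x - y)) * ennreal \<bar>indicator E y - u y\<bar> \<partial>lborel) \<partial>lborel) = (\<integral>\<^sup>+y. (\<integral>\<^sup>+x. ennreal (\<rho> (x - y)) * ennreal \<bar>indicator E y - u y\<bar> \<partial>lborel) \<partial>lborel)"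
    by (rule lborel_pair.Fubini') measurable
  also have "\<dots> = A" by (simp add: nn_integral_multc rho_nn_integral_shift A_def)
  finally show ?thesis unfolding A_def[symmetric] by (simp add: mult_2 add_ac)
qed

end

text \<open>Urysohn's lemma between a closed subset and an open superset of nearly the same measure
  gives a continuous function with L1 distance at most \<eta>/4 from the indicator. Used twice this
  costs \<eta>/2; uniform continuity on a compact ball takes care of the other half.\<close>

lemma smooth_tendsto_L1:
  fixes E :: "(real^'n) set"
  assumes E [measurable]: "E \<in> sets borel" and "\<eta> > 0"
  shows "\<exists>\<epsilon>0>0. \<forall>\<epsilon> \<rho> (D :: real^'n \<Rightarrow> real^'n) L. mollifier \<epsilon> \<rho> D L \<and> \<epsilon> < \<epsilon>0 \<longrightarrow>
    (\<integral>\<^sup>+x. ennreal \<bar>mollifier.smooth \<rho> E x - indicator E x\<bar> * indicator (cball 0 R) x \<partial>lborel) \<le> ennreal \<eta>"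
proof -
  have Eleb: "E \<in> sets lebesgue" using E by simp
  have e8: "\<eta>/8 > 0" using \<open>\<eta> > 0\<close> by simp
  obtain V where V: "open V" "E \<subseteq> V" "V - E \<in> lmeasurable" "emeasure lebesgue (V - E) < ennreal (\<eta>/8)"
    by (rule sets_lebesgue_outer_open[OF Eleb e8], rule that)
  obtain T where T: "closed T" "T \<subseteq> E" "E - T \<in> lmeasurable" "emeasure lebesgue (E - T) < ennreal (\<eta>/8)"
    by (rule sets_lebesgue_inner_closed[OF Eleb e8], rule that)
  have [measurable]: "V \<in> sets borel" "T \<in> sets borel" using V(1) T(1) by auto
  obtain u :: "real^'n \<Rightarrow> real" where u: "continuous_on UNIV u" "\<And>x. u x \<in> closed_segment 1 0"
    "\<And>x. x \<in> T \<Longrightarrow> u x = 1" "\<And>x. x \<in> - V \<Longrightarrow> u x = 0"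
  proof (rule Urysohn[of T "- V" "1::real" 0])
    show "closed T" "closed (- V)" "T \<inter> - V = {}" using V(1,2) T(1,2) by auto
  qed (rule that)
  have u01: "0 \<le> u x" "u x \<le> 1" for x using u(2)[of x] by (auto simp: closed_segment_eq_real_ivl)
  have [measurable]: "u \<in> borel_measurable borel" using u(1) by (rule borel_measurable_continuous_onI)
  have "(\<integral>\<^sup>+y. ennreal \<bar>indicator E y - u y\<bar> \<partial>lborel) \<le> (\<integral>\<^sup>+y. indicator (V - E) y + indicator (E - T) y \<partial>lborel)"
  proof (rule nn_integral_mono)
    fix y
    have "\<bar>indicator E y - u y\<bar> \<le> indicator (V - E) y + indicator (E - T) y"
      using u01[of y] u(3,4)[of y] V(2) T(2) by (auto simp: indicator_def)
    then have "ennreal \<bar>indicator E y - u y\<bar> \<le> ennreal (indicator (V - E) y + indicator (E - T) y)" by (rule ennreal_leI)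
    then show "ennreal \<bar>indicator E y - u y\<bar> \<le> indicator (V - E) y + indicator (E - T) y"
      by (simp add: ennreal_indicator)
  qed
  also have "\<dots> = emeasure lborel (V - E) + emeasure lborel (E - T)"
    by (simp add: nn_integral_add)
  also have "\<dots> \<le> ennreal (\<eta>/8) + ennreal (\<eta>/8)"
    using V(4) T(4) by (intro add_mono) auto
  also have "\<dots> = ennreal (\<eta>/4)" using \<open>\<eta> > 0\<close> by (simp add: ennreal_plus[symmetric] del: ennreal_plus)
  finally have A: "(\<integral>\<^sup>+y. ennreal \<bar>indicator E y - u y\<bar> \<partial>lborel) \<le> ennreal (\<eta>/4)" .
  define c where "c = measure lborel (cball (0::real^'n) R) + 1"
  have c: "c > 0" by (simp add: c_def add_nonneg_pos)
  have fc: "emeasure lborel (cball (0::real^'n) R) \<le> ennreal c"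
    using emeasure_lborel_cball_finite[of "0::real^'n" R]
    by (simp add: c_def emeasure_eq_ennreal_measure ennreal_leI)
  have "uniformly_continuous_on (cball 0 (R + 1)) u"
    by (intro compact_uniformly_continuous continuous_on_subset[OF u(1)]) auto
  moreover have "\<eta> / (2 * c) > 0" using \<open>\<eta> > 0\<close> c by simp
  ultimately have "\<exists>d>0. \<forall>x\<in>cball 0 (R + 1). \<forall>y\<in>cball 0 (R + 1). dist y x < d \<longrightarrow> dist (u y) (u x) < \<eta> / (2 * c)"
    unfolding uniformly_continuous_on_def by blast
  then obtain d where d: "d > 0" "\<And>x y. x \<in> cball 0 (R + 1) \<Longrightarrow> y \<in> cball 0 (R + 1) \<Longrightarrow> dist y x < d \<Longrightarrow> dist (u y) (u x) < \<eta> / (2 * c)"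
    by blast
  show ?thesis
  proof (intro exI[of _ "min 1 d"] conjI allI impI)
    show "min 1 d > 0" using d(1) by simp
    fix \<epsilon> \<rho> and D :: "real^'n \<Rightarrow> real^'n" and L
    assume a: "mollifier \<epsilon> \<rho> D L \<and> \<epsilon> < min 1 d"
    then interpret mollifier \<epsilon> \<rho> D L by simp
    have e: "\<epsilon> < min 1 d" using a by simp
    have un: "\<bar>u y - u x\<bar> \<le> \<eta> / (2 * c)" if xy: "norm x \<le> R" "dist x y < \<epsilon>" for x y
    proof -
      have "norm y \<le> norm x + dist y x" using norm_triangle_ineq2[of y x] by (simp add: dist_norm)
      moreover have "dist y x < d" "dist y x < 1" using xy(2) e by (simp_all add: dist_commute)
      ultimately have "dist (u y) (u x) < \<eta> / (2 * c)" using xy(1) by (intro d(2)) simp_all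
      then show ?thesis unfolding dist_real_def by linarith
    qed
    have e1: "\<epsilon> \<le> 1" using e by simp
    have "(\<integral>\<^sup>+x. ennreal \<bar>smooth E x - indicator E x\<bar> * indicator (cball 0 R) x \<partial>lborel)
      \<le> 2 * (\<integral>\<^sup>+y. ennreal \<bar>indicator E y - u y\<bar> \<partial>lborel) + ennreal (\<eta> / (2 * c)) * emeasure lborel (cball (0::real^'n) R)"
      by (rule smooth_approx[OF E u(1) e1 un])
    also have "\<dots> \<le> 2 * ennreal (\<eta>/4) + ennreal (\<eta> / (2 * c)) * ennreal c"
      by (intro add_mono mult_left_mono A fc zero_le)
    also have "2 * ennreal (\<eta>/4) + ennreal (\<eta> / (2 * c)) * ennreal c = ennreal \<eta>"
    proof -
      have "2 * ennreal (\<eta>/4) = ennreal (\<eta>/2)"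
        using \<open>\<eta> > 0\<close> by (simp add: mult_2 ennreal_plus[symmetric] del: ennreal_plus)
      moreover have "ennreal (\<eta> / (2 * c)) * ennreal c = ennreal (\<eta>/2)"
        using c \<open>\<eta> > 0\<close> by (simp add: ennreal_mult[symmetric])
      moreover have "ennreal (\<eta>/2) + ennreal (\<eta>/2) = ennreal \<eta>"
        using \<open>\<eta> > 0\<close> by (simp add: ennreal_plus[symmetric] del: ennreal_plus)
      ultimately show ?thesis by (simp only:)
    qed
    finally show "(\<integral>\<^sup>+x. ennreal \<bar>smooth E x - indicator E x\<bar> * indicator (cball 0 R) x \<partial>lborel) \<le> ennreal \<eta>" .
  qed
qed

text \<open>The bound for mollified sets has a right-hand side that does not see the mollifier, so
  Fatou's lemma in h transfers it to the set itself.\<close>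

lemma near_energy_le_Per_open:
  fixes E :: "(real^'n) set"
  assumes E [measurable]: "E \<in> sets borel" and mB [measurable]: "B \<in> sets borel"
    and B: "bounded B" "\<And>x. x \<in> B \<Longrightarrow> ball x r \<subseteq> U"
    and \<delta>: "0 < \<delta>" "\<delta> < r" and s: "s < 1/2"
  shows "near_energy s \<delta> E B \<le> ennreal (linear_const TYPE('n) s \<delta>) * e2ennreal (Per_open E U)"
proof -
  let ?k = "\<lambda>h. riesz_kernel s h * indicator (ball 0 \<delta>) h :: ennreal"
  let ?c = "ennreal (linear_const TYPE('n) s \<delta>) * e2ennreal (Per_open E U)"
  \<comment> \<open>The denominator exceeds 1 already for m = 0, which makes \<delta> + \<epsilon> m
    < r strict throughout.\<close>
  define \<epsilon> where "\<epsilon> m = (r - \<delta>) / (real m + 2)" for m :: nat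
  define \<rho> where "\<rho> m = (SOME \<rho> :: real^'n \<Rightarrow> real. \<exists>D L. mollifier (\<epsilon> m) \<rho> D L)" for m
  have eps: "\<epsilon> m > 0" "\<delta> + \<epsilon> m < r" for m
  proof -
    show "\<epsilon> m > 0" using \<delta> by (simp add: \<epsilon>_def)
    have "\<epsilon> m < (r - \<delta>) / 1" unfolding \<epsilon>_def using \<delta> by (intro divide_strict_left_mono) auto
    then show "\<delta> + \<epsilon> m < r" by simp
  qed
  have mol: "\<exists>D L. mollifier (\<epsilon> m) (\<rho> m) D L" for m
    using mollifier_exists[OF eps(1)[of m]] unfolding \<rho>_def by (rule someI_ex)
  define g where "g m = mollifier.smooth (\<rho> m) E" for m
  have [measurable]: "g m \<in> borel_measurable borel" for m
    using mol[of m] mollifier.smooth_measurable[OF _ E] unfolding g_def by blast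
  obtain R0 where R0: "\<And>x. x \<in> B \<Longrightarrow> norm x \<le> R0" using B(1) by (auto simp: bounded_iff)
  define R where "R = R0 + \<delta>"
  define e where "e m = (\<integral>\<^sup>+x. ennreal \<bar>g m x - indicator E x\<bar> * indicator (cball 0 R) x \<partial>lborel)" for m
  define V where "V h = (\<integral>\<^sup>+x. jump E x (x + h) * indicator B x \<partial>lborel)" for h
  define a where "a m h = (\<integral>\<^sup>+x. ennreal \<bar>g m (x + h) - g m x\<bar> * indicator B x \<partial>lborel)" for m h
  have [measurable]: "V \<in> borel_measurable borel" unfolding V_def[abs_def] by measurable
  have [measurable]: "a m \<in> borel_measurable borel" for m unfolding a_def[abs_def] by measurable
  have e0: "e \<longlonglongrightarrow> 0"
  proof (rule tendsto_zero_ennreal)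
    fix \<eta> :: real assume "0 < \<eta>"
    then have "\<eta>/2 > 0" by simp
    obtain \<epsilon>0 where e0: "\<epsilon>0 > 0" "\<forall>\<epsilon> \<rho> (D :: real^'n \<Rightarrow> real^'n) L. mollifier \<epsilon> \<rho> D L \<and> \<epsilon> < \<epsilon>0 \<longrightarrow>
      (\<integral>\<^sup>+x. ennreal \<bar>mollifier.smooth \<rho> E x - indicator E x\<bar> * indicator (cball 0 R) x \<partial>lborel) \<le> ennreal (\<eta>/2)"
      using smooth_tendsto_L1[OF E \<open>\<eta>/2 > 0\<close>, of R] by blast
    have "(\<lambda>m. (r - \<delta>) / real (m + 2)) \<longlonglongrightarrow> 0" by (rule LIMSEQ_ignore_initial_segment[OF lim_const_over_n])
    then have "\<epsilon> \<longlonglongrightarrow> 0" by (simp add: \<epsilon>_def[abs_def] add.commute)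
    then have "\<forall>\<^sub>F m in sequentially. \<epsilon> m < \<epsilon>0" using e0(1) by (rule order_tendstoD(2))
    then show "\<forall>\<^sub>F m in sequentially. e m < ennreal \<eta>"
    proof (rule eventually_mono)
      fix m assume "\<epsilon> m < \<epsilon>0"
      then have "e m \<le> ennreal (\<eta>/2)" using e0(2) mol[of m] unfolding e_def g_def by blast
      also have "\<dots> < ennreal \<eta>" using \<open>0 < \<eta>\<close> by (simp add: ennreal_less_iff)
      finally show "e m < ennreal \<eta>" .
    qed
  qed
  have Vle: "V h \<le> a m h + (e m + e m)" if h: "norm h < \<delta>" for m h
  proof -
    have "V h \<le> (\<integral>\<^sup>+x. ennreal \<bar>g m (x + h) - g m x\<bar> * indicator B x + (ennreal \<bar>g m x - indicator E x\<bar> * indicator (cball 0 R) x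
        + ennreal \<bar>g m (x + h) - indicator E (x + h)\<bar> * indicator (cball 0 R) (x + h)) \<partial>lborel)"
      unfolding V_def
    proof (rule nn_integral_mono)
      fix x
      show "jump E x (x + h) * indicator B x \<le> ennreal \<bar>g m (x + h) - g m x\<bar> * indicator B x + (ennreal \<bar>g m x - indicator E x\<bar> * indicator (cball 0 R) x
        + ennreal \<bar>g m (x + h) - indicator E (x + h)\<bar> * indicator (cball 0 R) (x + h))"
      proof (cases "x \<in> B")
        case True
        have "norm (x + h) \<le> R" "norm x \<le> R"
          using R0[OF True] h norm_triangle_ineq[of x h] \<delta>(1) by (simp_all add: R_def)
        moreover have "jump E x (x + h) \<le> ennreal (\<bar>g m (x + h) - g m x\<bar> + (\<bar>g m x - indicator E x\<bar> + \<bar>g m (x + h) - indicator E (x + h)\<bar>))"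
          unfolding jump_def by (intro ennreal_leI) linarith
        ultimately show ?thesis using True by simp
      qed simp
    qed
    also have "\<dots> = a m h + (e m + (\<integral>\<^sup>+x. ennreal \<bar>g m (x + h) - indicator E (x + h)\<bar> * indicator (cball 0 R) (x + h) \<partial>lborel))"
      unfolding a_def e_def by (simp add: nn_integral_add)
    also have "(\<integral>\<^sup>+x. ennreal \<bar>g m (x + h) - indicator E (x + h)\<bar> * indicator (cball 0 R) (x + h) \<partial>lborel) = e m"
      unfolding e_def by (rule nn_integral_lborel_shift) measurable
    finally show ?thesis .
  qed
  have Vfin: "V h < \<infinity>" for h
  proof -
    have "V h \<le> (\<integral>\<^sup>+x. indicator B x \<partial>lborel)"
      unfolding V_def by (intro nn_integral_mono) (simp add: jump_if indicator_def)
    also have "\<dots> < \<infinity>" using emeasure_bounded_finite[OF B(1)] by simp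
    finally show ?thesis .
  qed
  have "near_energy s \<delta> E B = (\<integral>\<^sup>+x. (\<integral>\<^sup>+h. jump E x (x + h) * ?k h * indicator B x \<partial>lborel) \<partial>lborel)"
    by (simp add: near_energy_def nn_integral_multc)
  also have "\<dots> = (\<integral>\<^sup>+h. (\<integral>\<^sup>+x. jump E x (x + h) * ?k h * indicator B x \<partial>lborel) \<partial>lborel)"
    by (rule lborel_pair.Fubini') measurable
  also have "\<dots> = (\<integral>\<^sup>+h. V h * ?k h \<partial>lborel)"
    unfolding V_def by (intro nn_integral_cong, subst nn_integral_multc[symmetric]) (auto intro!: nn_integral_cong simp: mult_ac)
  \<comment> \<open>For fixed h the approximation error is multiplied by the finite value of the
    kernel, so it vanishes in the limit although the kernel is unbounded in h.\<close>
  also have "\<dots> \<le> (\<integral>\<^sup>+h. liminf (\<lambda>m. a m h * ?k h) \<partial>lborel)"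
  proof (rule nn_integral_mono)
    fix h
    show "V h * ?k h \<le> liminf (\<lambda>m. a m h * ?k h)"
    proof (rule ennreal_le_liminf)
      show "V h * ?k h \<le> a m h * ?k h + (e m + e m) * ?k h" for m
      proof (cases "h \<in> ball 0 \<delta>")
        case True
        then have "norm h < \<delta>" by simp
        from mult_right_mono[OF Vle[OF this], of "?k h" m] show ?thesis by (simp add: distrib_right)
      qed simp
      have kf: "?k h < \<infinity>" by (simp add: riesz_kernel_def indicator_def)
      have "(\<lambda>m. ?k h * (e m + e m)) \<longlonglongrightarrow> ?k h * (0 + 0)"
        using kf by (intro ennreal_tendsto_cmult tendsto_add e0) auto
      then show "(\<lambda>m. (e m + e m) * ?k h) \<longlonglongrightarrow> 0" by (simp add: mult.commute)
      show "V h * ?k h < \<infinity>" using Vfin[of h] kf by (simp add: ennreal_mult_less_top)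
    qed
  qed
  also have "\<dots> \<le> liminf (\<lambda>m. \<integral>\<^sup>+h. a m h * ?k h \<partial>lborel)"
    by (rule nn_integral_liminf) measurable
  also have "\<dots> \<le> liminf (\<lambda>m. ?c)"
  proof (intro Liminf_mono always_eventually allI)
    fix m
    obtain D L where "mollifier (\<epsilon> m) (\<rho> m) D L" using mol[of m] by blast
    then show "(\<integral>\<^sup>+h. a m h * ?k h \<partial>lborel) \<le> ?c"
      unfolding a_def g_def by (rule mollifier.smooth_energy_le_Per_open[OF _ E mB B \<delta>(1) eps(2) s])
  qed
  also have "\<dots> = ?c" by (simp add: Liminf_const)
  finally show ?thesis .
qed

section \<open>The perimeter as a function of the region\<close>

lemma set_integral_divergence:
  assumes "E \<in> sets borel" "\<phi> \<in> C1_compact_support U"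
  shows "(LINT y:E|lebesgue. divergence \<phi> y) = (\<integral>y. indicator E y * divergence \<phi> y \<partial>lborel)"
  unfolding set_lebesgue_integral_def using assms(1) C1_measurable(3)[OF assms(2)] by (simp add: integral_completion)

lemma integrable_divergence:
  assumes "\<phi> \<in> C1_compact_support U"
  shows "integrable lborel (divergence \<phi>)"
proof -
  obtain C where C: "\<forall>x. norm (divergence \<phi> x) \<le> C" using C1_bounds(3)[OF assms] by blast
  show ?thesis
  proof (rule integrable_bounded_support[where C=C and S="closure {x. \<phi> x \<noteq> 0}"])
    show "divergence \<phi> \<in> borel_measurable borel" by (rule C1_measurable(3)[OF assms])
    show "divergence \<phi> x = 0" if "x \<notin> closure {x. \<phi> x \<noteq> 0}" for x using assms that by (rule divergence_zero)
    show "bounded (closure {x. \<phi> x \<noteq> 0})" using C1_support(1)[OF assms] by (rule compact_imp_bounded)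
    show "norm (divergence \<phi> x) \<le> C" for x using C by blast
  qed
qed

lemma integrable_indicator_mult:
  fixes f :: "'a \<Rightarrow> real"
  assumes "integrable M f" "A \<in> sets M"
  shows "integrable M (\<lambda>x. indicator A x * f x)"
  using integrable_mult_indicator[OF assms(2,1)] by simp

text \<open>The mollifier acts on the divergence, which is uniformly continuous, rather than on the
  set. Hence one threshold works for all Borel sets at once, in particular along a sequence.\<close>

lemma mollified_divergence_tendsto:
  fixes \<phi> :: "real^'n \<Rightarrow> real^'n"
  assumes phi: "\<phi> \<in> C1_compact_support U" and "\<eta> > 0"
  shows "\<exists>\<epsilon>0>0. \<forall>\<epsilon> \<rho> (D :: real^'n \<Rightarrow> real^'n) L. mollifier \<epsilon> \<rho> D L \<and> \<epsilon> < \<epsilon>0 \<longrightarrow>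
    (\<forall>E\<in>sets borel. \<bar>(\<integral>y. indicator E y * (\<integral>x. \<rho> (x - y) * divergence \<phi> x \<partial>lborel) \<partial>lborel)
      - (\<integral>y. indicator E y * divergence \<phi> y \<partial>lborel)\<bar> \<le> \<eta>)"
proof -
  note [measurable] = C1_measurable(3)[OF phi]
  let ?f = "divergence \<phi>"
  obtain R where R: "\<And>x. x \<in> closure {x. \<phi> x \<noteq> 0} \<Longrightarrow> norm x \<le> R"
    using compact_imp_bounded[OF C1_support(1)[OF phi]] by (auto simp: bounded_iff)
  have f0: "?f x = 0" if "norm x > R" for x
    using divergence_zero[OF phi, of x] R[of x] that by linarith
  obtain C where C: "\<forall>x. norm (?f x) \<le> C" using C1_bounds(3)[OF phi] by blast
  define c where "c = measure lborel (cball (0::real^'n) (R + 1)) + 1"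
  have c: "c > 0" by (simp add: c_def add_nonneg_pos)
  have "uniformly_continuous_on (cball 0 (R + 2)) ?f"
    by (intro compact_uniformly_continuous continuous_on_subset[OF divergence_continuous[OF phi]]) auto
  moreover have ec: "\<eta> / c > 0" using \<open>\<eta> > 0\<close> c by simp
  ultimately have "\<exists>d>0. \<forall>x\<in>cball 0 (R + 2). \<forall>y\<in>cball 0 (R + 2). dist y x < d \<longrightarrow> dist (?f y) (?f x) < \<eta> / c"
    unfolding uniformly_continuous_on_def by blast
  then obtain d where d: "d > 0" "\<And>x y. x \<in> cball 0 (R + 2) \<Longrightarrow> y \<in> cball 0 (R + 2) \<Longrightarrow> dist y x < d \<Longrightarrow> dist (?f y) (?f x) < \<eta> / c"
    by blast
  show ?thesis
  proof (intro exI[of _ "min 1 d"] conjI allI impI ballI)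
    show "min 1 d > 0" using d(1) by simp
    fix \<epsilon> \<rho> and D :: "real^'n \<Rightarrow> real^'n" and L and E :: "(real^'n) set"
    assume a: "mollifier \<epsilon> \<rho> D L \<and> \<epsilon> < min 1 d" and E: "E \<in> sets borel"
    interpret mollifier \<epsilon> \<rho> D L using a by simp
    have e: "\<epsilon> < 1" "\<epsilon> < d" using a by simp_all
    note E [measurable]
    define F where "F y = (\<integral>x. \<rho> (x - y) * ?f x \<partial>lborel) - ?f y" for y
    have [measurable]: "F \<in> borel_measurable borel" unfolding F_def[abs_def] by measurable
    have i1: "integrable lborel (\<lambda>x. \<rho> (x - y) * ?f x)" for y
      using integrable_rho_mult(2)[of ?f C y] C by simp
    have i2: "integrable lborel (\<lambda>x. \<rho> (x - y) * b)" for y and b :: real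
      using integrable_rho_mult(2)[of "\<lambda>y. b" "norm b" y] by simp
    have r1: "(\<integral>x. \<rho> (x - y) \<partial>lborel) = 1" for y
      using integral_lborel_shift[of \<rho> "- y"] rho_integral by simp
    have Fb: "\<bar>F y\<bar> \<le> (\<eta> / c) * indicator (cball 0 (R + 1)) y" for y
    proof (cases "norm y \<le> R + 1")
      case True
      have eq: "F y = (\<integral>x. \<rho> (x - y) * ?f x - \<rho> (x - y) * ?f y \<partial>lborel)"
        using i1 i2 by (simp add: F_def r1)
      have "\<bar>F y\<bar> \<le> (\<integral>x. \<bar>\<rho> (x - y) * ?f x - \<rho> (x - y) * ?f y\<bar> \<partial>lborel)"
        unfolding eq by (rule integral_abs_bound)
      also have "\<dots> \<le> (\<integral>x. \<rho> (x - y) * (\<eta> / c) \<partial>lborel)"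
      proof (rule integral_mono)
        show "integrable lborel (\<lambda>x. \<bar>\<rho> (x - y) * ?f x - \<rho> (x - y) * ?f y\<bar>)"
          by (intro integrable_abs Bochner_Integration.integrable_diff i1 i2)
        show "integrable lborel (\<lambda>x. \<rho> (x - y) * (\<eta> / c))" by (rule i2)
        fix x
        show "\<bar>\<rho> (x - y) * ?f x - \<rho> (x - y) * ?f y\<bar> \<le> \<rho> (x - y) * (\<eta> / c)"
        proof (cases "dist x y < \<epsilon>")
          case near: True
          have "norm x \<le> norm y + dist x y" using norm_triangle_ineq2[of x y] by (simp add: dist_norm)
          then have "x \<in> cball 0 (R + 2)" "y \<in> cball 0 (R + 2)" using True near e by simp_all
          then have "dist (?f x) (?f y) < \<eta> / c" using near e(2) by (intro d(2)) simp_all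
          then have "\<bar>?f x - ?f y\<bar> \<le> \<eta> / c" unfolding dist_real_def by linarith
          moreover have "\<bar>\<rho> (x - y) * ?f x - \<rho> (x - y) * ?f y\<bar> = \<rho> (x - y) * \<bar>?f x - ?f y\<bar>"
            using rho_nonneg[of "x - y"] by (simp add: right_diff_distrib[symmetric] abs_mult)
          ultimately show ?thesis using mult_left_mono[OF _ rho_nonneg[of "x - y"]] by metis
        next
          case False
          then have "\<rho> (x - y) = 0" by (simp add: rho_zero dist_norm)
          then show ?thesis by simp
        qed
      qed
      also have "\<dots> = \<eta> / c" by (simp add: r1)
      finally show ?thesis using True by simp
    next
      case False
      have "\<rho> (x - y) * ?f x = 0" for x
      proof (cases "norm (x - y) < \<epsilon>")
        case True
        then have "norm x > R" using False e(1) norm_triangle_ineq2[of y x] by (simp add: norm_minus_commute)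
        then show ?thesis by (simp add: f0)
      qed (simp add: rho_zero)
      then have "F y = 0" using f0[of y] False unfolding F_def by (simp only: integral_zero)
      then show ?thesis using False by simp
    qed
    have iB: "integrable lborel (\<lambda>y. (\<eta> / c) * indicator (cball (0::real^'n) (R + 1)) y)"
      by (intro integrable_const_indicator) auto
    have iF: "integrable lborel F"
    proof (rule Bochner_Integration.integrable_bound[OF iB])
      show "AE y in lborel. norm (F y) \<le> norm ((\<eta> / c) * indicator (cball (0::real^'n) (R + 1)) y :: real)"
      proof (rule AE_I2)
        fix y
        show "norm (F y) \<le> norm ((\<eta> / c) * indicator (cball (0::real^'n) (R + 1)) y :: real)"
          using Fb[of y] unfolding real_norm_def by linarith
      qed
    qed measurable
    have "(\<integral>y. indicator E y * (\<integral>x. \<rho> (x - y) * ?f x \<partial>lborel) \<partial>lborel) = (\<integral>y. indicator E y * F y + indicator E y * ?f y \<partial>lborel)"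
      by (simp add: F_def distrib_left[symmetric])
    also have "\<dots> = (\<integral>y. indicator E y * F y \<partial>lborel) + (\<integral>y. indicator E y * ?f y \<partial>lborel)"
      by (intro Bochner_Integration.integral_add integrable_indicator_mult iF integrable_divergence[OF phi]) measurable
    finally have eq: "(\<integral>y. indicator E y * (\<integral>x. \<rho> (x - y) * ?f x \<partial>lborel) \<partial>lborel) - (\<integral>y. indicator E y * ?f y \<partial>lborel)
        = (\<integral>y. indicator E y * F y \<partial>lborel)" by simp
    have "\<bar>\<integral>y. indicator E y * F y \<partial>lborel\<bar> \<le> (\<integral>y. \<bar>indicator E y * F y\<bar> \<partial>lborel)"
      by (rule integral_abs_bound)
    also have "\<dots> \<le> (\<integral>y. (\<eta> / c) * indicator (cball (0::real^'n) (R + 1)) y \<partial>lborel)"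
    proof (rule integral_mono'[OF iB])
      fix y
      show "\<bar>indicator E y * F y\<bar> \<le> (\<eta> / c) * indicator (cball (0::real^'n) (R + 1)) y"
        using Fb[of y] ec by (cases "y \<in> E") auto
      show "0 \<le> (\<eta> / c) * indicator (cball (0::real^'n) (R + 1)) y" using ec by (intro mult_nonneg_nonneg) auto
    qed
    also have "\<dots> = \<eta> / c * (c - 1)" by (simp add: c_def)
    also have "\<dots> \<le> \<eta> / c * c" using ec by (intro mult_left_mono) auto
    also have "\<dots> = \<eta>" using c by simp
    finally show "\<bar>(\<integral>y. indicator E y * (\<integral>x. \<rho> (x - y) * ?f x \<partial>lborel) \<partial>lborel)
      - (\<integral>y. indicator E y * ?f y \<partial>lborel)\<bar> \<le> \<eta>" unfolding eq .
  qed
qed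

lemma zero_C1_compact_support: "(\<lambda>_. 0) \<in> C1_compact_support U"
proof -
  have "frechet_derivative (\<lambda>_::real^'n. 0::real^'n) (at x) = (\<lambda>_. 0)" for x
    by (rule frechet_derivative_at[symmetric]) simp
  then show ?thesis by (simp add: C1_compact_support_def compactly_contained_def)
qed

lemma divergence_0: "divergence (\<lambda>_. 0) x = 0"
proof -
  have "frechet_derivative (\<lambda>_::real^'n. 0::real^'n) (at x) = (\<lambda>_. 0)" for x
    by (rule frechet_derivative_at[symmetric]) simp
  then show ?thesis by (simp add: divergence_def)
qed

lemma Per_open_nonneg: "0 \<le> Per_open E U"
proof -
  have "ereal (LINT x:E|lebesgue. divergence (\<lambda>_. 0) x) \<le> Per_open E U"
    unfolding Per_open_def by (rule SUP_upper) (simp add: zero_C1_compact_support)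
  then show ?thesis by (simp add: divergence_0 set_lebesgue_integral_def zero_ereal_def)
qed

lemma compact_ball_subset_open:
  fixes S :: "'a::heine_borel set"
  assumes "compact S" "S \<subseteq> U" "open U"
  shows "\<exists>r>0. \<forall>x\<in>S. ball x r \<subseteq> U"
proof (rule Heine_Borel_lemma[OF assms(1), of "{U}"])
  fix e :: real assume e: "0 < e" "\<And>x. x \<in> S \<Longrightarrow> \<exists>G\<in>{U}. ball x e \<subseteq> G"
  then have "\<forall>x\<in>S. ball x e \<subseteq> U" by simp
  with e(1) show ?thesis by blast
qed (use assms in auto)

lemma nn_integral_indicator_Un_le:
  assumes [measurable]: "f \<in> borel_measurable M" "A \<in> sets M" "B \<in> sets M" and "S \<subseteq> A \<union> B"
  shows "(\<integral>\<^sup>+x. f x * indicator S x \<partial>M) \<le> (\<integral>\<^sup>+x. f x * indicator A x \<partial>M) + (\<integral>\<^sup>+x. f x * indicator B x \<partial>M)"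
proof -
  have "(\<integral>\<^sup>+x. f x * indicator S x \<partial>M) \<le> (\<integral>\<^sup>+x. f x * indicator A x + f x * indicator B x \<partial>M)"
    using assms(4) by (intro nn_integral_mono) (auto simp: indicator_def)
  also have "\<dots> = (\<integral>\<^sup>+x. f x * indicator A x \<partial>M) + (\<integral>\<^sup>+x. f x * indicator B x \<partial>M)"
    by (rule nn_integral_add) measurable
  finally show ?thesis .
qed

lemma enn2ereal_e2ennreal_Per: "enn2ereal (e2ennreal (Per_open E U)) = Per_open E U"
  by (rule enn2ereal_e2ennreal) (rule Per_open_nonneg)

text \<open>Mollifying the set turns the divergence into the integral of a gradient, which is additive in the region.\<close>

lemma Per_open_subadditive:
  fixes E :: "(real^'n) set"
  assumes E: "E \<in> sets borel" and U: "open U1" "open U2" "U \<subseteq> U1 \<union> U2"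
  shows "Per_open E U \<le> Per_open E U1 + Per_open E U2"
  unfolding Per_open_def[of E U]
proof (rule SUP_least)
  fix \<phi> :: "real^'n \<Rightarrow> real^'n" assume "\<phi> \<in> {\<phi> \<in> C1_compact_support U. \<forall>x. norm (\<phi> x) \<le> 1}"
  then have phi: "\<phi> \<in> C1_compact_support U" "\<And>x. norm (\<phi> x) \<le> 1" by auto
  define S where "S = closure {x. \<phi> x \<noteq> 0}"
  have S: "compact S" "S \<subseteq> \<Union>{U1, U2}" "bounded S"
    using C1_support[OF phi(1)] U(3) by (auto simp: S_def compact_imp_bounded)
  \<comment> \<open>A Lebesgue number of the cover: the support splits into points whose r-ball lies
    in \<open>U1\<close> and points whose r-ball lies in \<open>U2\<close>. For \<epsilon> < r the
    gradient integral on each piece is controlled by the perimeter in the corresponding open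
    set.\<close>
  obtain r where r: "r > 0" "\<And>x. x \<in> S \<Longrightarrow> \<exists>G\<in>{U1, U2}. ball x r \<subseteq> G"
    by (rule Heine_Borel_lemma[OF S(1,2)]) (use U in auto)
  define B where "B G = S \<inter> {x. ball x r \<subseteq> G}" for G
  have "{x. ball x r \<subseteq> G} = - (\<Union>y\<in>- G. ball y r)" for G :: "(real^'n) set"
    by (auto simp: subset_eq dist_commute)
  then have "closed {x. ball x r \<subseteq> G}" for G :: "(real^'n) set"
    by (auto intro!: open_UN)
  then have BB [measurable]: "B G \<in> sets borel" for G
    unfolding B_def using S(1) by (intro sets.Int borel_closed compact_imp_closed) auto
  have Bb: "bounded (B G)" for G unfolding B_def using S(3) by (rule bounded_subset) auto
  have SB: "S \<subseteq> B U1 \<union> B U2" using r(2) by (auto simp: B_def)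
  show "ereal (LINT y:E|lebesgue. divergence \<phi> y) \<le> Per_open E U1 + Per_open E U2"
  proof (rule ereal_le_epsilon2)
    fix \<eta> :: real assume "0 < \<eta>"
    obtain \<epsilon>0 where e0: "\<epsilon>0 > 0" "\<forall>\<epsilon> \<rho> (D :: real^'n \<Rightarrow> real^'n) L. mollifier \<epsilon> \<rho> D L \<and> \<epsilon> < \<epsilon>0 \<longrightarrow>
      (\<forall>E\<in>sets borel. \<bar>(\<integral>y. indicator E y * (\<integral>x. \<rho> (x - y) * divergence \<phi> x \<partial>lborel) \<partial>lborel)
      - (\<integral>y. indicator E y * divergence \<phi> y \<partial>lborel)\<bar> \<le> \<eta>)"
      using mollified_divergence_tendsto[OF phi(1) \<open>0 < \<eta>\<close>] by blast
    define \<epsilon> where "\<epsilon> = min \<epsilon>0 r / 2"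
    have ep: "\<epsilon> > 0" "\<epsilon> < \<epsilon>0" "\<epsilon> < r" using e0(1) r(1) by (auto simp: \<epsilon>_def)
    obtain \<rho> and D :: "real^'n \<Rightarrow> real^'n" and L where mol: "mollifier \<epsilon> \<rho> D L"
      using mollifier_exists[OF ep(1)] by blast
    interpret mollifier \<epsilon> \<rho> D L by (rule mol)
    let ?I = "\<integral>y. indicator E y * (\<integral>x. \<rho> (x - y) * divergence \<phi> x \<partial>lborel) \<partial>lborel"
    have "(LINT y:E|lebesgue. divergence \<phi> y) \<le> ?I + \<eta>"
    proof -
      have "\<bar>?I - (\<integral>y. indicator E y * divergence \<phi> y \<partial>lborel)\<bar> \<le> \<eta>" using e0(2) mol ep(2) E by blast
      then show ?thesis unfolding set_integral_divergence[OF E phi(1)] by linarith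
    qed
    then have "ereal (LINT y:E|lebesgue. divergence \<phi> y) \<le> ereal ?I + ereal \<eta>" by simp
    also have "ereal ?I \<le> Per_open E U1 + Per_open E U2"
    proof -
      have gm: "(\<lambda>x. ennreal (norm (grad E x))) \<in> borel_measurable lborel"
        using grad_measurable[OF E] by measurable
      have "ennreal ?I \<le> (\<integral>\<^sup>+x. ennreal (norm (grad E x)) * indicator S x \<partial>lborel)"
        unfolding S_def by (rule mollified_divergence_le_grad[OF E phi])
      also have "\<dots> \<le> (\<integral>\<^sup>+x. ennreal (norm (grad E x)) * indicator (B U1) x \<partial>lborel) + (\<integral>\<^sup>+x. ennreal (norm (grad E x)) * indicator (B U2) x \<partial>lborel)"
        using SB by (intro nn_integral_indicator_Un_le gm) simp_all
      also have "\<dots> \<le> e2ennreal (Per_open E U1) + e2ennreal (Per_open E U2)"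
        using ep(3) by (intro add_mono grad_le_Per_open[OF E BB Bb]) (auto simp: B_def)
      finally have "enn2ereal (ennreal ?I) \<le> enn2ereal (e2ennreal (Per_open E U1) + e2ennreal (Per_open E U2))"
        by (simp add: less_eq_ennreal.rep_eq)
      also have "\<dots> = Per_open E U1 + Per_open E U2"
        by (simp add: plus_ennreal.rep_eq enn2ereal_e2ennreal_Per)
      finally have "enn2ereal (ennreal ?I) \<le> Per_open E U1 + Per_open E U2" .
      moreover have "ereal ?I \<le> enn2ereal (ennreal ?I)" by (cases "0 \<le> ?I") (auto simp: enn2ereal_ennreal ennreal_neg zero_ennreal.rep_eq)
      ultimately show ?thesis by (rule order_trans[rotated])
    qed
    finally show "ereal (LINT y:E|lebesgue. divergence \<phi> y) \<le> Per_open E U1 + Per_open E U2 + ereal \<eta>"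
      by (simp add: add_right_mono)
  qed
qed

text \<open>Fields supported in disjoint regions can be added without exceeding norm 1, and their
  divergences add up.\<close>

lemma Per_open_superadditive:
  fixes E :: "(real^'n) set"
  assumes E: "E \<in> sets borel" and U: "U1 \<inter> U2 = {}" "U1 \<union> U2 \<subseteq> U"
  shows "Per_open E U1 + Per_open E U2 \<le> Per_open E U"
proof -
  have key: "ereal (LINT y:E|lebesgue. divergence \<phi>1 y) + ereal (LINT y:E|lebesgue. divergence \<phi>2 y) \<le> Per_open E U"
    if p1: "\<phi>1 \<in> C1_compact_support U1" "\<And>x. norm (\<phi>1 x) \<le> 1" and p2: "\<phi>2 \<in> C1_compact_support U2" "\<And>x. norm (\<phi>2 x) \<le> 1"
    for \<phi>1 \<phi>2
  proof -
    define \<phi> where "\<phi> x = \<phi>1 x + \<phi>2 x" for x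
    have der: "(\<phi> has_derivative (\<lambda>h. frechet_derivative \<phi>1 (at x) h + frechet_derivative \<phi>2 (at x) h)) (at x)" for x
      unfolding \<phi>_def by (intro has_derivative_add C1_has_derivative[OF p1(1)] C1_has_derivative[OF p2(1)])
    have fd: "frechet_derivative \<phi> (at x) = (\<lambda>h. frechet_derivative \<phi>1 (at x) h + frechet_derivative \<phi>2 (at x) h)" for x
      by (rule frechet_derivative_at[symmetric, OF der])
    have sub: "closure {x. \<phi> x \<noteq> 0} \<subseteq> closure {x. \<phi>1 x \<noteq> 0} \<union> closure {x. \<phi>2 x \<noteq> 0}"
      unfolding closure_Un[symmetric] by (intro closure_mono) (auto simp: \<phi>_def)
    have "compact (closure {x. \<phi> x \<noteq> 0})"
      using sub C1_support(1)[OF p1(1)] C1_support(1)[OF p2(1)]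
      by (meson bounded_subset closed_closure compact_Un compact_eq_bounded_closed)
    moreover have "closure {x. \<phi> x \<noteq> 0} \<subseteq> U"
      using sub C1_support(2)[OF p1(1)] C1_support(2)[OF p2(1)] U(2) by blast
    ultimately have phi: "\<phi> \<in> C1_compact_support U"
      unfolding C1_compact_support_def compactly_contained_def fd mem_Collect_eq
      using der by (auto simp: differentiable_def intro!: continuous_on_add C1_derivative_continuous[OF p1(1)] C1_derivative_continuous[OF p2(1)])
    have "norm (\<phi> x) \<le> 1" for x
    proof (cases "x \<in> U1")
      case True
      then have "\<phi>2 x = 0" using U(1) C1_support(2)[OF p2(1)] C1_zero[of x \<phi>2] by blast
      then show ?thesis using p1(2)[of x] by (simp add: \<phi>_def)
    next
      case False
      then have "\<phi>1 x = 0" using C1_support(2)[OF p1(1)] C1_zero[of x \<phi>1] by blast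
      then show ?thesis using p2(2)[of x] by (simp add: \<phi>_def)
    qed
    then have "ereal (LINT y:E|lebesgue. divergence \<phi> y) \<le> Per_open E U"
      unfolding Per_open_def using phi by (intro SUP_upper) simp
    moreover have "divergence \<phi> y = divergence \<phi>1 y + divergence \<phi>2 y" for y
      unfolding divergence_def fd by (simp add: sum.distrib)
    then have "(LINT y:E|lebesgue. divergence \<phi> y) = (LINT y:E|lebesgue. divergence \<phi>1 y) + (LINT y:E|lebesgue. divergence \<phi>2 y)"
      unfolding set_integral_divergence[OF E phi] set_integral_divergence[OF E p1(1)] set_integral_divergence[OF E p2(1)]
      using E by (simp add: distrib_left integrable_indicator_mult integrable_divergence[OF p1(1)] integrable_divergence[OF p2(1)])
    ultimately show ?thesis by simp
  qed
  show ?thesis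
  proof (cases "Per_open E U")
    case (real p)
    \<comment> \<open>The two suprema are taken one after the other, the second field being fixed
      during the first; differences are formed with real numbers only.\<close>
    have "Per_open E U1 \<le> ereal p - ereal (LINT y:E|lebesgue. divergence \<phi>2 y)"
      if "\<phi>2 \<in> C1_compact_support U2" "\<And>x. norm (\<phi>2 x) \<le> 1" for \<phi>2
      unfolding Per_open_def[of E U1]
    proof (rule SUP_least)
      fix \<phi>1 :: "real^'n \<Rightarrow> real^'n" assume "\<phi>1 \<in> {\<phi> \<in> C1_compact_support U1. \<forall>x. norm (\<phi> x) \<le> 1}"
      then show "ereal (LINT y:E|lebesgue. divergence \<phi>1 y) \<le> ereal p - ereal (LINT y:E|lebesgue. divergence \<phi>2 y)"
        using key[of \<phi>1 \<phi>2] that real by (simp add: algebra_simps)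
    qed
    note le = this
    have "Per_open E U1 \<le> Per_open E U" by (rule Per_open_mono) (use U in auto)
    then obtain p1 where p1: "Per_open E U1 = ereal p1"
      using Per_open_nonneg[of E U1] real by (cases "Per_open E U1") auto
    have "Per_open E U2 \<le> ereal (p - p1)"
      unfolding Per_open_def[of E U2]
    proof (rule SUP_least)
      fix \<phi>2 :: "real^'n \<Rightarrow> real^'n" assume "\<phi>2 \<in> {\<phi> \<in> C1_compact_support U2. \<forall>x. norm (\<phi> x) \<le> 1}"
      then show "ereal (LINT y:E|lebesgue. divergence \<phi>2 y) \<le> ereal (p - p1)"
        using le[of \<phi>2] p1 by simp
    qed
    then have "Per_open E U1 + Per_open E U2 \<le> ereal p1 + ereal (p - p1)"
      unfolding p1 by (rule add_left_mono)
    then show ?thesis by (simp add: real)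
  qed (use Per_open_nonneg[of E U] in auto)
qed

lemma ennreal_le_add_imp_ereal_le:
  assumes "ennreal a \<le> 2 * X + ennreal K" "0 \<le> K"
  shows "ereal ((a - K) / 2) \<le> enn2ereal X"
proof (cases X)
  case (real x)
  have "ennreal (2 * x + K) = ennreal 2 * ennreal x + ennreal K"
    using real assms(2) by (subst ennreal_plus) (auto simp: ennreal_mult')
  then have "ennreal a \<le> ennreal (2 * x + K)"
    using assms(1) real by simp
  then have "a \<le> 2 * x + K" using real assms(2) ennreal_le_iff[of "2 * x + K" a] by simp
  then show ?thesis using real by (simp add: enn2ereal_ennreal)
qed (simp add: top_ennreal.rep_eq)

lemma linear_const_scaled:
  assumes "s < 1/2"
  shows "(1 - 2 * s) * linear_const TYPE('n::finite) s \<delta> = 2 * unit_ball_vol (real (CARD('n) - 1)) * \<delta> powr (1 - 2 * s)"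
  using assms by (simp add: linear_const_def)

lemma powr_tendsto_1:
  fixes s :: "nat \<Rightarrow> real"
  assumes "s \<longlonglongrightarrow> 1/2" "\<delta> > 0"
  shows "(\<lambda>j. \<delta> powr (1 - 2 * s j)) \<longlonglongrightarrow> 1"
proof -
  have "(\<lambda>j. \<delta> powr (1 - 2 * s j)) \<longlonglongrightarrow> \<delta> powr (1 - 2 * (1/2))"
    using assms by (intro tendsto_intros) auto
  then show ?thesis using assms(2) by simp
qed

text \<open>\<open>X\<close> is left abstract: any quantity that dominates half of the short-range
  energy in \<open>U\<close> will do. The half accounts for ordered pairs and cancels the 2 of
  \<open>linear_const\<close>.\<close>

lemma Per_open_le_liminf:
  fixes E :: "(real^'n) set" and s :: "nat \<Rightarrow> real"
  assumes E: "E \<in> sets borel" "\<And>j. Ej j \<in> sets borel" and "open U"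
    and conv: "\<And>R. (\<lambda>j. measure lborel (cball 0 R \<inter> sym_diff (Ej j) E)) \<longlonglongrightarrow> 0"
    and s: "\<And>j. 0 < s j" "\<And>j. s j < 1/2" "s \<longlonglongrightarrow> 1/2"
    and X: "\<And>j \<delta> B. \<forall>x\<in>B. ball x \<delta> \<subseteq> U \<Longrightarrow> near_energy (s j) \<delta> (Ej j) B \<le> 2 * X j"
  shows "ereal (unit_ball_vol (real (CARD('n) - 1))) * Per_open E U \<le> liminf (\<lambda>j. ereal (1 - 2 * s j) * enn2ereal (X j))"
proof -
  define w where "w = unit_ball_vol (real (CARD('n) - 1))"
  have w: "w > 0" by (simp add: w_def)
  define \<Lambda> where "\<Lambda> = liminf (\<lambda>j. ereal (1 - 2 * s j) * enn2ereal (X j))"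
  have main: "ereal (w * ((LINT y:E|lebesgue. divergence \<phi> y) - \<eta>)) \<le> \<Lambda>"
    if phi: "\<phi> \<in> C1_compact_support U" "\<And>x. norm (\<phi> x) \<le> 1" and eta: "\<eta> > 0" for \<phi> \<eta>
  proof -
    define S where "S = closure {x. \<phi> x \<noteq> 0}"
    have S: "compact S" "S \<subseteq> U" using C1_support[OF phi(1)] by (auto simp: S_def)
    obtain r where r: "r > 0" "\<forall>x\<in>S. ball x r \<subseteq> U" using compact_ball_subset_open[OF S \<open>open U\<close>] by blast
    obtain R where R: "\<And>x. x \<in> S \<Longrightarrow> norm x \<le> R"
      using compact_imp_bounded[OF S(1)] by (auto simp: bounded_iff)
    obtain C where C: "C \<ge> 0" "\<forall>x. norm (divergence \<phi> x) \<le> C" using C1_bounds(3)[OF phi(1)] by blast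
    obtain \<epsilon>0 where e0: "\<epsilon>0 > 0" "\<forall>\<epsilon> \<rho> (D :: real^'n \<Rightarrow> real^'n) L. mollifier \<epsilon> \<rho> D L \<and> \<epsilon> < \<epsilon>0 \<longrightarrow>
      (\<forall>E\<in>sets borel. \<bar>(\<integral>y. indicator E y * (\<integral>x. \<rho> (x - y) * divergence \<phi> x \<partial>lborel) \<partial>lborel)
      - (\<integral>y. indicator E y * divergence \<phi> y \<partial>lborel)\<bar> \<le> \<eta>)"
      using mollified_divergence_tendsto[OF phi(1) eta] by blast
    define \<epsilon> where "\<epsilon> = min \<epsilon>0 r / 2"
    have eps: "\<epsilon> > 0" "\<epsilon> < \<epsilon>0" "\<epsilon> \<le> r / 2" using e0(1) r(1) by (auto simp: \<epsilon>_def)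
    define \<delta> where "\<delta> = min 1 (r / 2)"
    have \<delta>: "0 < \<delta>" "\<delta> \<le> 1" "\<delta> \<le> r / 2" using r(1) by (auto simp: \<delta>_def)
    obtain \<rho> and D :: "real^'n \<Rightarrow> real^'n" and L where mol: "mollifier \<epsilon> \<rho> D L"
      using mollifier_exists[OF eps(1)] by blast
    let ?B = "\<Union>x\<in>S. ball x \<epsilon>"
    obtain K where K: "K \<ge> 0" "\<forall>E\<in>sets borel. \<forall>s. 0 < s \<and> s < 1/2 \<longrightarrow>
      ennreal (linear_const TYPE('n) s \<delta>) * ennreal (\<integral>y. indicator E y * (\<integral>x. \<rho> (x - y) * divergence \<phi> x \<partial>lborel) \<partial>lborel)
      \<le> near_energy s \<delta> E ?B + ennreal (K * (\<delta> powr (2 - 2 * s) / (2 - 2 * s)))"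
      using mollifier.mollified_divergence_le_near_energy[OF mol phi \<delta>(1,2)] unfolding S_def by blast
    have BU: "\<forall>x\<in>?B. ball x \<delta> \<subseteq> U"
    proof
      fix y assume "y \<in> ?B"
      then obtain x where x: "x \<in> S" "dist x y < \<epsilon>" by auto
      have "z \<in> ball x r" if "z \<in> ball y \<delta>" for z
        using that x(2) dist_triangle[of x z y] eps(3) \<delta>(3) by simp
      then show "ball y \<delta> \<subseteq> U" using r(2) x(1) by blast
    qed
    define J where "J E = (\<integral>y. indicator E y * divergence \<phi> y \<partial>lborel)" for E :: "(real^'n) set"
    \<comment> \<open>Replacing the set in the test integral costs the bound of the divergence times
      the volume of the mismatch inside a ball that contains the support.\<close>
    have JE: "J (Ej j) \<ge> J E - C * measure lborel (cball 0 R \<inter> sym_diff (Ej j) E)" for j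
    proof -
      let ?A = "cball 0 R \<inter> sym_diff (Ej j) E"
      have A: "?A \<in> sets borel" "bounded ?A" using E(1) E(2)[of j] by (auto intro: bounded_subset[OF bounded_cball])
      have i: "integrable lborel (\<lambda>y. indicator F y * divergence \<phi> y)" if "F \<in> sets borel" for F :: "(real^'n) set"
        using that by (intro integrable_indicator_mult integrable_divergence[OF phi(1)]) simp
      have "J E - J (Ej j) = (\<integral>y. indicator E y * divergence \<phi> y - indicator (Ej j) y * divergence \<phi> y \<partial>lborel)"
        unfolding J_def using i[OF E(1)] i[OF E(2)] by simp
      also have "\<dots> \<le> (\<integral>y. C * indicator ?A y \<partial>lborel)"
      proof (rule integral_mono)
        show "integrable lborel (\<lambda>y. indicator E y * divergence \<phi> y - indicator (Ej j) y * divergence \<phi> y)"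
          by (intro Bochner_Integration.integrable_diff i E)
        show "integrable lborel (\<lambda>y. C * indicator ?A y)" using A by (rule integrable_const_indicator)
        show "indicator E y * divergence \<phi> y - indicator (Ej j) y * divergence \<phi> y \<le> C * indicator ?A y" for y
        proof (cases "y \<in> S")
          case True
          have "\<bar>divergence \<phi> y\<bar> \<le> C" using C(2) by simp
          then show ?thesis using R[OF True] C(1) by (auto simp: indicator_def)
        next
          case False
          then show ?thesis using divergence_zero[OF phi(1), of y] C(1) by (simp add: S_def)
        qed
      qed
      also have "\<dots> = C * measure lborel ?A" using A by simp
      finally show ?thesis by simp
    qed
    have est: "ereal (w * \<delta> powr (1 - 2 * s j) * (J E - C * measure lborel (cball 0 R \<inter> sym_diff (Ej j) E) - \<eta>) - (1 - 2 * s j) * (K / 2))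
        \<le> ereal (1 - 2 * s j) * enn2ereal (X j)" for j
    proof -
      let ?c = "linear_const TYPE('n) (s j) \<delta>"
      let ?I = "\<integral>y. indicator (Ej j) y * (\<integral>x. \<rho> (x - y) * divergence \<phi> x \<partial>lborel) \<partial>lborel"
      let ?y = "J E - C * measure lborel (cball 0 R \<inter> sym_diff (Ej j) E) - \<eta>"
      have p: "1 - 2 * s j > 0" using s(2)[of j] by simp
      have c0: "?c \<ge> 0" using s(2) by (rule linear_const_nonneg)
      have "\<bar>?I - J (Ej j)\<bar> \<le> \<eta>" unfolding J_def using e0(2) mol eps(2) E(2)[of j] by blast
      then have I: "?y \<le> ?I" using JE[of j] by linarith
      have "\<delta> powr (2 - 2 * s j) / (2 - 2 * s j) \<le> 1"
      proof -
        have "\<delta> powr (2 - 2 * s j) \<le> 1" using \<delta> p by (intro powr_le1) auto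
        then show ?thesis using p by (simp add: divide_le_eq)
      qed
      then have K1: "K * (\<delta> powr (2 - 2 * s j) / (2 - 2 * s j)) \<le> K" using K(1) mult_left_le by blast
      have "ennreal (?c * ?y) \<le> ennreal ?c * ennreal ?I"
      proof -
        \<comment> \<open>\<open>ennreal\<close> truncates a negative integral to 0; passing through
          the positive part covers this case.\<close>
        have "?c * ?y \<le> ?c * max 0 ?I" using I c0 by (intro mult_left_mono) auto
        then have "ennreal (?c * ?y) \<le> ennreal (?c * max 0 ?I)" by (rule ennreal_leI)
        also have "\<dots> = ennreal ?c * ennreal ?I" using c0 by (simp add: ennreal_mult' max_def ennreal_neg)
        finally show ?thesis .
      qed
      also have "\<dots> \<le> near_energy (s j) \<delta> (Ej j) ?B + ennreal (K * (\<delta> powr (2 - 2 * s j) / (2 - 2 * s j)))"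
        using K(2) E(2)[of j] s(1,2) by blast
      also have "\<dots> \<le> 2 * X j + ennreal K" using X[OF BU, of j] K1 by (intro add_mono ennreal_leI) auto
      finally have "ereal ((?c * ?y - K) / 2) \<le> enn2ereal (X j)" using K(1) by (rule ennreal_le_add_imp_ereal_le)
      then have "ereal (1 - 2 * s j) * ereal ((?c * ?y - K) / 2) \<le> ereal (1 - 2 * s j) * enn2ereal (X j)"
        using p by (intro ereal_mult_left_mono) auto
      moreover have "(1 - 2 * s j) * ((?c * ?y - K) / 2) = w * \<delta> powr (1 - 2 * s j) * ?y - (1 - 2 * s j) * (K / 2)"
      proof -
        have "(1 - 2 * s j) * ((?c * ?y - K) / 2) = ((1 - 2 * s j) * ?c) * ?y / 2 - (1 - 2 * s j) * (K / 2)"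
          by (simp add: diff_divide_distrib right_diff_distrib)
        then show ?thesis using linear_const_scaled[OF s(2), of j \<delta>, where 'n='n] by (simp add: w_def)
      qed
      ultimately show ?thesis by (simp only: times_ereal.simps)
    qed
    \<comment> \<open>Only now does j tend to infinity, with \<phi>, \<eta>, \<epsilon>, \<delta>
      and K fixed: the mismatch and the K-term vanish and the power of \<delta> tends to 1.\<close>
    have "(\<lambda>j. w * \<delta> powr (1 - 2 * s j) * (J E - C * measure lborel (cball 0 R \<inter> sym_diff (Ej j) E) - \<eta>) - (1 - 2 * s j) * (K / 2))
        \<longlonglongrightarrow> w * 1 * (J E - C * 0 - \<eta>) - (1 - 2 * (1/2)) * (K / 2)"
      by (intro tendsto_intros powr_tendsto_1 s(3) \<delta>(1) conv)
    then have "(\<lambda>j. ereal (w * \<delta> powr (1 - 2 * s j) * (J E - C * measure lborel (cball 0 R \<inter> sym_diff (Ej j) E) - \<eta>) - (1 - 2 * s j) * (K / 2)))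
        \<longlonglongrightarrow> ereal (w * (J E - \<eta>))" by (simp only: lim_ereal) simp
    from lim_imp_Liminf[OF _ this]
    have "ereal (w * (J E - \<eta>)) = liminf (\<lambda>j. ereal (w * \<delta> powr (1 - 2 * s j) * (J E - C * measure lborel (cball 0 R \<inter> sym_diff (Ej j) E) - \<eta>) - (1 - 2 * s j) * (K / 2)))"
      by simp
    also have "\<dots> \<le> \<Lambda>" unfolding \<Lambda>_def by (intro Liminf_mono always_eventually allI est)
    finally show ?thesis unfolding J_def set_integral_divergence[OF E(1) phi(1)] .
  qed
  have "Per_open E U \<le> \<Lambda> / ereal w"
    unfolding Per_open_def
  proof (rule SUP_least)
    fix \<phi> :: "real^'n \<Rightarrow> real^'n" assume "\<phi> \<in> {\<phi> \<in> C1_compact_support U. \<forall>x. norm (\<phi> x) \<le> 1}"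
    then have phi: "\<phi> \<in> C1_compact_support U" "\<And>x. norm (\<phi> x) \<le> 1" by auto
    have "ereal (w * (LINT y:E|lebesgue. divergence \<phi> y)) \<le> \<Lambda>"
    proof (rule ereal_le_epsilon2)
      fix e :: real assume "0 < e"
      then have "ereal (w * ((LINT y:E|lebesgue. divergence \<phi> y) - e / w)) \<le> \<Lambda>" using w by (intro main phi) auto
      then have "ereal (w * (LINT y:E|lebesgue. divergence \<phi> y) - e) \<le> \<Lambda>" using w by (simp add: right_diff_distrib)
      then show "ereal (w * (LINT y:E|lebesgue. divergence \<phi> y)) \<le> \<Lambda> + ereal e" by (cases \<Lambda>) auto
    qed
    then show "ereal (LINT y:E|lebesgue. divergence \<phi> y) \<le> \<Lambda> / ereal w"
      using w by (cases \<Lambda>) (auto simp: field_simps)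
  qed
  then have "ereal w * Per_open E U \<le> ereal w * (\<Lambda> / ereal w)" using w by (intro ereal_mult_left_mono) auto
  also have "\<dots> = \<Lambda>" using w by (cases \<Lambda>) auto
  finally show ?thesis unfolding w_def \<Lambda>_def .
qed

section \<open>The nonlocal perimeter\<close>

text \<open>Measuring sets of pairs turns the bookkeeping of interactions into inclusions and
  disjoint unions in the product space.\<close>

definition pair_energy :: "real \<Rightarrow> ((real^'n) \<times> (real^'n)) set \<Rightarrow> ennreal"
  where "pair_energy s W = (\<integral>\<^sup>+x. (\<integral>\<^sup>+y. indicator W (x, y) * riesz_kernel s (x - y) \<partial>lborel) \<partial>lborel)"

lemma pair_energy_mono: "W \<subseteq> W' \<Longrightarrow> pair_energy s W \<le> pair_energy s W'"
  unfolding pair_energy_def by (intro nn_integral_mono mult_right_mono) (auto simp: indicator_def)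

lemma kernel_diff_measurable [measurable]:
  "(\<lambda>p. riesz_kernel s (fst p - snd p)) \<in> borel_measurable (borel \<Otimes>\<^sub>M borel)"
  by measurable

lemma pair_energy_Un_disjoint:
  fixes W W' :: "((real^'n) \<times> (real^'n)) set"
  assumes [measurable]: "W \<in> sets (borel \<Otimes>\<^sub>M borel)" "W' \<in> sets (borel \<Otimes>\<^sub>M borel)" and "W \<inter> W' = {}"
  shows "pair_energy s (W \<union> W') = pair_energy s W + pair_energy s W'"
proof -
  have "indicator (W \<union> W') p = (indicator W p + indicator W' p :: ennreal)" for p
    using assms(3) by (auto simp: indicator_def)
  then have "pair_energy s (W \<union> W') = (\<integral>\<^sup>+x. (\<integral>\<^sup>+y. indicator W (x, y) * riesz_kernel s (x - y) + indicator W' (x, y) * riesz_kernel s (x - y) \<partial>lborel) \<partial>lborel)"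
    by (simp add: pair_energy_def distrib_right)
  also have "\<dots> = pair_energy s W + pair_energy s W'"
    unfolding pair_energy_def by (subst nn_integral_add[symmetric], measurable) (intro nn_integral_cong nn_integral_add, measurable)
  finally show ?thesis .
qed

lemma pair_energy_Un_le:
  fixes W W' :: "((real^'n) \<times> (real^'n)) set"
  assumes [measurable]: "W \<in> sets (borel \<Otimes>\<^sub>M borel)" "W' \<in> sets (borel \<Otimes>\<^sub>M borel)"
  shows "pair_energy s (W \<union> W') \<le> pair_energy s W + pair_energy s W'"
proof -
  have "pair_energy s (W \<union> W') = pair_energy s (W \<union> (W' - W))" by simp
  also have "\<dots> = pair_energy s W + pair_energy s (W' - W)" by (rule pair_energy_Un_disjoint) auto
  also have "\<dots> \<le> pair_energy s W + pair_energy s W'" by (intro add_left_mono pair_energy_mono) auto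
  finally show ?thesis .
qed

lemma pair_energy_swap:
  assumes [measurable]: "A \<in> sets borel" "B \<in> sets borel"
  shows "pair_energy s (A \<times> B) = pair_energy s (B \<times> A)"
proof -
  have "pair_energy s (A \<times> B) = (\<integral>\<^sup>+y. (\<integral>\<^sup>+x. indicator (A \<times> B) (x, y) * riesz_kernel s (x - y) \<partial>lborel) \<partial>lborel)"
    unfolding pair_energy_def by (rule lborel_pair.Fubini') measurable
  also have "\<dots> = pair_energy s (B \<times> A)"
    unfolding pair_energy_def by (intro nn_integral_cong) (auto simp: kernel_minus indicator_def)
  finally show ?thesis .
qed

lemma interaction_eq_pair_energy:
  assumes [measurable]: "A \<in> sets borel" "B \<in> sets borel"
  shows "interaction s A B = pair_energy s (A \<times> B)"
proof -
  have "interaction s A B = (\<integral>\<^sup>+x. (\<integral>\<^sup>+y. riesz_kernel s (x - y) * indicator B y \<partial>lborel) * indicator A x \<partial>lebesgue)"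
    unfolding interaction_def riesz_kernel_def[symmetric]
    by (intro nn_integral_cong arg_cong2[where f="(*)"] nn_integral_completion refl) measurable
  also have "\<dots> = (\<integral>\<^sup>+x. (\<integral>\<^sup>+y. riesz_kernel s (x - y) * indicator B y \<partial>lborel) * indicator A x \<partial>lborel)"
    by (rule nn_integral_completion) measurable
  also have "\<dots> = pair_energy s (A \<times> B)"
    unfolding pair_energy_def by (subst nn_integral_multc[symmetric], measurable)
      (auto intro!: nn_integral_cong simp: indicator_def)
  finally show ?thesis .
qed

definition crossing :: "'a set \<Rightarrow> 'a set \<Rightarrow> ('a \<times> 'a) set"
  where "crossing E A = (E \<inter> A) \<times> (- E \<inter> A) \<union> (E \<inter> A) \<times> (- E \<inter> - A) \<union> (E \<inter> - A) \<times> (- E \<inter> A)"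

lemma crossing_iff: "(x, y) \<in> crossing E A \<longleftrightarrow> x \<in> E \<and> y \<notin> E \<and> (x \<in> A \<or> y \<in> A)"
  by (auto simp: crossing_def)

lemma crossing_measurable [measurable]:
  assumes [measurable]: "E \<in> sets borel" "A \<in> sets borel"
  shows "crossing E A \<in> sets (borel \<Otimes>\<^sub>M borel)"
  unfolding crossing_def by (intro sets.Un pair_measureI sets.Int borel_comp) (use assms in auto)

lemma Per_s_eq_pair_energy:
  fixes E :: "(real^'n) set"
  assumes E: "E \<in> sets borel" and A: "A \<in> sets borel"
  shows "Per_s s E A = pair_energy s (crossing E A)"
proof -
  have m: "E \<inter> A \<in> sets borel" "- E \<inter> A \<in> sets borel" "- E \<inter> - A \<in> sets borel" "E \<inter> - A \<in> sets borel"
    using E A by (auto intro!: sets.Int borel_comp)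
  show ?thesis
    unfolding Per_s_def crossing_def interaction_eq_pair_energy[OF m(1,2)] interaction_eq_pair_energy[OF m(1,3)] interaction_eq_pair_energy[OF m(4,2)]
    by (subst pair_energy_Un_disjoint, (auto intro!: pair_measureI m)[3],
        subst pair_energy_Un_disjoint, (auto intro!: pair_measureI m)[3]) simp
qed

section \<open>Localizing and gluing the nonlocal perimeter\<close>

lemma Per_s_mono:
  fixes E :: "(real^'n) set"
  assumes "E \<in> sets borel" "A \<in> sets borel" "B \<in> sets borel" "A \<subseteq> B"
  shows "Per_s s E A \<le> Per_s s E B"
  unfolding Per_s_eq_pair_energy[OF assms(1,2)] Per_s_eq_pair_energy[OF assms(1,3)]
  using assms(4) by (intro pair_energy_mono) (auto simp: crossing_def)

text \<open>Pairs counted for \<open>U\<close> but not for \<open>A\<close> have both points outside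
  \<open>A\<close>, where the two sets agree. The common part \<open>R\<close> may be infinite,
  hence sums in place of differences.\<close>

lemma Per_s_decompose:
  fixes E G :: "(real^'n) set"
  assumes m [measurable]: "E \<in> sets borel" "G \<in> sets borel" "A \<in> sets borel" "U \<in> sets borel"
    and "A \<subseteq> U" "sym_diff E G \<subseteq> A"
  shows "\<exists>R. Per_s s E U = Per_s s E A + R \<and> Per_s s G U = Per_s s G A + R"
proof -
  define W where "W E = crossing E U - crossing E A" for E
  have W: "pair_energy s (crossing F U) = pair_energy s (crossing F A) + pair_energy s (W F)" if [measurable]: "F \<in> sets borel" for F
  proof -
    have "crossing F U = crossing F A \<union> W F" using assms(5) by (auto simp: W_def crossing_def)
    then show ?thesis
      by (metis (no_types, lifting) Diff_disjoint W_def crossing_measurable m(3,4) pair_energy_Un_disjoint sets.Diff that)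
  qed
  have "(x, y) \<in> W E \<longleftrightarrow> (x, y) \<in> W G" for x y
    using assms(6) unfolding W_def Diff_iff crossing_iff by blast
  then have "W E = W G" by auto
  then show ?thesis
    unfolding Per_s_eq_pair_energy[OF m(1,3)] Per_s_eq_pair_energy[OF m(1,4)] Per_s_eq_pair_energy[OF m(2,3)] Per_s_eq_pair_energy[OF m(2,4)]
    using W[OF m(1)] W[OF m(2)] by auto
qed

text \<open>A pair that crosses the glued set and touches \<open>A\<close> either crosses
  \<open>F\<close> as well or has its other point in the mismatch outside \<open>A\<close>. The
  mismatch point may be either member of the pair, whence the factor 2.\<close>

lemma Per_s_glue_le:
  fixes E F :: "(real^'n) set"
  assumes m [measurable]: "E \<in> sets borel" "F \<in> sets borel" "A \<in> sets borel"
  shows "Per_s s ((F \<inter> A) \<union> (E - A)) A \<le> Per_s s F A + 2 * pair_energy s (A \<times> (sym_diff F E - A))"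
proof -
  let ?G = "(F \<inter> A) \<union> (E - A)" and ?D = "sym_diff F E - A"
  have mm: "?G \<in> sets borel" "?D \<in> sets borel" by auto
  have "Per_s s ?G A \<le> pair_energy s (crossing F A \<union> (A \<times> ?D \<union> ?D \<times> A))"
    unfolding Per_s_eq_pair_energy[OF mm(1) m(3)]
    by (intro pair_energy_mono) (auto simp: crossing_def)
  also have "\<dots> \<le> pair_energy s (crossing F A) + pair_energy s (A \<times> ?D \<union> ?D \<times> A)"
    using mm m by (intro pair_energy_Un_le) auto
  also have "\<dots> \<le> pair_energy s (crossing F A) + (pair_energy s (A \<times> ?D) + pair_energy s (?D \<times> A))"
    using mm m by (intro add_left_mono pair_energy_Un_le) auto
  also have "pair_energy s (?D \<times> A) = pair_energy s (A \<times> ?D)"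
    using mm m by (intro pair_energy_swap) auto
  finally show ?thesis unfolding Per_s_eq_pair_energy[OF m(2,3)] by (simp add: mult_2)
qed

text \<open>The integrals of \<open>riesz_kernel s h\<close> outside \<open>ball 0 \<delta>\<close> and of \<open>\<bar>h\<bar> riesz_kernel s h\<close> inside it.\<close>

definition far_const :: "'n::finite itself \<Rightarrow> real \<Rightarrow> real \<Rightarrow> real"
  where "far_const _ s \<delta> = real CARD('n) * unit_ball_vol (real CARD('n)) * (\<delta> powr (- 2 * s) / (2 * s))"

definition near_const :: "'n::finite itself \<Rightarrow> real \<Rightarrow> real \<Rightarrow> real"
  where "near_const _ s \<delta> = real CARD('n) * unit_ball_vol (real CARD('n)) * (\<delta> powr (1 - 2 * s) / (1 - 2 * s))"

lemma far_const_nonneg: "0 < s \<Longrightarrow> 0 \<le> far_const TYPE('n::finite) s \<delta>"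
  by (simp add: far_const_def)

lemma near_const_nonneg: "s < 1/2 \<Longrightarrow> 0 \<le> near_const TYPE('n::finite) s \<delta>"
  by (simp add: near_const_def)

lemma near_const_scaled: "s < 1/2 \<Longrightarrow> (1 - 2 * s) * near_const TYPE('n::finite) s \<delta> = real CARD('n) * unit_ball_vol (real CARD('n)) * \<delta> powr (1 - 2 * s)"
  by (simp add: near_const_def)

lemma far_integral:
  assumes [measurable]: "A \<in> sets borel" and "0 < s" "0 < \<delta>"
  shows "(\<integral>\<^sup>+x. (\<integral>\<^sup>+y. indicator A x * (riesz_kernel s (x - y) * indicator (- ball 0 \<delta>) (x - y)) \<partial>lborel) \<partial>lborel)
    = ennreal (far_const TYPE('n) s \<delta>) * emeasure lborel (A :: (real^'n) set)"
proof -
  have [measurable]: "(indicator (- ball 0 \<delta>) :: real^'n \<Rightarrow> ennreal) \<in> borel_measurable borel"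
    by (intro borel_measurable_indicator borel_comp borel_open open_ball)
  have "(\<integral>\<^sup>+y. indicator A x * (riesz_kernel s (x - y) * indicator (- ball 0 \<delta>) (x - y)) \<partial>lborel) = ennreal (far_const TYPE('n) s \<delta>) * indicator A x" for x
  proof -
    have "(\<integral>\<^sup>+y. riesz_kernel s (x - y) * indicator (- ball 0 \<delta>) (x - y) \<partial>lborel) = (\<integral>\<^sup>+y. riesz_kernel s (x + y) * indicator (- ball 0 \<delta>) (x + y) \<partial>lborel)"
      using nn_integral_lborel_uminus[of "\<lambda>y. riesz_kernel s (x + y) * indicator (- ball 0 \<delta>) (x + y)"] by simp
    also have "\<dots> = (\<integral>\<^sup>+y. riesz_kernel s y * indicator (- ball 0 \<delta>) y \<partial>(lborel :: (real^'n) measure))"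
      using nn_integral_lborel_shift[of "\<lambda>y. riesz_kernel s y * indicator (- ball 0 \<delta>) y" x] by (simp add: add.commute)
    also have "\<dots> = ennreal (far_const TYPE('n) s \<delta>)"
      using nn_integral_kernel_far[OF assms(2,3), where 'n='n] by (simp add: far_const_def)
    finally show ?thesis by (simp add: nn_integral_cmult mult.commute)
  qed
  then show ?thesis by (simp add: nn_integral_cmult)
qed

lemma near_energy_alt:
  fixes E :: "(real^'n) set"
  assumes [measurable]: "E \<in> sets borel" "B \<in> sets borel"
  shows "near_energy s \<delta> E B = (\<integral>\<^sup>+x. (\<integral>\<^sup>+y. jump E x y * (riesz_kernel s (x - y) * indicator (ball 0 \<delta>) (x - y)) * indicator B x \<partial>lborel) \<partial>lborel)"
  unfolding near_energy_def
proof (rule nn_integral_cong)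
  fix x :: "real^'n"
  have "(\<integral>\<^sup>+h. jump E x (x + h) * (riesz_kernel s h * indicator (ball 0 \<delta>) h) \<partial>lborel)
      = (\<integral>\<^sup>+y. jump E x y * (riesz_kernel s (y - x) * indicator (ball 0 \<delta>) (y - x)) \<partial>lborel)"
    using nn_integral_lborel_shift[of "\<lambda>y. jump E x y * (riesz_kernel s (y - x) * indicator (ball 0 \<delta>) (y - x))" x]
    by (simp add: add.commute)
  also have "\<dots> = (\<integral>\<^sup>+y. jump E x y * (riesz_kernel s (x - y) * indicator (ball 0 \<delta>) (x - y)) \<partial>lborel)"
    by (intro nn_integral_cong) (simp add: kernel_minus indicator_def norm_minus_commute)
  finally show "(\<integral>\<^sup>+h. jump E x (x + h) * (riesz_kernel s h * indicator (ball 0 \<delta>) h) \<partial>lborel) * indicator B x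
    = (\<integral>\<^sup>+y. jump E x y * (riesz_kernel s (x - y) * indicator (ball 0 \<delta>) (x - y)) * indicator B x \<partial>lborel)"
    by (simp add: nn_integral_multc)
qed

text \<open>If the \<delta>-ball around each base point stays in \<open>U\<close>, every short jump
  joins two points of \<open>U\<close>; both orders of the pair are counted.\<close>

lemma near_energy_le_interaction:
  fixes E :: "(real^'n) set"
  assumes m [measurable]: "E \<in> sets borel" "U \<in> sets borel" and BU: "\<forall>x\<in>B. ball x \<delta> \<subseteq> U"
  shows "near_energy s \<delta> E B \<le> 2 * interaction s (E \<inter> U) (- E \<inter> U)"
proof (cases "\<delta> > 0")
  case False
  \<comment> \<open>For \<delta> \<le> 0 the condition on \<open>B\<close> is vacuous and does not
    place base points in \<open>U\<close>, but then the energy is zero.\<close>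
  then have "ball (0::real^'n) \<delta> = {}" by simp
  then have "indicator (ball (0::real^'n) \<delta>) = (\<lambda>_. 0 :: ennreal)" by (simp only:) auto
  then show ?thesis unfolding near_energy_def by (simp only: mult_zero_right nn_integral_const mult_zero_left zero_le)
next
  case True
  \<comment> \<open>\<open>B\<close> is not assumed measurable; it is enlarged to the closed set of
    all admissible base points.\<close>
  let ?B = "{x. ball x \<delta> \<subseteq> U}"
  have "?B = - (\<Union>y\<in>- U. ball y \<delta>)" by (auto simp: subset_eq dist_commute)
  then have "closed ?B" by (auto intro!: open_UN)
  then have B [measurable]: "?B \<in> sets borel" by (rule borel_closed)
  have mm: "E \<inter> U \<in> sets borel" "- E \<inter> U \<in> sets borel" using m by (auto intro!: borel_comp)
  let ?W = "(E \<inter> U) \<times> (- E \<inter> U)" and ?W' = "(- E \<inter> U) \<times> (E \<inter> U)"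
  have "near_energy s \<delta> E B \<le> near_energy s \<delta> E ?B" using BU by (intro near_energy_mono) auto
  also have "\<dots> \<le> pair_energy s (?W \<union> ?W')"
    unfolding near_energy_alt[OF m(1) B] pair_energy_def
  proof (intro nn_integral_mono)
    fix x y :: "real^'n"
    show "jump E x y * (riesz_kernel s (x - y) * indicator (ball 0 \<delta>) (x - y)) * indicator ?B x \<le> indicator (?W \<union> ?W') (x, y) * riesz_kernel s (x - y)"
    proof (cases "x \<in> ?B \<and> norm (x - y) < \<delta>")
      case xy: True
      then have "x \<in> U" "y \<in> U" using True by (auto simp: dist_norm)
      then show ?thesis using xy by (simp add: jump_if indicator_def)
    next
      case False
      then show ?thesis by (auto simp: indicator_def)
    qed
  qed
  also have "\<dots> = pair_energy s ?W + pair_energy s ?W'"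
    using mm by (intro pair_energy_Un_disjoint) auto
  also have "\<dots> = 2 * interaction s (E \<inter> U) (- E \<inter> U)"
    unfolding interaction_eq_pair_energy[OF mm] pair_energy_swap[OF mm(2,1)] by (simp add: mult_2)
  finally show ?thesis .
qed

text \<open>Pairs closer than \<delta> belong to the short-range energy. The others are paid by the
  tail of the kernel around each point of \<open>A\<close>, wherever the second point is.\<close>

lemma pair_energy_le_near_far:
  fixes E :: "(real^'n) set"
  assumes m [measurable]: "E \<in> sets borel" "A \<in> sets borel" "B \<in> sets borel" and "0 < s" "0 < \<delta>"
    and W: "\<And>x y. (x, y) \<in> W \<Longrightarrow> x \<in> A \<and> (x \<in> E \<longleftrightarrow> y \<notin> E) \<and> (norm (x - y) < \<delta> \<longrightarrow> x \<in> B)"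
  shows "pair_energy s W \<le> near_energy s \<delta> E B + ennreal (far_const TYPE('n) s \<delta>) * emeasure lborel A"
proof -
  have [measurable]: "(indicator (- ball 0 \<delta>) :: real^'n \<Rightarrow> ennreal) \<in> borel_measurable borel"
    by (intro borel_measurable_indicator borel_comp borel_open open_ball)
  have "pair_energy s W \<le> (\<integral>\<^sup>+x. (\<integral>\<^sup>+y. jump E x y * (riesz_kernel s (x - y) * indicator (ball 0 \<delta>) (x - y)) * indicator B x
      + indicator A x * (riesz_kernel s (x - y) * indicator (- ball 0 \<delta>) (x - y)) \<partial>lborel) \<partial>lborel)"
    unfolding pair_energy_def
  proof (intro nn_integral_mono)
    fix x y
    show "indicator W (x, y) * riesz_kernel s (x - y) \<le> jump E x y * (riesz_kernel s (x - y) * indicator (ball 0 \<delta>) (x - y)) * indicator B x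
      + indicator A x * (riesz_kernel s (x - y) * indicator (- ball 0 \<delta>) (x - y))"
      using W[of x y] by (cases "norm (x - y) < \<delta>") (auto simp: indicator_def jump_if)
  qed
  also have "\<dots> = near_energy s \<delta> E B + (\<integral>\<^sup>+x. (\<integral>\<^sup>+y. indicator A x * (riesz_kernel s (x - y) * indicator (- ball 0 \<delta>) (x - y)) \<partial>lborel) \<partial>lborel)"
    unfolding near_energy_alt[OF m(1,3)]
    by (subst nn_integral_add[symmetric], measurable) (intro nn_integral_cong nn_integral_add, measurable)
  finally show ?thesis unfolding far_integral[OF m(2) \<open>0 < s\<close> \<open>0 < \<delta>\<close>] .
qed

text \<open>Counting ordered pairs, interactions inside \<open>A\<close> occur twice on the left-hand side but those across
  the boundary of \<open>A\<close> are counted twice only because of the factor \<open>2\<close>; the excess sits near the boundary.\<close>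

lemma Per_s_le_near_far:
  fixes E :: "(real^'n) set"
  assumes m [measurable]: "E \<in> sets borel" "A \<in> sets borel" "B \<in> sets borel" and s: "0 < s" "0 < \<delta>"
    and B: "\<And>x y. x \<in> A \<Longrightarrow> y \<notin> A \<Longrightarrow> norm (x - y) < \<delta> \<Longrightarrow> x \<in> B"
  shows "2 * Per_s s E A \<le> near_energy s \<delta> E A + near_energy s \<delta> E B + 2 * (ennreal (far_const TYPE('n) s \<delta>) * emeasure lborel A)"
proof -
  have mm: "E \<inter> A \<in> sets borel" "- E \<inter> A \<in> sets borel" "- E \<inter> - A \<in> sets borel" "E \<inter> - A \<in> sets borel"
    using m by (auto intro!: sets.Int borel_comp)
  let ?p = "pair_energy s" and ?F = "ennreal (far_const TYPE('n) s \<delta>) * emeasure lborel A"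
  let ?W1 = "(E \<inter> A) \<times> (- E \<inter> A)" and ?W1' = "(- E \<inter> A) \<times> (E \<inter> A)"
    and ?W2 = "(E \<inter> A) \<times> (- E \<inter> - A)" and ?W3 = "(- E \<inter> A) \<times> (E \<inter> - A)"
  have "Per_s s E A = ?p ?W1 + ?p ?W2 + ?p ?W3"
    unfolding Per_s_def interaction_eq_pair_energy[OF mm(1,2)] interaction_eq_pair_energy[OF mm(1,3)] interaction_eq_pair_energy[OF mm(4,2)]
    by (simp only: pair_energy_swap[OF mm(4,2)])
  moreover have "?p ?W1' = ?p ?W1" by (rule pair_energy_swap[OF mm(2,1)])
  ultimately have "2 * Per_s s E A = (?p ?W1 + ?p ?W1' + ?p ?W2 + ?p ?W3) + (?p ?W2 + ?p ?W3)"
    by (simp add: mult_2 add_ac)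
  also have "?p ?W1 + ?p ?W1' + ?p ?W2 + ?p ?W3 = ?p (((?W1 \<union> ?W1') \<union> ?W2) \<union> ?W3)"
    using mm by (subst pair_energy_Un_disjoint, (auto intro!: pair_measureI sets.Un)[3],
      subst pair_energy_Un_disjoint, (auto intro!: pair_measureI sets.Un)[3],
      subst pair_energy_Un_disjoint, (auto intro!: pair_measureI sets.Un)[3]) simp
  also have "?p ?W2 + ?p ?W3 = ?p (?W2 \<union> ?W3)"
    using mm by (subst pair_energy_Un_disjoint, (auto intro!: pair_measureI sets.Un)[3]) simp
  also have "?p (((?W1 \<union> ?W1') \<union> ?W2) \<union> ?W3) + ?p (?W2 \<union> ?W3) \<le> (near_energy s \<delta> E A + ?F) + (near_energy s \<delta> E B + ?F)"
  proof (intro add_mono)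
    show "?p (((?W1 \<union> ?W1') \<union> ?W2) \<union> ?W3) \<le> near_energy s \<delta> E A + ?F"
      by (rule pair_energy_le_near_far[OF m(1,2,2) s]) auto
    show "?p (?W2 \<union> ?W3) \<le> near_energy s \<delta> E B + ?F"
      by (rule pair_energy_le_near_far[OF m(1,2,3) s]) (auto intro: B)
  qed
  finally show ?thesis by (simp add: mult_2 add_ac)
qed

text \<open>Integrating over the level \<open>t\<close> turns the interaction across \<open>{d < t}\<close> into one with the
  integrable kernel \<open>\<bar>h\<bar> riesz_kernel s h\<close>, because \<open>{t. d x < t \<le> d y}\<close> has length at most \<open>\<bar>x - y\<bar>\<close>.\<close>

lemma level_average:
  fixes d :: "real^'n \<Rightarrow> real"
  assumes m [measurable]: "G \<in> sets borel" and d: "\<And>x y. \<bar>d x - d y\<bar> \<le> norm (x - y)"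
    and ab: "a < b" and s: "0 < s" "s < 1/2" and \<delta>: "0 < \<delta>"
    and M: "ennreal (near_const TYPE('n) s \<delta>) * emeasure lborel (G \<inter> {x. d x < b + \<delta>}) \<le> ennreal M" "0 \<le> M"
  shows "\<exists>t. a < t \<and> t < b \<and> pair_energy s ({x. d x < t} \<times> (G - {x. d x < t}))
    \<le> ennreal ((M + 1) / (b - a)) + ennreal (far_const TYPE('n) s \<delta>) * emeasure lborel {x. d x < b}"
proof -
  have "continuous_on UNIV d"
    unfolding continuous_on_iff
  proof (intro ballI allI impI)
    fix x :: "real^'n" and e :: real assume "0 < e"
    then show "\<exists>k>0. \<forall>x'\<in>UNIV. dist x' x < k \<longrightarrow> dist (d x') (d x) < e"
      using d by (intro exI[of _ e]) (auto simp: dist_real_def dist_norm intro: le_less_trans)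
  qed
  then have dm [measurable]: "d \<in> borel_measurable borel" by (rule borel_measurable_continuous_onI)
  have lev [measurable]: "{x. d x < t} \<in> sets borel" for t by measurable
  let ?kn = "\<lambda>h. riesz_kernel s h * indicator (ball 0 \<delta>) h :: ennreal"
  let ?G = "G \<inter> {x. d x < b + \<delta>}"
  \<comment> \<open>Only short pairs are averaged over the level. If such a pair is separated by a
    level below b, then \<open>d y\<close> < b + \<delta>, which confines the mismatch to a bounded
    region.\<close>
  define f where "f t x y = (if a < t \<and> t < b \<and> d x < t \<and> t \<le> d y then ?kn (x - y) * indicator G y else 0)" for t x y
  have [measurable]: "(\<lambda>p. f (fst p) (fst (snd p)) (snd (snd p))) \<in> borel_measurable (borel \<Otimes>\<^sub>M (borel \<Otimes>\<^sub>M borel))"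
    unfolding f_def by measurable
  have fm [measurable]: "(\<lambda>p. f (u p) (v p) (w p)) \<in> borel_measurable N"
    if [measurable]: "u \<in> borel_measurable N" "v \<in> borel_measurable N" "w \<in> borel_measurable N" for u v w N
    unfolding f_def by measurable
  define \<Phi> where "\<Phi> t = (\<integral>\<^sup>+x. (\<integral>\<^sup>+y. f t x y \<partial>lborel) \<partial>lborel)" for t
  have ft: "(\<integral>\<^sup>+t. f t x y \<partial>lborel) \<le> indicator ?G y * (ennreal (norm (x - y)) * ?kn (x - y))" for x y
  proof -
    have "(\<integral>\<^sup>+t. f t x y \<partial>lborel) \<le> (\<integral>\<^sup>+t. (indicator ?G y * ?kn (x - y)) * indicator {d x..d y} t \<partial>lborel)"
    proof (rule nn_integral_mono)
      fix t
      show "f t x y \<le> (indicator ?G y * ?kn (x - y)) * indicator {d x..d y} t"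
      proof (cases "a < t \<and> t < b \<and> d x < t \<and> t \<le> d y \<and> norm (x - y) < \<delta>")
        case True
        then have "d y < b + \<delta>" using d[of x y] by linarith
        then show ?thesis using True by (simp add: f_def indicator_def)
      next
        case False
        then show ?thesis by (auto simp: f_def indicator_def)
      qed
    qed
    also have "\<dots> = (indicator ?G y * ?kn (x - y)) * emeasure lborel {d x..d y}"
      by (rule nn_integral_cmult_indicator) simp
    also have "\<dots> \<le> (indicator ?G y * ?kn (x - y)) * ennreal (norm (x - y))"
    proof (intro mult_left_mono)
      show "emeasure lborel {d x..d y} \<le> ennreal (norm (x - y))"
        using d[of x y] by (cases "d x \<le> d y") (auto intro!: ennreal_leI)
    qed simp
    finally show ?thesis by (simp add: mult_ac)
  qed
  have "(\<integral>\<^sup>+t. \<Phi> t \<partial>lborel) = (\<integral>\<^sup>+x. (\<integral>\<^sup>+t. (\<integral>\<^sup>+y. f t x y \<partial>lborel) \<partial>lborel) \<partial>lborel)"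
    unfolding \<Phi>_def by (rule lborel_pair.Fubini') measurable
  also have "\<dots> = (\<integral>\<^sup>+x. (\<integral>\<^sup>+y. (\<integral>\<^sup>+t. f t x y \<partial>lborel) \<partial>lborel) \<partial>lborel)"
    by (intro nn_integral_cong lborel_pair.Fubini') measurable
  also have "\<dots> \<le> (\<integral>\<^sup>+x. (\<integral>\<^sup>+y. indicator ?G y * (ennreal (norm (x - y)) * ?kn (x - y)) \<partial>lborel) \<partial>lborel)"
    by (intro nn_integral_mono ft)
  also have "\<dots> = (\<integral>\<^sup>+y. (\<integral>\<^sup>+x. indicator ?G y * (ennreal (norm (x - y)) * ?kn (x - y)) \<partial>lborel) \<partial>lborel)"
    by (rule lborel_pair.Fubini') measurable
  also have "\<dots> = (\<integral>\<^sup>+y. ennreal (near_const TYPE('n) s \<delta>) * indicator ?G y \<partial>lborel)"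
  proof (rule nn_integral_cong)
    fix y :: "real^'n"
    have "(\<integral>\<^sup>+x. ennreal (norm (x - y)) * ?kn (x - y) \<partial>lborel) = (\<integral>\<^sup>+x. ennreal (norm x) * ?kn x \<partial>(lborel :: (real^'n) measure))"
      using nn_integral_lborel_shift[of "\<lambda>x::real^'n. ennreal (norm x) * ?kn x" "- y"] by simp
    also have "\<dots> = ennreal (near_const TYPE('n) s \<delta>)"
      using nn_integral_kernel_near[OF s(2) \<delta>, of 1, where 'n='n] by (simp add: near_const_def mult.assoc)
    finally show "(\<integral>\<^sup>+x. indicator ?G y * (ennreal (norm (x - y)) * ?kn (x - y)) \<partial>lborel) = ennreal (near_const TYPE('n) s \<delta>) * indicator ?G y"
      by (simp add: nn_integral_cmult mult.commute)
  qed
  also have "\<dots> = ennreal (near_const TYPE('n) s \<delta>) * emeasure lborel ?G"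
    by (rule nn_integral_cmult_indicator) measurable
  finally have int: "(\<integral>\<^sup>+t. \<Phi> t \<partial>lborel) \<le> ennreal M" using M(1) by (rule order_trans)
  have "\<exists>t. a < t \<and> t < b \<and> \<Phi> t \<le> ennreal ((M + 1) / (b - a))"
  \<comment> \<open>Using M + 1 keeps the contradiction strict even if M = 0.\<close>
  proof (rule ccontr)
    assume neg: "\<not> ?thesis"
    have "ennreal (M + 1) = (\<integral>\<^sup>+t. ennreal ((M + 1) / (b - a)) * indicator {a<..<b} t \<partial>lborel)"
      using ab M(2) by (simp add: nn_integral_cmult_indicator ennreal_mult[symmetric])
    also have "\<dots> \<le> (\<integral>\<^sup>+t. \<Phi> t \<partial>lborel)"
      using neg by (intro nn_integral_mono) (auto simp: indicator_def not_le intro: less_imp_le)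
    finally have "ennreal (M + 1) \<le> ennreal M" using int by (rule order_trans)
    then show False using M(2) by simp
  qed
  then obtain t where t: "a < t" "t < b" "\<Phi> t \<le> ennreal ((M + 1) / (b - a))" by blast
  have [measurable]: "(indicator (- ball 0 \<delta>) :: real^'n \<Rightarrow> ennreal) \<in> borel_measurable borel"
    by (intro borel_measurable_indicator borel_comp borel_open open_ball)
  \<comment> \<open>Long pairs are not averaged; the tail of the kernel over {d < b} bounds them for
    every level at once.\<close>
  have "pair_energy s ({x. d x < t} \<times> (G - {x. d x < t}))
      \<le> (\<integral>\<^sup>+x. (\<integral>\<^sup>+y. f t x y + indicator {x. d x < b} x * (riesz_kernel s (x - y) * indicator (- ball 0 \<delta>) (x - y)) \<partial>lborel) \<partial>lborel)"
    unfolding pair_energy_def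
  proof (intro nn_integral_mono)
    fix x y
    show "indicator ({x. d x < t} \<times> (G - {x. d x < t})) (x, y) * riesz_kernel s (x - y)
      \<le> f t x y + indicator {x. d x < b} x * (riesz_kernel s (x - y) * indicator (- ball 0 \<delta>) (x - y))"
      using t(1,2) by (auto simp: f_def indicator_def)
  qed
  also have "\<dots> = \<Phi> t + (\<integral>\<^sup>+x. (\<integral>\<^sup>+y. indicator {x. d x < b} x * (riesz_kernel s (x - y) * indicator (- ball 0 \<delta>) (x - y)) \<partial>lborel) \<partial>lborel)"
    unfolding \<Phi>_def by (subst nn_integral_add[symmetric], measurable) (intro nn_integral_cong nn_integral_add, measurable)
  also have "\<dots> \<le> ennreal ((M + 1) / (b - a)) + ennreal (far_const TYPE('n) s \<delta>) * emeasure lborel {x. d x < b}"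
    unfolding far_integral[OF lev s(1) \<delta>] by (intro add_right_mono t(3))
  finally show ?thesis using t(1,2) by blast
qed

section \<open>Sequences of minimizers\<close>

text \<open>Isolates what gluing needs from a distance function: the Lipschitz bound, which makes
  level sets quantitatively apart, and compact sublevels inside the region.\<close>

definition level_function :: "('a::real_normed_vector \<Rightarrow> real) \<Rightarrow> real \<Rightarrow> 'a set \<Rightarrow> bool"
  where "level_function d t0 V \<longleftrightarrow> 0 < t0 \<and> (\<forall>x y. \<bar>d x - d y\<bar> \<le> norm (x - y)) \<and>
    compact {x. d x \<le> t0} \<and> {x. d x \<le> t0} \<subseteq> V"

lemma lipschitz_abs_continuous:
  fixes d :: "'a::real_normed_vector \<Rightarrow> real"
  assumes "\<And>x y. \<bar>d x - d y\<bar> \<le> norm (x - y)"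
  shows "continuous_on UNIV d"
  unfolding continuous_on_iff
proof (intro ballI allI impI)
  fix x :: 'a and e :: real assume "0 < e"
  then show "\<exists>k>0. \<forall>x'\<in>UNIV. dist x' x < k \<longrightarrow> dist (d x') (d x) < e"
    using assms by (intro exI[of _ e]) (auto simp: dist_real_def dist_norm intro: le_less_trans)
qed

lemma level_function_exists:
  fixes K :: "'a::euclidean_space set"
  assumes K: "compact K" "K \<subseteq> V" "open V"
  shows "\<exists>d t0. level_function d t0 V \<and> (\<forall>x\<in>K. d x \<le> 0)"
proof (cases "K = {}")
  case True
  \<comment> \<open>\<open>infdist\<close> to the empty set is 0 by convention, so its sublevels
    would be the whole space; a constant above the top level has empty sublevels.\<close>
  have "level_function (\<lambda>_::'a. 1) (1/2) V" by (simp add: level_function_def)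
  then show ?thesis using True by blast
next
  case False
  obtain r where r: "r > 0" "\<forall>x\<in>K. ball x r \<subseteq> V" using compact_ball_subset_open[OF K] by blast
  let ?d = "\<lambda>x. infdist x K"
  have lip: "\<bar>?d x - ?d y\<bar> \<le> norm (x - y)" for x y
    using infdist_triangle[of x K y] infdist_triangle[of y K x] by (simp add: dist_norm norm_minus_commute abs_le_iff)
  have near: "\<exists>k\<in>K. norm (x - k) \<le> t" if "?d x \<le> t" for x t
    using infdist_attains_inf[OF compact_imp_closed[OF K(1)] False, of x] that by (metis dist_norm)
  obtain R where R: "\<And>x. x \<in> K \<Longrightarrow> norm x \<le> R" using compact_imp_bounded[OF K(1)] by (auto simp: bounded_iff)
  have "norm x \<le> R + r/2" if x: "?d x \<le> r/2" for x
  proof -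
    obtain k where "k \<in> K" "norm (x - k) \<le> r/2" using near[OF x] by blast
    then show ?thesis using R[of k] norm_triangle_ineq2[of x k] by linarith
  qed
  then have "bounded {x. ?d x \<le> r/2}" unfolding bounded_iff by blast
  moreover have "closed {x. ?d x \<le> r/2}" by (intro closed_Collect_le continuous_intros)
  ultimately have "compact {x. ?d x \<le> r/2}" by (simp add: compact_eq_bounded_closed)
  moreover have "{x. ?d x \<le> r/2} \<subseteq> V"
  proof
    fix x assume "x \<in> {x. ?d x \<le> r/2}"
    then obtain k where "k \<in> K" "norm (x - k) \<le> r/2" using near by blast
    moreover then have "x \<in> ball k r" using r(1) by (simp add: dist_norm norm_minus_commute)
    ultimately show "x \<in> V" using r(2) by blast
  qed
  ultimately have "level_function ?d (r/2) V" using r(1) lip by (simp add: level_function_def)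
  moreover have "\<forall>x\<in>K. ?d x \<le> 0" by simp
  ultimately show ?thesis by blast
qed

lemma
  fixes d :: "'a::euclidean_space \<Rightarrow> real"
  assumes "level_function d t0 V"
  shows level_open: "open {x. d x < t}" "open {x. a < d x \<and> d x < t}" "open {x. a < d x}"
    and level_borel: "{x. d x < t} \<in> sets borel"
    and level_bounded: "t \<le> t0 \<Longrightarrow> bounded {x. d x < t}"
    and level_closure: "t < t0 \<Longrightarrow> compact (closure {x. d x < t}) \<and> closure {x. d x < t} \<subseteq> {x. d x < t0}"
    and level_subset: "t \<le> t0 \<Longrightarrow> {x. d x < t} \<subseteq> V"
    and level_lipschitz: "\<bar>d x - d y\<bar> \<le> norm (x - y)"
    and level_pos: "0 < t0"
proof -
  show lip: "\<bar>d x - d y\<bar> \<le> norm (x - y)" for x y using assms by (simp add: level_function_def)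
  show "0 < t0" using assms by (simp add: level_function_def)
  have cont: "continuous_on UNIV d" using lip by (rule lipschitz_abs_continuous)
  show o: "open {x. d x < t}" "open {x. a < d x}" for t a using cont by (auto intro!: open_Collect_less continuous_intros)
  show "{x. d x < t} \<in> sets borel" using o(1) by (rule borel_open)
  show "open {x. a < d x \<and> d x < t}" using o by (intro open_Collect_conj) auto
  have comp: "compact {x. d x \<le> t0}" "{x. d x \<le> t0} \<subseteq> V" using assms by (auto simp: level_function_def)
  show "bounded {x. d x < t}" if "t \<le> t0"
    by (rule bounded_subset[OF compact_imp_bounded[OF comp(1)]]) (use that in auto)
  show "{x. d x < t} \<subseteq> V" if "t \<le> t0" using comp(2) that by force
  show "compact (closure {x. d x < t}) \<and> closure {x. d x < t} \<subseteq> {x. d x < t0}" if t: "t < t0"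
  proof -
    have c: "closed {x. d x \<le> t}" using cont by (intro closed_Collect_le continuous_intros) auto
    have sub: "closure {x. d x < t} \<subseteq> {x. d x \<le> t}" using c by (intro closure_minimal) auto
    have "bounded (closure {x. d x < t})"
      using compact_imp_bounded[OF comp(1)] by (rule bounded_subset) (use sub t in force)
    then show ?thesis using sub t by (force simp: compact_eq_bounded_closed)
  qed
qed

lemma compactly_contained_subset:
  fixes A :: "'a::heine_borel set"
  assumes "compactly_contained B U" "A \<subseteq> B"
  shows "compactly_contained A U"
  using assms closure_mono[OF assms(2)] unfolding compactly_contained_def
  by (meson bounded_subset closed_closure compact_eq_bounded_closed order_trans)

lemma ereal_mult_add_real: "ereal c * (x + ereal b) = ereal c * x + ereal (c * b)"
  by (cases x; cases "c = 0") (auto simp: distrib_left)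

text \<open>Pigeonhole: by superadditivity, disjoint shells cannot all carry perimeter \<open>\<eta>\<close>.\<close>

lemma small_shell:
  fixes F :: "(real^'n) set" and d :: "real^'n \<Rightarrow> real" and t0 \<eta> :: real
  assumes F: "F \<in> sets borel" and fin: "Per_open F U < \<infinity>" and sub: "{x. d x < t0} \<subseteq> U" and t0: "0 < t0" and eta: "0 < \<eta>"
  shows "\<exists>\<alpha> \<beta>. 0 < \<alpha> \<and> \<alpha> < \<beta> \<and> \<beta> < t0 \<and> Per_open F {x. \<alpha> < d x \<and> d x < \<beta>} \<le> ereal \<eta>"
proof (rule ccontr)
  assume neg: "\<not> ?thesis"
  obtain p where p: "Per_open F U = ereal p" using fin Per_open_nonneg[of F U] by (cases "Per_open F U") auto
  obtain N where N: "p / \<eta> < real N" using reals_Archimedean2 by blast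
  \<comment> \<open>The levels with k \<le> N lie strictly between 0 and t0 and bound N shells,
    whose total perimeter would exceed p since N \<eta> > p.\<close>
  define \<tau> where "\<tau> k = t0 * (real k + 1) / (real N + 2)" for k :: nat
  have tau_pos: "0 < \<tau> k" for k using t0 by (simp add: \<tau>_def)
  have tau_mono: "\<tau> k < \<tau> (Suc k)" for k using t0 by (simp add: \<tau>_def divide_strict_right_mono)
  have tau_less: "\<tau> k < t0" if "k \<le> N" for k
  proof -
    have "t0 * (real k + 1) < t0 * (real N + 2)" using t0 that by (intro mult_strict_left_mono) auto
    then show ?thesis by (simp add: \<tau>_def divide_less_eq)
  qed
  have "ereal (real k * \<eta>) \<le> Per_open F {x. \<tau> 0 < d x \<and> d x < \<tau> k}" if "k \<le> N" for k
    using that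
  proof (induction k)
    case 0
    show ?case using Per_open_nonneg by (simp add: zero_ereal_def[symmetric])
  next
    case (Suc k)
    have mono: "\<tau> 0 \<le> \<tau> k" using t0 by (simp add: \<tau>_def divide_right_mono)
    have "ereal \<eta> \<le> Per_open F {x. \<tau> k < d x \<and> d x < \<tau> (Suc k)}"
      using neg tau_pos[of k] tau_mono[of k] tau_less[OF Suc.prems] by (meson linorder_le_cases)
    then have "ereal (real k * \<eta>) + ereal \<eta> \<le> Per_open F {x. \<tau> 0 < d x \<and> d x < \<tau> k} + Per_open F {x. \<tau> k < d x \<and> d x < \<tau> (Suc k)}"
      using Suc by (intro add_mono) auto
    also have "\<dots> \<le> Per_open F {x. \<tau> 0 < d x \<and> d x < \<tau> (Suc k)}"
      using tau_mono[of k] mono by (intro Per_open_superadditive[OF F]) auto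
    finally show ?case by (simp add: distrib_right add.commute)
  qed
  from this[of N] have "ereal (real N * \<eta>) \<le> Per_open F {x. \<tau> 0 < d x \<and> d x < \<tau> N}" by simp
  also have "\<dots> \<le> Per_open F U" using sub tau_less[of N] by (intro Per_open_mono) force
  finally have "real N * \<eta> \<le> p" by (simp add: p)
  then show False using N eta by (simp add: divide_less_eq)
qed

lemma Per_open_local:
  fixes E F :: "(real^'n) set"
  assumes E: "E \<in> sets borel" "F \<in> sets borel" and eq: "E \<inter> U = F \<inter> U"
  shows "Per_open E U = Per_open F U"
  unfolding Per_open_def
proof (rule SUP_cong[OF refl])
  fix \<phi> :: "real^'n \<Rightarrow> real^'n" assume "\<phi> \<in> {\<phi> \<in> C1_compact_support U. \<forall>x. norm (\<phi> x) \<le> 1}"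
  then have phi: "\<phi> \<in> C1_compact_support U" by simp
  have "indicator E y * divergence \<phi> y = indicator F y * divergence \<phi> y" for y
  proof (cases "y \<in> U")
    case True
    then show ?thesis using eq by (auto simp: indicator_def)
  next
    case False
    then show ?thesis using divergence_zero[OF phi, of y] C1_support(2)[OF phi] by auto
  qed
  then show "ereal (LINT x:E|lebesgue. divergence \<phi> x) = ereal (LINT x:F|lebesgue. divergence \<phi> x)"
    unfolding set_integral_divergence[OF E(1) phi] set_integral_divergence[OF E(2) phi] by (simp only:)
qed

text \<open>The hypotheses in the form used by the estimates: Borel sets, one almost everywhere
  bound \<open>M\<close> for all H_j, and convergence of sets as volume of the mismatch in
  balls.\<close>

locale massari_sequence =
  fixes \<Omega> :: "(real^'n) set" and s :: "nat \<Rightarrow> real" and Hj :: "nat \<Rightarrow> real^'n \<Rightarrow> real" and H :: "real^'n \<Rightarrow> real"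
    and Ej :: "nat \<Rightarrow> (real^'n) set" and E :: "(real^'n) set" and M :: real
  assumes open_Omega: "open \<Omega>" and bounded_Omega: "bounded \<Omega>"
    and s_pos: "0 < s j" and s_less: "s j < 1/2" and s_lim: "s \<longlonglongrightarrow> 1/2"
    and Hj_int: "integrable (lebesgue_on \<Omega>) (Hj j)" and H_int: "integrable (lebesgue_on \<Omega>) H"
    and H_lim: "(\<lambda>j. \<integral>x. \<bar>Hj j x - H x\<bar> \<partial>lebesgue_on \<Omega>) \<longlonglongrightarrow> 0"
    and Hj_bound: "AE x in lebesgue_on \<Omega>. \<bar>Hj j x\<bar> \<le> M" and M_nonneg: "0 \<le> M"
    and Ej_borel: "Ej j \<in> sets borel" and E_borel: "E \<in> sets borel"
    and E_lim: "(\<lambda>j. measure lborel (cball 0 R \<inter> sym_diff (Ej j) E)) \<longlonglongrightarrow> 0"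
    and minimal: "local_minimizer (Massari_s (s j) (Hj j)) \<Omega> (Ej j)"
begin

lemma Omega_sets: "\<Omega> \<in> sets lebesgue" using open_Omega by simp

lemma set_integral_restrict:
  fixes f :: "real^'n \<Rightarrow> real"
  assumes "X \<in> sets lebesgue" "X \<subseteq> \<Omega>"
  shows "(LINT x:X|lebesgue. f x) = (\<integral>x. indicator X x * f x \<partial>lebesgue_on \<Omega>)"
proof -
  have "(\<integral>x. indicator X x * f x \<partial>lebesgue_on \<Omega>) = (\<integral>x. indicator \<Omega> x *\<^sub>R (indicator X x * f x) \<partial>lebesgue)"
    using Omega_sets by (intro integral_restrict_space) simp
  also have "\<dots> = (LINT x:X|lebesgue. f x)"
    unfolding set_lebesgue_integral_def using assms(2)
    by (intro Bochner_Integration.integral_cong) (auto simp: indicator_def)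
  finally show ?thesis ..
qed

lemma sets_restrict_Omega:
  assumes "X \<in> sets lebesgue" "X \<subseteq> \<Omega>"
  shows "X \<in> sets (lebesgue_on \<Omega>)"
  using assms by (auto simp: sets_restrict_space)

lemma emeasure_subset_Omega:
  assumes "X \<subseteq> \<Omega>" "X \<in> sets lebesgue"
  shows "emeasure (lebesgue_on \<Omega>) X = emeasure lebesgue X" "emeasure lebesgue X < \<infinity>"
proof -
  show "emeasure (lebesgue_on \<Omega>) X = emeasure lebesgue X"
    using assms Omega_sets by (intro emeasure_restrict_space) auto
  have "X \<in> lmeasurable"
    using bounded_subset[OF bounded_Omega assms(1)] assms(2) by (rule bounded_set_imp_lmeasurable)
  then show "emeasure lebesgue X < \<infinity>" unfolding fmeasurable_def by blast
qed

lemma integral_difference_bound: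
  assumes X: "X \<in> sets lebesgue" "X \<subseteq> \<Omega>" and Y: "Y \<in> sets lebesgue" "Y \<subseteq> \<Omega>"
  shows "\<bar>(LINT x:X|lebesgue. Hj j x) - (LINT x:Y|lebesgue. Hj j x)\<bar> \<le> M * measure lebesgue (sym_diff X Y)"
proof -
  let ?S = "sym_diff X Y"
  have S: "?S \<in> sets lebesgue" "?S \<subseteq> \<Omega>" using X Y by auto
  have i: "integrable (lebesgue_on \<Omega>) (\<lambda>x. indicator Z x * Hj j x)" if "Z \<in> sets lebesgue" "Z \<subseteq> \<Omega>" for Z
    using Hj_int sets_restrict_Omega[OF that] by (rule integrable_indicator_mult)
  have iS: "integrable (lebesgue_on \<Omega>) (\<lambda>x. M * indicator ?S x :: real)"
    using sets_restrict_Omega[OF S] emeasure_subset_Omega[OF S(2,1)] by (intro integrable_mult_right integrable_real_indicator) auto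
  have "(LINT x:X|lebesgue. Hj j x) - (LINT x:Y|lebesgue. Hj j x)
      = (\<integral>x. indicator X x * Hj j x - indicator Y x * Hj j x \<partial>lebesgue_on \<Omega>)"
    unfolding set_integral_restrict[OF X] set_integral_restrict[OF Y] using i[OF X] i[OF Y] by simp
  also have "\<bar>\<integral>x. indicator X x * Hj j x - indicator Y x * Hj j x \<partial>lebesgue_on \<Omega>\<bar>
      \<le> (\<integral>x. \<bar>indicator X x * Hj j x - indicator Y x * Hj j x\<bar> \<partial>lebesgue_on \<Omega>)"
    by (rule integral_abs_bound)
  also have "\<dots> \<le> (\<integral>x. M * indicator ?S x \<partial>lebesgue_on \<Omega>)"
  proof (rule integral_mono_AE)
    show "integrable (lebesgue_on \<Omega>) (\<lambda>x. \<bar>indicator X x * Hj j x - indicator Y x * Hj j x\<bar>)"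
      by (intro integrable_abs Bochner_Integration.integrable_diff i X Y)
    show "integrable (lebesgue_on \<Omega>) (\<lambda>x. M * indicator ?S x :: real)" by (rule iS)
    show "AE x in lebesgue_on \<Omega>. \<bar>indicator X x * Hj j x - indicator Y x * Hj j x\<bar> \<le> M * indicator ?S x"
      using Hj_bound[of j] by (rule eventually_mono) (auto simp: indicator_def)
  qed
  also have "\<dots> = M * measure lebesgue ?S"
  proof -
    have "?S \<inter> \<Omega> = ?S" using S(2) by blast
    then show ?thesis using emeasure_subset_Omega(1)[OF S(2,1)] by (simp only: integral_mult_right_zero Bochner_Integration.integral_indicator
        space_restrict_space space_completion space_lborel space_borel Int_UNIV_right measure_def)
  qed
  finally show ?thesis .
qed

lemma integral_bound:
  assumes X: "X \<in> sets lebesgue" "X \<subseteq> \<Omega>"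
  shows "\<bar>LINT x:X|lebesgue. Hj j x\<bar> \<le> M * measure lebesgue \<Omega>"
proof -
  have "\<bar>LINT x:X|lebesgue. Hj j x\<bar> \<le> M * measure lebesgue X"
    using integral_difference_bound[OF X, of "{}" j] by (simp add: set_lebesgue_integral_def)
  also have "\<dots> \<le> M * measure lebesgue \<Omega>"
    using X emeasure_subset_Omega(2)[OF order_refl Omega_sets] M_nonneg Omega_sets
    by (intro mult_left_mono measure_mono_fmeasurable) (auto simp: fmeasurable_def)
  finally show ?thesis .
qed

lemma integral_tendsto:
  assumes X: "X \<in> sets lebesgue" "X \<subseteq> \<Omega>"
  shows "(\<lambda>j. LINT x:X|lebesgue. Hj j x) \<longlonglongrightarrow> (LINT x:X|lebesgue. H x)"
proof (rule LIM_zero_cancel, rule Lim_null_comparison[OF _ H_lim], rule always_eventually, rule allI)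
  fix j
  have i: "integrable (lebesgue_on \<Omega>) (\<lambda>x. indicator X x * Hj j x)" "integrable (lebesgue_on \<Omega>) (\<lambda>x. indicator X x * H x)"
    using Hj_int H_int sets_restrict_Omega[OF X] by (auto intro: integrable_indicator_mult)
  have "(LINT x:X|lebesgue. Hj j x) - (LINT x:X|lebesgue. H x)
      = (\<integral>x. indicator X x * Hj j x - indicator X x * H x \<partial>lebesgue_on \<Omega>)"
    unfolding set_integral_restrict[OF X] using i by simp
  also have "norm \<dots> \<le> (\<integral>x. norm (indicator X x * Hj j x - indicator X x * H x) \<partial>lebesgue_on \<Omega>)"
    by (rule integral_norm_bound)
  also have "\<dots> \<le> (\<integral>x. \<bar>Hj j x - H x\<bar> \<partial>lebesgue_on \<Omega>)"
  proof (rule integral_mono)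
    show "integrable (lebesgue_on \<Omega>) (\<lambda>x. norm (indicator X x * Hj j x - indicator X x * H x))"
      by (intro integrable_norm Bochner_Integration.integrable_diff i)
    show "integrable (lebesgue_on \<Omega>) (\<lambda>x. \<bar>Hj j x - H x\<bar>)"
      by (intro integrable_abs Bochner_Integration.integrable_diff Hj_int H_int)
  qed (auto simp: indicator_def)
  finally show "norm ((LINT x:X|lebesgue. Hj j x) - (LINT x:X|lebesgue. H x)) \<le> (\<integral>x. \<bar>Hj j x - H x\<bar> \<partial>lebesgue_on \<Omega>)" .
qed

lemma set_integral_split:
  fixes f :: "real^'n \<Rightarrow> real"
  assumes f: "integrable (lebesgue_on \<Omega>) f" and X: "X \<in> sets lebesgue" "X \<subseteq> \<Omega>" and A: "A \<in> sets lebesgue"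
  shows "(LINT x:X|lebesgue. f x) = (LINT x:X \<inter> A|lebesgue. f x) + (LINT x:X - A|lebesgue. f x)"
proof -
  have Y: "X \<inter> A \<in> sets lebesgue" "X \<inter> A \<subseteq> \<Omega>" "X - A \<in> sets lebesgue" "X - A \<subseteq> \<Omega>" using X A by auto
  have "indicator X x * f x = indicator (X \<inter> A) x * f x + indicator (X - A) x * f x" for x by (auto simp: indicator_def)
  then show ?thesis
    unfolding set_integral_restrict[OF X] set_integral_restrict[OF Y(1,2)] set_integral_restrict[OF Y(3,4)]
    using integrable_indicator_mult[OF f sets_restrict_Omega[OF Y(1,2)]] integrable_indicator_mult[OF f sets_restrict_Omega[OF Y(3,4)]] by simp
qed

text \<open>Minimality holds on a neighbourhood \<open>U\<close> of the closure of \<open>A\<close>,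
  but the comparison is needed on \<open>A\<close>. Interactions and integrals that do not involve
  \<open>A\<close> are the same for both sets and cancel.\<close>

lemma compare_energy:
  assumes G: "G \<in> sets borel" and A: "A \<in> sets borel" "A \<subseteq> U" "compactly_contained A U"
    and U: "open U" "compactly_contained U \<Omega>" and EG: "sym_diff (Ej j) G \<subseteq> A"
  shows "ereal (1 - 2 * s j) * enn2ereal (Per_s (s j) (Ej j) A)
    \<le> ereal (1 - 2 * s j) * enn2ereal (Per_s (s j) G A) + ereal ((LINT x:A \<inter> G|lebesgue. Hj j x) - (LINT x:A \<inter> Ej j|lebesgue. Hj j x))"
proof -
  define P :: "(real^'n) set \<Rightarrow> (real^'n) set \<Rightarrow> ennreal" where "P = Per_s (s j)"
  define c where "c = 1 - 2 * s j"
  have c: "c > 0" using s_less[of j] by (simp add: c_def)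
  have UO: "U \<subseteq> \<Omega>" using U(2) closure_subset[of U] by (auto simp: compactly_contained_def)
  have Ub: "U \<in> sets borel" using U(1) by simp
  define I where "I X = (LINT x:X|lebesgue. Hj j x)" for X
  have J: "P (Ej j) U < \<infinity>" and le: "Massari_s (s j) (Hj j) U (Ej j) \<le> Massari_s (s j) (Hj j) U G"
  proof -
    have m: "Massari_s (s j) (Hj j) U (Ej j) < \<infinity>"
      "\<And>F. F \<in> sets lebesgue \<Longrightarrow> compactly_contained (sym_diff (Ej j) F) U \<Longrightarrow> Massari_s (s j) (Hj j) U (Ej j) \<le> Massari_s (s j) (Hj j) U F"
      using minimal[of j] U unfolding local_minimizer_def by blast+
    show "P (Ej j) U < \<infinity>" using m(1) by (cases "P (Ej j) U") (auto simp: Massari_s_def P_def top_ennreal.rep_eq)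
    show "Massari_s (s j) (Hj j) U (Ej j) \<le> Massari_s (s j) (Hj j) U G"
      using G compactly_contained_subset[OF A(3) EG] by (intro m(2)) auto
  qed
  obtain R where R: "P (Ej j) U = P (Ej j) A + R" "P G U = P G A + R"
    using Per_s_decompose[OF Ej_borel G A(1) Ub A(2) EG] unfolding P_def by blast
  \<comment> \<open>The cancelled part is finite because E_j has finite energy in \<open>U\<close>.
    The energy of \<open>G\<close> may still be infinite and is split off as a case.\<close>
  obtain r pa where r: "R = ennreal r" "P (Ej j) A = ennreal pa" "0 \<le> r" "0 \<le> pa"
    using J unfolding R(1) by (cases R; cases "P (Ej j) A") auto
  have leb: "Ej j \<in> sets lebesgue" "G \<in> sets lebesgue" "U \<in> sets lebesgue" "A \<in> sets lebesgue"
    using Ej_borel G Ub A(1) by auto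
  have split: "I (U \<inter> F) = I (A \<inter> F) + I (U \<inter> F - A)" if "F \<in> sets lebesgue" for F
  proof -
    have "U \<inter> F \<inter> A = A \<inter> F" using A(2) by auto
    then show ?thesis using set_integral_split[OF Hj_int[of j], of "U \<inter> F" A] that leb UO by (auto simp: I_def)
  qed
  have "U \<inter> Ej j - A = U \<inter> G - A" using EG by auto
  then have diff: "I (U \<inter> G) - I (U \<inter> Ej j) = I (A \<inter> G) - I (A \<inter> Ej j)"
    using split[OF leb(1)] split[OF leb(2)] by simp
  show ?thesis
    unfolding P_def[symmetric] c_def[symmetric] I_def[symmetric]
  proof (cases "P G A")
    case top
    then show "ereal c * enn2ereal (P (Ej j) A) \<le> ereal c * enn2ereal (P G A) + ereal (I (A \<inter> G) - I (A \<inter> Ej j))"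
      using c by (simp add: top_ennreal.rep_eq)
  next
    case (real q)
    have e: "Massari_s (s j) (Hj j) U (Ej j) = ereal (pa + r + 1 / c * I (U \<inter> Ej j))"
      using r R(1) unfolding Massari_s_def P_def[symmetric] I_def[symmetric] c_def[symmetric]
      by (simp add: plus_ennreal.rep_eq enn2ereal_ennreal)
    have g: "Massari_s (s j) (Hj j) U G = ereal (q + r + 1 / c * I (U \<inter> G))"
      using r R(2) real unfolding Massari_s_def P_def[symmetric] I_def[symmetric] c_def[symmetric]
      by (simp add: plus_ennreal.rep_eq enn2ereal_ennreal)
    have "pa + 1 / c * I (U \<inter> Ej j) \<le> q + 1 / c * I (U \<inter> G)" using le unfolding e g by simp
    then have "c * (pa + 1 / c * I (U \<inter> Ej j)) \<le> c * (q + 1 / c * I (U \<inter> G))" using c by (intro mult_left_mono) auto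
    then have "c * pa \<le> c * q + (I (A \<inter> G) - I (A \<inter> Ej j))" using c diff by (simp add: distrib_left)
    then show "ereal c * enn2ereal (P (Ej j) A) \<le> ereal c * enn2ereal (P G A) + ereal (I (A \<inter> G) - I (A \<inter> Ej j))"
      using r real by (simp add: enn2ereal_ennreal)
  qed
qed

text \<open>Twice the bound of \<open>level_average\<close>: \<open>v\<close> is the volume of the
  possible mismatch near the levels between \<open>a\<close> and \<open>b\<close>, \<open>w\<close>
  the volume from which long pairs start.\<close>

definition glue_error :: "nat \<Rightarrow> real \<Rightarrow> real \<Rightarrow> real \<Rightarrow> real \<Rightarrow> real \<Rightarrow> real"
  where "glue_error j \<delta> a b v w = 2 * ((near_const TYPE('n) (s j) \<delta> * v + 1) / (b - a) + far_const TYPE('n) (s j) \<delta> * w)"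

text \<open>The competitor is \<open>F\<close> below a level t and E_j above it. \<open>G\<close>
  contains the mismatch beyond every admissible level, so t may be chosen by averaging; the level
  found depends on j.\<close>

lemma glue_estimate:
  assumes d: "level_function d t0 \<Omega>" and ab: "0 < a" "a < b" "b < t0" and \<delta>: "0 < \<delta>" "b + \<delta> \<le> t0"
    and F: "F \<in> sets borel" and G: "G \<in> sets borel" "sym_diff F (Ej j) - {x. d x < a} \<subseteq> G"
  shows "\<exists>t. a < t \<and> t < b \<and> ereal (1 - 2 * s j) * enn2ereal (Per_s (s j) (Ej j) {x. d x < t})
    \<le> ereal (1 - 2 * s j) * enn2ereal (Per_s (s j) F {x. d x < t})
      + ereal ((1 - 2 * s j) * glue_error j \<delta> a b (measure lborel (G \<inter> {x. d x < b + \<delta>})) (measure lborel {x. d x < b}))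
      + ereal ((LINT x:{x. d x < t} \<inter> F|lebesgue. Hj j x) - (LINT x:{x. d x < t} \<inter> Ej j|lebesgue. Hj j x))"
proof -
  define A where "A t = {x. d x < t}" for t
  let ?n = "near_const TYPE('n) (s j) \<delta>" and ?f = "far_const TYPE('n) (s j) \<delta>"
  let ?v = "measure lborel (G \<inter> A (b + \<delta>))" and ?w = "measure lborel (A b)"
  have n0: "?n \<ge> 0" "?f \<ge> 0" using near_const_nonneg[OF s_less] far_const_nonneg[OF s_pos] by auto
  have fin: "emeasure lborel (A t) = ennreal (measure lborel (A t))" if "t \<le> t0" for t
    using emeasure_bounded_finite[OF level_bounded[OF d that]] by (simp add: A_def emeasure_eq_ennreal_measure)
  have "emeasure lborel (G \<inter> A (b + \<delta>)) < \<infinity>"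
    using level_bounded[OF d \<delta>(2)] by (intro emeasure_bounded_finite bounded_Int) (simp add: A_def)
  then have Gfin: "emeasure lborel (G \<inter> A (b + \<delta>)) = ennreal ?v" by (simp add: emeasure_eq_ennreal_measure)
  obtain t where t: "a < t" "t < b" and pe: "pair_energy (s j) (A t \<times> (G - A t)) \<le> ennreal ((?n * ?v + 1) / (b - a)) + ennreal ?f * emeasure lborel (A b)"
  proof -
    have "\<exists>t. a < t \<and> t < b \<and> pair_energy (s j) ({x. d x < t} \<times> (G - {x. d x < t}))
      \<le> ennreal ((?n * ?v + 1) / (b - a)) + ennreal ?f * emeasure lborel {x. d x < b}"
    proof (rule level_average[OF G(1) level_lipschitz[OF d] ab(2) s_pos s_less \<delta>(1)])
      show "ennreal ?n * emeasure lborel (G \<inter> {x. d x < b + \<delta>}) \<le> ennreal (?n * ?v)"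
        using Gfin n0 by (simp add: A_def ennreal_mult)
      show "0 \<le> ?n * ?v" using n0 by simp
    qed
    then show ?thesis using that unfolding A_def by blast
  qed
  have tt: "t < t0" "t \<le> t0" using t ab by auto
  let ?F = "(F \<inter> A t) \<union> (Ej j - A t)"
  let ?c = "(?n * ?v + 1) / (b - a) + ?f * ?w"
  have Ab: "A t \<in> sets borel" using level_borel[OF d] by (simp add: A_def)
  have c0: "0 \<le> (?n * ?v + 1) / (b - a)" "0 \<le> ?f * ?w" using n0 ab by auto
  have "pair_energy (s j) (A t \<times> (sym_diff F (Ej j) - A t)) \<le> pair_energy (s j) (A t \<times> (G - A t))"
    using G(2) t(1) by (intro pair_energy_mono) (auto simp: A_def)
  also have "\<dots> \<le> ennreal ((?n * ?v + 1) / (b - a)) + ennreal ?f * emeasure lborel (A b)" by (rule pe)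
  also have "\<dots> = ennreal ?c"
    using c0 n0 fin[of b] ab(3) by (simp add: ennreal_mult)
  finally have pc: "pair_energy (s j) (A t \<times> (sym_diff F (Ej j) - A t)) \<le> ennreal ?c" .
  have "Per_s (s j) ?F (A t) \<le> Per_s (s j) F (A t) + 2 * pair_energy (s j) (A t \<times> (sym_diff F (Ej j) - A t))"
    by (rule Per_s_glue_le[OF Ej_borel F Ab])
  also have "\<dots> \<le> Per_s (s j) F (A t) + 2 * ennreal ?c" by (intro add_left_mono mult_left_mono pc) simp
  also have "2 * ennreal ?c = ennreal (2 * ?c)" using c0 ennreal_mult[of 2 ?c] by simp
  finally have "enn2ereal (Per_s (s j) ?F (A t)) \<le> enn2ereal (Per_s (s j) F (A t) + ennreal (2 * ?c))"
    by (simp add: less_eq_ennreal.rep_eq)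
  also have "\<dots> = enn2ereal (Per_s (s j) F (A t)) + ereal (2 * ?c)"
  proof -
    have "0 \<le> 2 * ?c" by (intro mult_nonneg_nonneg add_nonneg_nonneg c0) simp
    then show ?thesis by (simp only: plus_ennreal.rep_eq enn2ereal_ennreal)
  qed
  finally have "ereal (1 - 2 * s j) * enn2ereal (Per_s (s j) ?F (A t)) \<le> ereal (1 - 2 * s j) * (enn2ereal (Per_s (s j) F (A t)) + ereal (2 * ?c))"
    using s_less[of j] by (intro ereal_mult_left_mono) auto
  then have P: "ereal (1 - 2 * s j) * enn2ereal (Per_s (s j) ?F (A t)) \<le> ereal (1 - 2 * s j) * enn2ereal (Per_s (s j) F (A t)) + ereal ((1 - 2 * s j) * (2 * ?c))"
    by (simp only: ereal_mult_add_real)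
  have eqF: "A t \<inter> ?F = A t \<inter> F" by auto
  have "ereal (1 - 2 * s j) * enn2ereal (Per_s (s j) (Ej j) (A t))
    \<le> ereal (1 - 2 * s j) * enn2ereal (Per_s (s j) ?F (A t)) + ereal ((LINT x:A t \<inter> ?F|lebesgue. Hj j x) - (LINT x:A t \<inter> Ej j|lebesgue. Hj j x))"
  \<comment> \<open>Minimality asks for an open set with room on both sides, between the glued
    region and \<Omega>; the level halfway to t0 provides it.\<close>
  proof (rule compare_energy[where U="A ((t + t0)/2)"])
    show "?F \<in> sets borel" using F Ej_borel Ab by auto
    show "A t \<in> sets borel" by (rule Ab)
    show "A t \<subseteq> A ((t + t0)/2)" using tt by (auto simp: A_def)
    show "open (A ((t + t0)/2))" unfolding A_def by (rule level_open(1)[OF d])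
    show "sym_diff (Ej j) ?F \<subseteq> A t" by auto
    have "closure (A t) \<subseteq> A ((t + t0)/2)"
    proof -
      have "closed {x. d x \<le> t}"
        using lipschitz_abs_continuous[of d] level_lipschitz[OF d] by (intro closed_Collect_le continuous_intros) auto
      then have "closure (A t) \<subseteq> {x. d x \<le> t}" unfolding A_def by (intro closure_minimal) auto
      then show ?thesis using tt by (auto simp: A_def)
    qed
    then show "compactly_contained (A t) (A ((t + t0)/2))"
      using level_closure[OF d tt(1)] by (simp add: compactly_contained_def A_def)
    have "(t + t0)/2 < t0" using tt by simp
    then show "compactly_contained (A ((t + t0)/2)) \<Omega>"
      using level_closure[OF d, of "(t + t0)/2"] level_subset[OF d order_refl] unfolding compactly_contained_def A_def by blast
  qed
  also have "\<dots> \<le> ereal (1 - 2 * s j) * enn2ereal (Per_s (s j) F (A t)) + ereal ((1 - 2 * s j) * (2 * ?c)) + ereal ((LINT x:A t \<inter> F|lebesgue. Hj j x) - (LINT x:A t \<inter> Ej j|lebesgue. Hj j x))"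
    unfolding eqF by (intro add_right_mono P)
  finally show ?thesis using t unfolding glue_error_def A_def by blast
qed

lemma scaled_lim: "(\<lambda>j. 1 - 2 * s j) \<longlonglongrightarrow> 0"
proof -
  have "(\<lambda>j. 1 - 2 * s j) \<longlonglongrightarrow> 1 - 2 * (1/2)" by (intro tendsto_intros s_lim)
  then show ?thesis by simp
qed

lemma near_const_lim:
  assumes "0 < \<delta>"
  shows "(\<lambda>j. (1 - 2 * s j) * near_const TYPE('n) (s j) \<delta>) \<longlonglongrightarrow> real CARD('n) * unit_ball_vol (real CARD('n))"
proof -
  have "(\<lambda>j. real CARD('n) * unit_ball_vol (real CARD('n)) * \<delta> powr (1 - 2 * s j)) \<longlonglongrightarrow> real CARD('n) * unit_ball_vol (real CARD('n)) * 1"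
    by (intro tendsto_intros powr_tendsto_1 s_lim assms)
  then show ?thesis by (simp only: near_const_scaled[OF s_less] mult_1_right)
qed

lemma far_const_lim:
  assumes "0 < \<delta>"
  shows "(\<lambda>j. (1 - 2 * s j) * far_const TYPE('n) (s j) \<delta>) \<longlonglongrightarrow> 0"
proof -
  have "(\<lambda>j. far_const TYPE('n) (s j) \<delta>) \<longlonglongrightarrow> real CARD('n) * unit_ball_vol (real CARD('n)) * (\<delta> powr (- 2 * (1/2)) / (2 * (1/2)))"
    unfolding far_const_def using assms by (intro tendsto_intros s_lim) auto
  from tendsto_mult[OF scaled_lim this] show ?thesis by simp
qed

text \<open>\<open>near_const\<close> blows up exactly like 1 / (1 - 2 s), so the rescaled error
  tends to a multiple of the limiting mismatch volume. It vanishes when v0 = 0, and is merely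
  bounded when gluing with the empty set.\<close>

lemma glue_error_lim:
  assumes "0 < \<delta>" "v \<longlonglongrightarrow> v0"
  shows "(\<lambda>j. (1 - 2 * s j) * glue_error j \<delta> a b (v j) w) \<longlonglongrightarrow> 2 * (real CARD('n) * unit_ball_vol (real CARD('n)) * v0 / (b - a))"
proof -
  have eq: "(1 - 2 * s j) * glue_error j \<delta> a b (v j) w = 2 * ((((1 - 2 * s j) * near_const TYPE('n) (s j) \<delta>) * v j + (1 - 2 * s j)) * (1 / (b - a)) + ((1 - 2 * s j) * far_const TYPE('n) (s j) \<delta>) * w)" for j
    by (simp add: glue_error_def distrib_left add_divide_distrib)
  have "(\<lambda>j. 2 * ((((1 - 2 * s j) * near_const TYPE('n) (s j) \<delta>) * v j + (1 - 2 * s j)) * (1 / (b - a)) + ((1 - 2 * s j) * far_const TYPE('n) (s j) \<delta>) * w))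
    \<longlonglongrightarrow> 2 * ((real CARD('n) * unit_ball_vol (real CARD('n)) * v0 + 0) * (1 / (b - a)) + 0 * w)"
    by (intro tendsto_mult tendsto_add tendsto_const near_const_lim far_const_lim scaled_lim assms)
  then show ?thesis unfolding eq by simp
qed

end

lemma Per_s_empty: "Per_s s {} A = 0"
  by (simp add: Per_s_def interaction_def)

lemma enn2ereal_half_le:
  assumes "2 * X \<le> ennreal y" "0 \<le> y"
  shows "enn2ereal X \<le> ereal (y / 2)"
proof (cases X)
  case (real x)
  have "ennreal (2 * x) = 2 * ennreal x" using real ennreal_mult[of 2 x] by simp
  then have "ennreal (2 * x) \<le> ennreal y" using assms(1) real by simp
  then have "2 * x \<le> y" using assms(2) by simp
  then show ?thesis using real by (simp add: enn2ereal_ennreal)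
next
  case top
  then show ?thesis using assms by (simp add: top_unique ennreal_mult_eq_top_iff)
qed

lemma interaction_le_Per_s: "interaction s (E \<inter> A) (- E \<inter> A) \<le> Per_s s E A"
  unfolding Per_s_def by (simp add: add.assoc)

section \<open>Asymptotic bounds for the energies\<close>

context massari_sequence
begin

abbreviation energy :: "(real^'n) set \<Rightarrow> nat \<Rightarrow> ereal"
  where "energy W j \<equiv> ereal (1 - 2 * s j) * enn2ereal (Per_s (s j) (Ej j) W)"

lemma omega_pos: "0 < unit_ball_vol (real (CARD('n) - 1))"
    and omega_pos': "0 < unit_ball_vol (real CARD('n) - 1)" "unit_ball_vol (real CARD('n) - 1) \<noteq> 0"
proof -
  show "0 < unit_ball_vol (real (CARD('n) - 1))" by simp
  show "0 < unit_ball_vol (real CARD('n) - 1)" by (rule unit_ball_vol_pos) (simp add: Suc_le_eq)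
  then show "unit_ball_vol (real CARD('n) - 1) \<noteq> 0" by linarith
qed

lemma energy_mono:
  assumes "V \<in> sets borel" "W \<in> sets borel" "V \<subseteq> W"
  shows "energy V j \<le> energy W j"
  using Per_s_mono[OF Ej_borel assms(1,2,3)] s_less[of j]
  by (intro ereal_mult_left_mono) (auto simp: less_eq_ennreal.rep_eq)

text \<open>Only pairs with both points in \<open>U\<close> enter the lower bound, and all of them
  are counted by the nonlocal perimeter on any larger set.\<close>

lemma energy_liminf:
  assumes U: "open U" and W: "W \<in> sets borel" "U \<subseteq> W"
  shows "ereal (unit_ball_vol (real (CARD('n) - 1))) * Per_open E U \<le> liminf (energy W)"
proof (rule Per_open_le_liminf[OF E_borel Ej_borel U E_lim s_pos s_less s_lim])
  fix j \<delta> and B :: "(real^'n) set" assume B: "\<forall>x\<in>B. ball x \<delta> \<subseteq> U"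
  have Ub: "U \<in> sets borel" using U by simp
  have "near_energy (s j) \<delta> (Ej j) B \<le> 2 * interaction (s j) (Ej j \<inter> U) (- Ej j \<inter> U)"
    by (rule near_energy_le_interaction[OF Ej_borel Ub B])
  also have "\<dots> \<le> 2 * Per_s (s j) (Ej j) W"
    by (intro mult_left_mono order_trans[OF interaction_le_Per_s Per_s_mono[OF Ej_borel Ub W]]) simp
  finally show "near_energy (s j) \<delta> (Ej j) B \<le> 2 * Per_s (s j) (Ej j) W" .
qed

lemma energy_bounded:
  assumes K: "K \<in> sets borel" "compactly_contained K \<Omega>"
  shows "\<exists>u u0. u \<longlonglongrightarrow> u0 \<and> (\<forall>j. energy K j \<le> ereal (u j))"
proof -
  obtain d t0 where d: "level_function d t0 \<Omega>" and K0: "\<forall>x\<in>closure K. d x \<le> 0"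
    using level_function_exists[of "closure K" \<Omega>] K(2) open_Omega unfolding compactly_contained_def by blast
  have t0: "0 < t0" using d by (rule level_pos)
  \<comment> \<open>The empty set may differ from E_j anywhere, so the mismatch set is the whole
    space and \<open>?v\<close> the volume of {d < t0}. \<open>?b\<close> serves also as the cut-off
    \<delta>.\<close>
  let ?a = "t0/4" and ?b = "t0/2"
  let ?v = "measure lborel (UNIV \<inter> {x. d x < ?b + ?b})" and ?w = "measure lborel {x. d x < ?b}"
  define u where "u j = (1 - 2 * s j) * glue_error j ?b ?a ?b ?v ?w + M * measure lebesgue \<Omega>" for j
  have "energy K j \<le> ereal (u j)" for j
  proof -
    have "\<exists>t. ?a < t \<and> t < ?b \<and> energy {x. d x < t} j \<le> ereal (1 - 2 * s j) * enn2ereal (Per_s (s j) {} {x. d x < t})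
      + ereal ((1 - 2 * s j) * glue_error j ?b ?a ?b ?v ?w)
      + ereal ((LINT x:{x. d x < t} \<inter> {}|lebesgue. Hj j x) - (LINT x:{x. d x < t} \<inter> Ej j|lebesgue. Hj j x))"
      using t0 by (intro glue_estimate[OF d]) auto
    then obtain t where t: "?a < t" "t < ?b" and le: "energy {x. d x < t} j \<le> ereal (1 - 2 * s j) * enn2ereal (Per_s (s j) {} {x. d x < t})
      + ereal ((1 - 2 * s j) * glue_error j ?b ?a ?b ?v ?w)
      + ereal ((LINT x:{x. d x < t} \<inter> {}|lebesgue. Hj j x) - (LINT x:{x. d x < t} \<inter> Ej j|lebesgue. Hj j x))" by blast
    have A: "{x. d x < t} \<in> sets borel" "{x. d x < t} \<subseteq> \<Omega>"
      using level_borel[OF d] level_subset[OF d, of t] t t0 by auto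
    have "K \<subseteq> {x. d x < t}" using K0 closure_subset[of K] t(1) t0 by force
    then have "energy K j \<le> energy {x. d x < t} j" by (rule energy_mono[OF K(1) A(1)])
    also have "\<dots> \<le> ereal ((1 - 2 * s j) * glue_error j ?b ?a ?b ?v ?w - (LINT x:{x. d x < t} \<inter> Ej j|lebesgue. Hj j x))"
      using le by (simp add: Per_s_empty zero_ennreal.rep_eq set_lebesgue_integral_def[of _ "{}"])
    also have "\<dots> \<le> ereal (u j)"
    proof -
      have "{x. d x < t} \<inter> Ej j \<in> sets lebesgue" "{x. d x < t} \<inter> Ej j \<subseteq> \<Omega>" using A Ej_borel[of j] by auto
      from integral_bound[OF this, of j] show ?thesis by (simp add: u_def)
    qed
    finally show ?thesis .
  qed
  moreover have "u \<longlonglongrightarrow> 2 * (real CARD('n) * unit_ball_vol (real CARD('n)) * ?v / (?b - ?a)) + M * measure lebesgue \<Omega>"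
    unfolding u_def using t0 by (intro tendsto_add glue_error_lim tendsto_const) auto
  ultimately show ?thesis by blast
qed

text \<open>The energies are bounded and their liminf dominates the perimeter.\<close>

lemma Per_open_finite:
  assumes U: "open U" "compactly_contained U \<Omega>"
  shows "Per_open E U < \<infinity>"
proof -
  have Ub: "U \<in> sets borel" using U(1) by simp
  obtain u u0 where u: "u \<longlonglongrightarrow> u0" "\<forall>j. energy U j \<le> ereal (u j)" using energy_bounded[OF Ub U(2)] by blast
  have "ereal (unit_ball_vol (real (CARD('n) - 1))) * Per_open E U \<le> liminf (energy U)" by (rule energy_liminf[OF U(1) Ub order_refl])
  also have "\<dots> \<le> liminf (\<lambda>j. ereal (u j))" using u(2) by (intro Liminf_mono) auto
  also have "\<dots> = ereal u0" using u(1) by (intro lim_imp_Liminf) auto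
  finally show ?thesis using omega_pos omega_pos' by (cases "Per_open E U") auto
qed

text \<open>Gluing bounds the energy of E_j by that of \<open>F\<close> below a level inside the
  shell. P1 is the main term; P2 is the excess of the short pairs leaving the sublevel, which
  \<open>Per_s_le_near_far\<close> counts a second time.\<close>

lemma energy_upper_bound:
  assumes d: "level_function d t0 \<Omega>" and \<alpha>\<beta>: "0 < \<alpha>" "\<alpha> < \<beta>" "\<beta> < t0" and a: "a = (2 * \<alpha> + \<beta>) / 3"
    and F: "F \<in> sets borel" "sym_diff F E \<subseteq> {x. d x \<le> \<alpha>}"
    and P: "Per_open F {x. d x < \<beta>} = ereal P1" "Per_open F {x. \<alpha> < d x \<and> d x < \<beta>} = ereal P2"
  shows "\<exists>z. z \<longlonglongrightarrow> unit_ball_vol (real (CARD('n) - 1)) * (P1 + P2) + ((LINT x:{x. d x < a} \<inter> F|lebesgue. H x) - (LINT x:{x. d x < a} \<inter> E|lebesgue. H x))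
    \<and> (\<forall>j. energy {x. d x < a} j \<le> ereal (z j))"
proof -
  define A where "A t = {x. d x < t}" for t
  define b where "b = (\<alpha> + 2 * \<beta>) / 3"
  \<comment> \<open>The shell is cut into thirds and the gluing level lies in the middle one. The
    strip that starts \<delta> below a, enlarged by r, stays in the shell because \<delta> + r = 5/6
    r0; r > \<delta> is required by the comparison with the perimeter.\<close>
  define r0 where "r0 = (\<beta> - \<alpha>) / 3"
  define \<delta> where "\<delta> = r0 / 3"
  define r where "r = r0 / 2"
  have r0: "r0 > 0" "a = \<alpha> + r0" "b = a + r0" "\<beta> = b + r0" using \<alpha>\<beta> by (simp_all add: r0_def a b_def field_simps)
  have \<delta>: "0 < \<delta>" "\<delta> < r" using r0(1) by (simp_all add: \<delta>_def r_def)
  have ab: "0 < a" "a < b" "b < t0" "b + \<delta> \<le> t0" using r0 \<alpha>\<beta> by (simp_all add: \<delta>_def)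
  have Ab: "A t \<in> sets borel" for t using level_borel[OF d] by (simp add: A_def)
  have AO: "A t \<subseteq> \<Omega>" if "t \<le> t0" for t using level_subset[OF d that] by (simp add: A_def)
  obtain R where R: "\<And>x. x \<in> A t0 \<Longrightarrow> norm x \<le> R"
    using level_bounded[OF d order_refl] unfolding A_def by (auto simp: bounded_iff)
  define m where "m j = measure lborel (cball 0 R \<inter> sym_diff (Ej j) E)" for j
  define v where "v j = measure lborel (sym_diff E (Ej j) \<inter> A (b + \<delta>))" for j
  define w where "w = measure lborel (A b)"
  define D where "D j = (LINT x:A a \<inter> F|lebesgue. Hj j x) - (LINT x:A a \<inter> E|lebesgue. Hj j x)" for j
  define c where "c j = linear_const TYPE('n) (s j) \<delta>" for j
  define f where "f j = far_const TYPE('n) (s j) \<delta>" for j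
  have c0: "c j \<ge> 0" "f j \<ge> 0" for j
    unfolding c_def f_def using linear_const_nonneg[OF s_less] far_const_nonneg[OF s_pos] by auto
  have P0: "P1 \<ge> 0" "P2 \<ge> 0" using Per_open_nonneg[of F] P by (metis ereal_less_eq(5))+
  have fm: "cball 0 R \<inter> sym_diff (Ej j) E \<in> fmeasurable lborel" for j
  proof -
    have "cball 0 R \<inter> sym_diff (Ej j) E \<in> sets lborel" using Ej_borel[of j] E_borel by auto
    moreover have "emeasure lborel (cball 0 R \<inter> sym_diff (Ej j) E) < \<infinity>"
      by (intro emeasure_bounded_finite bounded_Int) simp
    ultimately show ?thesis by (rule fmeasurableI)
  qed
  have meas_le: "measure lborel X \<le> m j" if "X \<in> sets borel" "X \<subseteq> A t0 \<inter> sym_diff (Ej j) E" for X j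
    unfolding m_def using that R fm[of j] by (intro measure_mono_fmeasurable) auto
  have m0: "m \<longlonglongrightarrow> 0" unfolding m_def by (rule E_lim)
  have v0: "v \<longlonglongrightarrow> 0"
  proof (rule Lim_null_comparison[OF _ m0], rule always_eventually, rule allI)
    fix j
    have "v j \<le> m j" unfolding v_def using Ab Ej_borel[of j] E_borel ab(4) by (intro meas_le) (auto simp: A_def)
    then show "norm (v j) \<le> m j" by (simp add: v_def)
  qed
  have per: "enn2ereal (Per_s (s j) F (A t)) \<le> ereal ((c j * (P1 + P2) + 2 * (f j * w)) / 2)" if t: "a < t" "t < b" for j t
  proof -
    \<comment> \<open>Short pairs leaving the sublevel start in this strip whatever the level
      between a and b, so the bound is uniform in the j-dependent level.\<close>
    let ?B = "{x. a - \<delta> < d x \<and> d x < b}"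
    have Bb: "?B \<in> sets borel" using level_open(2)[OF d] by simp
    have bd: "bounded (A t)" "bounded ?B"
    proof -
      have bb: "bounded (A b)" using level_bounded[OF d, of b] ab(3) by (simp add: A_def)
      show "bounded (A t)" using bb by (rule bounded_subset) (use t in \<open>auto simp: A_def\<close>)
      show "bounded ?B" using bb by (rule bounded_subset) (auto simp: A_def)
    qed
    have dy: "d y < d x + k \<and> d x - k < d y" if "dist x y < k" for x y k
      using level_lipschitz[OF d, of x y] that unfolding dist_norm by linarith
    have "near_energy (s j) \<delta> F (A t) \<le> ennreal (c j) * e2ennreal (Per_open F {x. d x < \<beta>})"
      unfolding c_def
    proof (rule near_energy_le_Per_open[OF F(1) Ab bd(1) _ \<delta> s_less])
      fix x assume x: "x \<in> A t"
      show "ball x r \<subseteq> {x. d x < \<beta>}"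
      proof
        fix y assume "y \<in> ball x r"
        then have "d y < d x + r \<and> d x - r < d y" by (intro dy) simp
        then show "y \<in> {x. d x < \<beta>}" using x t r0 by (simp add: A_def r_def)
      qed
    qed
    moreover have "near_energy (s j) \<delta> F ?B \<le> ennreal (c j) * e2ennreal (Per_open F {x. \<alpha> < d x \<and> d x < \<beta>})"
      unfolding c_def
    proof (rule near_energy_le_Per_open[OF F(1) Bb bd(2) _ \<delta> s_less])
      fix x assume x: "x \<in> ?B"
      show "ball x r \<subseteq> {x. \<alpha> < d x \<and> d x < \<beta>}"
      proof
        fix y assume "y \<in> ball x r"
        then have "d y < d x + r \<and> d x - r < d y" by (intro dy) simp
        then show "y \<in> {x. \<alpha> < d x \<and> d x < \<beta>}" using x t r0 by (simp add: r_def \<delta>_def)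
      qed
    qed
    moreover have "emeasure lborel (A t) \<le> ennreal w"
    proof -
      have "emeasure lborel (A t) \<le> emeasure lborel (A b)" using t Ab by (intro emeasure_mono) (auto simp: A_def)
      also have "\<dots> = ennreal w" unfolding w_def
        using emeasure_bounded_finite[OF level_bounded[OF d, of b]] ab(3) by (simp add: A_def emeasure_eq_ennreal_measure)
      finally show ?thesis .
    qed
    moreover have "2 * Per_s (s j) F (A t) \<le> near_energy (s j) \<delta> F (A t) + near_energy (s j) \<delta> F ?B + 2 * (ennreal (f j) * emeasure lborel (A t))"
      unfolding f_def
    proof (rule Per_s_le_near_far[OF F(1) Ab Bb s_pos \<delta>(1)])
      fix x y assume "x \<in> A t" "y \<notin> A t" "norm (x - y) < \<delta>"
      then show "x \<in> ?B" using level_lipschitz[OF d, of x y] t by (simp add: A_def)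
    qed
    ultimately have "2 * Per_s (s j) F (A t) \<le> ennreal (c j) * e2ennreal (Per_open F {x. d x < \<beta>})
        + ennreal (c j) * e2ennreal (Per_open F {x. \<alpha> < d x \<and> d x < \<beta>}) + 2 * (ennreal (f j) * ennreal w)"
      by (meson add_mono mult_left_mono order_trans zero_le)
    also have "\<dots> = ennreal (c j * P1) + ennreal (c j * P2) + ennreal (2 * (f j * w))"
    proof -
      have "2 * (ennreal (f j) * ennreal w) = ennreal (2 * (f j * w))"
        using c0(2)[of j] by (simp add: ennreal_mult' w_def)
      moreover have "ennreal (c j) * e2ennreal (ereal p) = ennreal (c j * p)" for p
        using c0(1)[of j] by (simp add: e2ennreal_ereal ennreal_mult')
      ultimately show ?thesis unfolding P by (simp only:)
    qed
    also have "\<dots> = ennreal (c j * (P1 + P2) + 2 * (f j * w))"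
      using c0[of j] P0 by (simp add: distrib_left w_def)
    finally show ?thesis
      using c0[of j] P0 by (intro enn2ereal_half_le) (auto simp: w_def)
  qed
  \<comment> \<open>Above a the sets \<open>F\<close> and \<open>E\<close> agree, so the difference
    of integrals at the j-dependent level t reduces to the fixed level a. Exchanging E_j for
    \<open>E\<close> costs \<open>M\<close> times the mismatch volume.\<close>
  have h: "(LINT x:A t \<inter> F|lebesgue. Hj j x) - (LINT x:A t \<inter> Ej j|lebesgue. Hj j x) \<le> D j + M * m j" if t: "a < t" "t < b" for j t
  proof -
    have leb: "A t \<in> sets lebesgue" "A a \<in> sets lebesgue" "E \<in> sets lebesgue" "F \<in> sets lebesgue" "Ej j \<in> sets lebesgue"
      using Ab E_borel F(1) Ej_borel by auto
    have tO: "A t \<subseteq> \<Omega>" using t ab by (intro AO) simp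
    define I where "I X = (LINT x:X|lebesgue. Hj j x)" for X
    have sp: "I (A t \<inter> X) = I (A a \<inter> X) + I (A t \<inter> X - A a)" if "X \<in> sets lebesgue" for X
    proof -
      have "A t \<inter> X \<inter> A a = A a \<inter> X" using t by (auto simp: A_def)
      then show ?thesis using set_integral_split[OF Hj_int[of j], of "A t \<inter> X" "A a"] leb that tO by (auto simp: I_def)
    qed
    have "A t \<inter> F - A a = A t \<inter> E - A a" using F(2) r0 by (auto simp: A_def)
    then have e1: "I (A t \<inter> F) - I (A t \<inter> E) = D j" using sp[OF leb(3)] sp[OF leb(4)] by (simp add: D_def I_def)
    let ?S = "sym_diff (A t \<inter> E) (A t \<inter> Ej j)"
    have "I (A t \<inter> E) - I (A t \<inter> Ej j) \<le> M * measure lebesgue ?S"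
    proof -
      have X: "A t \<inter> E \<in> sets lebesgue" "A t \<inter> E \<subseteq> \<Omega>" "A t \<inter> Ej j \<in> sets lebesgue" "A t \<inter> Ej j \<subseteq> \<Omega>" using leb tO by auto
      show ?thesis using integral_difference_bound[OF X, of j] unfolding I_def by linarith
    qed
    also have "measure lebesgue ?S = measure lborel ?S"
      using Ab E_borel Ej_borel[of j] by (intro measure_completion) auto
    also have "M * measure lborel ?S \<le> M * m j"
      using M_nonneg Ab E_borel Ej_borel[of j] t ab by (intro mult_left_mono meas_le) (auto simp: A_def)
    finally show ?thesis using e1 unfolding I_def by simp
  qed
  define z where "z j = (1 - 2 * s j) * ((c j * (P1 + P2) + 2 * (f j * w)) / 2) + (1 - 2 * s j) * glue_error j \<delta> a b (v j) w + (D j + M * m j)" for j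
  have le: "energy (A a) j \<le> ereal (z j)" for j
  proof -
    have "\<exists>t. a < t \<and> t < b \<and> energy {x. d x < t} j \<le> ereal (1 - 2 * s j) * enn2ereal (Per_s (s j) F {x. d x < t})
      + ereal ((1 - 2 * s j) * glue_error j \<delta> a b (measure lborel (sym_diff E (Ej j) \<inter> {x. d x < b + \<delta>})) (measure lborel {x. d x < b}))
      + ereal ((LINT x:{x. d x < t} \<inter> F|lebesgue. Hj j x) - (LINT x:{x. d x < t} \<inter> Ej j|lebesgue. Hj j x))"
    proof (rule glue_estimate[OF d ab(1,2,3) \<delta>(1) ab(4) F(1)])
      show "sym_diff E (Ej j) \<in> sets borel" using E_borel Ej_borel[of j] by auto
      show "sym_diff F (Ej j) - {x. d x < a} \<subseteq> sym_diff E (Ej j)" using F(2) r0 by auto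
    qed
    then obtain t where t: "a < t" "t < b" and e: "energy (A t) j \<le> ereal (1 - 2 * s j) * enn2ereal (Per_s (s j) F (A t))
      + ereal ((1 - 2 * s j) * glue_error j \<delta> a b (v j) w)
      + ereal ((LINT x:A t \<inter> F|lebesgue. Hj j x) - (LINT x:A t \<inter> Ej j|lebesgue. Hj j x))"
      unfolding A_def v_def w_def by blast
    have "energy (A a) j \<le> energy (A t) j" using Ab t by (intro energy_mono) (auto simp: A_def)
    also note e
    also have "ereal (1 - 2 * s j) * enn2ereal (Per_s (s j) F (A t))
      + ereal ((1 - 2 * s j) * glue_error j \<delta> a b (v j) w)
      + ereal ((LINT x:A t \<inter> F|lebesgue. Hj j x) - (LINT x:A t \<inter> Ej j|lebesgue. Hj j x))
      \<le> ereal (1 - 2 * s j) * ereal ((c j * (P1 + P2) + 2 * (f j * w)) / 2) + ereal ((1 - 2 * s j) * glue_error j \<delta> a b (v j) w) + ereal (D j + M * m j)"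
      using s_less[of j] h[OF t, of j] by (intro add_mono ereal_mult_left_mono per[OF t]) auto
    also have "\<dots> = ereal (z j)" by (simp add: z_def)
    finally show ?thesis .
  qed
  have zlim: "z \<longlonglongrightarrow> unit_ball_vol (real (CARD('n) - 1)) * (P1 + P2) + ((LINT x:A a \<inter> F|lebesgue. H x) - (LINT x:A a \<inter> E|lebesgue. H x))"
  proof -
    have eq: "(1 - 2 * s j) * ((c j * (P1 + P2) + 2 * (f j * w)) / 2) = unit_ball_vol (real (CARD('n) - 1)) * \<delta> powr (1 - 2 * s j) * (P1 + P2) + ((1 - 2 * s j) * f j) * w" for j
    proof -
      have "(1 - 2 * s j) * ((c j * (P1 + P2) + 2 * (f j * w)) / 2) = ((1 - 2 * s j) * c j) / 2 * (P1 + P2) + ((1 - 2 * s j) * f j) * w"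
        by (simp add: add_divide_distrib distrib_left)
      then show ?thesis using linear_const_scaled[OF s_less, of j \<delta>, where 'n='n] by (simp add: c_def)
    qed
    have aO: "A a \<inter> X \<in> sets lebesgue" "A a \<inter> X \<subseteq> \<Omega>" if "X \<in> sets borel" for X
      using Ab that AO[of a] ab by auto
    have "(\<lambda>j. unit_ball_vol (real (CARD('n) - 1)) * \<delta> powr (1 - 2 * s j) * (P1 + P2) + ((1 - 2 * s j) * f j) * w + (1 - 2 * s j) * glue_error j \<delta> a b (v j) w + (D j + M * m j))
      \<longlonglongrightarrow> unit_ball_vol (real (CARD('n) - 1)) * 1 * (P1 + P2) + 0 * w + 2 * (real CARD('n) * unit_ball_vol (real CARD('n)) * 0 / (b - a))
        + (((LINT x:A a \<inter> F|lebesgue. H x) - (LINT x:A a \<inter> E|lebesgue. H x)) + M * 0)"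
      unfolding D_def f_def
      by (rule tendsto_add[OF tendsto_add[OF tendsto_add[OF
            tendsto_mult[OF tendsto_mult[OF tendsto_const powr_tendsto_1[OF s_lim \<delta>(1)]] tendsto_const]
            tendsto_mult[OF far_const_lim[OF \<delta>(1)] tendsto_const]] glue_error_lim[OF \<delta>(1) v0]]
          tendsto_add[OF tendsto_diff[OF integral_tendsto[OF aO[OF F(1)]] integral_tendsto[OF aO[OF E_borel]]]
            tendsto_mult[OF tendsto_const m0]]])
    then show ?thesis unfolding z_def eq by simp
  qed
  show ?thesis using zlim le unfolding A_def by blast
qed

text \<open>The competitor is \<open>E\<close> itself, so the integrals of H cancel in the limit,
  and a shell of perimeter at most \<eta> makes the excess P2 arbitrarily small.\<close>

lemma energy_limsup_open:
  assumes C: "compact C" "C \<subseteq> \<Omega>" and W: "W \<in> sets borel" "W \<subseteq> C" and U: "open U" "C \<subseteq> U"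
  shows "limsup (energy W) \<le> ereal (unit_ball_vol (real (CARD('n) - 1))) * Per_open E U"
proof (cases "Per_open E U")
  case (real p)
  have sub: "C \<subseteq> U \<inter> \<Omega>" "open (U \<inter> \<Omega>)" using C(2) U open_Omega by auto
  obtain d t0 where d: "level_function d t0 (U \<inter> \<Omega>)" and C0: "\<forall>x\<in>C. d x \<le> 0"
    using level_function_exists[OF C(1) sub] by blast
  have dO: "level_function d t0 \<Omega>" using d by (auto simp: level_function_def)
  have le: "limsup (energy W) \<le> ereal (unit_ball_vol (real (CARD('n) - 1)) * p) + ereal e" if e: "0 < e" for e
  proof -
    define \<eta> where "\<eta> = e / (unit_ball_vol (real (CARD('n) - 1)))"
    have eta: "0 < \<eta>" using e omega_pos by (simp add: \<eta>_def)
    have dU: "{x. d x < t0} \<subseteq> U" using level_subset[OF d order_refl] by auto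
    have "Per_open E U < \<infinity>" using real by simp
    then obtain \<alpha> \<beta> where ab: "0 < \<alpha>" "\<alpha> < \<beta>" "\<beta> < t0" and sh: "Per_open E {x. \<alpha> < d x \<and> d x < \<beta>} \<le> ereal \<eta>"
      using small_shell[OF E_borel _ dU level_pos[OF d] eta] by blast
    obtain P2 where P2: "Per_open E {x. \<alpha> < d x \<and> d x < \<beta>} = ereal P2" "P2 \<le> \<eta>"
      using sh Per_open_nonneg[of E "{x. \<alpha> < d x \<and> d x < \<beta>}"] by (cases "Per_open E {x. \<alpha> < d x \<and> d x < \<beta>}") auto
    have "Per_open E {x. d x < \<beta>} \<le> ereal p"
      using dU ab unfolding real[symmetric] by (intro Per_open_mono) auto
    then obtain P1 where P1: "Per_open E {x. d x < \<beta>} = ereal P1" "P1 \<le> p"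
      using Per_open_nonneg[of E "{x. d x < \<beta>}"] by (cases "Per_open E {x. d x < \<beta>}") auto
    define a where "a = (2 * \<alpha> + \<beta>) / 3"
    have "sym_diff E E \<subseteq> {x. d x \<le> \<alpha>}" by simp
    then obtain z where z: "z \<longlonglongrightarrow> unit_ball_vol (real (CARD('n) - 1)) * (P1 + P2) + ((LINT x:{x. d x < a} \<inter> E|lebesgue. H x) - (LINT x:{x. d x < a} \<inter> E|lebesgue. H x))"
      "\<forall>j. energy {x. d x < a} j \<le> ereal (z j)"
      using energy_upper_bound[OF dO ab a_def E_borel _ P1(1) P2(1)] by blast
    have "W \<subseteq> {x. d x < a}" using W(2) C0 ab by (force simp: a_def)
    then have "limsup (energy W) \<le> limsup (\<lambda>j. ereal (z j))"
      by (intro Limsup_mono always_eventually allI order_trans[OF energy_mono[OF W(1) level_borel[OF d]] z(2)[rule_format]])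
    also have "\<dots> = ereal (unit_ball_vol (real (CARD('n) - 1)) * (P1 + P2))" using z(1) by (intro lim_imp_Limsup) auto
    also have "\<dots> \<le> ereal (unit_ball_vol (real (CARD('n) - 1)) * (p + \<eta>))" using P1(2) P2(2) omega_pos omega_pos' by simp
    also have "\<dots> = ereal (unit_ball_vol (real (CARD('n) - 1)) * p) + ereal e" using omega_pos' by (simp add: \<eta>_def distrib_left)
    finally show ?thesis .
  qed
  show ?thesis unfolding real using ereal_le_epsilon2[of "limsup (energy W)" "ereal (unit_ball_vol (real (CARD('n) - 1)) * p)"] le by simp
next
  case PInf
  then show ?thesis using omega_pos omega_pos' by simp
next
  case MInf
  then show ?thesis using Per_open_nonneg[of E U] by simp
qed

text \<open>The lower bound lives on an open set inside \<open>W\<close> and the upper bound on open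
  sets around its closure; both limits agree if no perimeter sits in between. \<open>W\<close> is
  any Borel set in between, so that a null modification of a given region is allowed.\<close>

lemma energy_limit:
  assumes C: "compact C" "C \<subseteq> \<Omega>" and I: "open I" "I \<subseteq> C" and W: "W \<in> sets borel" "I \<subseteq> W" "W \<subseteq> C"
    and null: "Per E (C - I) = 0"
  shows "energy W \<longlonglongrightarrow> ereal (unit_ball_vol (real (CARD('n) - 1))) * Per_open E I"
    and "I \<subseteq> K \<Longrightarrow> K \<subseteq> C \<Longrightarrow> Per E K = Per_open E I"
proof -
  \<comment> \<open>An open neighbourhood of \<open>C - I\<close> with small perimeter exists by the
    infimum that defines \<open>Per\<close>; together with \<open>I\<close> it covers
    \<open>C\<close>, and subadditivity applies.\<close>
  have small: "\<exists>V. open V \<and> C \<subseteq> V \<and> Per_open E V \<le> Per_open E I + ereal e" if e: "0 < e" for e :: real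
  proof -
    have "Per E (C - I) < ereal e" using null e by simp
    then obtain V where V: "open V" "C - I \<subseteq> V" "Per_open E V < ereal e"
      unfolding Per_def INF_less_iff by blast
    have "Per_open E (I \<union> V) \<le> Per_open E I + Per_open E V" by (rule Per_open_subadditive[OF E_borel I(1) V(1) order_refl])
    also have "\<dots> \<le> Per_open E I + ereal e" using V(3) by (intro add_left_mono) simp
    finally show ?thesis using V(1,2) I(1) by (intro exI[of _ "I \<union> V"]) auto
  qed
  show "Per E K = Per_open E I" if K: "I \<subseteq> K" "K \<subseteq> C"
  proof (rule antisym)
    show "Per_open E I \<le> Per E K" unfolding Per_def using K by (intro INF_greatest Per_open_mono) auto
    show "Per E K \<le> Per_open E I"
    proof (rule ereal_le_epsilon2)
      fix e :: real assume "0 < e"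
      then obtain V where V: "open V" "C \<subseteq> V" "Per_open E V \<le> Per_open E I + ereal e" using small by blast
      have "Per E K \<le> Per_open E V" unfolding Per_def using V K by (intro INF_lower) auto
      then show "Per E K \<le> Per_open E I + ereal e" using V(3) by (rule order_trans)
    qed
  qed
  have "limsup (energy W) \<le> ereal (unit_ball_vol (real (CARD('n) - 1))) * Per_open E I"
  proof (rule ereal_le_epsilon2)
    fix e :: real assume e: "0 < e"
    then have "0 < e / (unit_ball_vol (real (CARD('n) - 1)))" using omega_pos omega_pos' by simp
    then obtain V where V: "open V" "C \<subseteq> V" "Per_open E V \<le> Per_open E I + ereal (e / (unit_ball_vol (real (CARD('n) - 1))))" using small by blast
    have "limsup (energy W) \<le> ereal (unit_ball_vol (real (CARD('n) - 1))) * Per_open E V" by (rule energy_limsup_open[OF C W(1,3) V(1,2)])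
    also have "\<dots> \<le> ereal (unit_ball_vol (real (CARD('n) - 1))) * (Per_open E I + ereal (e / (unit_ball_vol (real (CARD('n) - 1)))))" using V(3) omega_pos by (intro ereal_mult_left_mono) auto
    also have "\<dots> = ereal (unit_ball_vol (real (CARD('n) - 1))) * Per_open E I + ereal e"
    proof -
      have "unit_ball_vol (real (CARD('n) - 1)) * (e / unit_ball_vol (real (CARD('n) - 1))) = e"
        using omega_pos by (metis less_irrefl nonzero_mult_div_cancel_left times_divide_eq_right)
      then show ?thesis by (simp only: ereal_mult_add_real)
    qed
    finally show "limsup (energy W) \<le> ereal (unit_ball_vol (real (CARD('n) - 1))) * Per_open E I + ereal e" .
  qed
  note upper = this
  have lower: "ereal (unit_ball_vol (real (CARD('n) - 1))) * Per_open E I \<le> liminf (energy W)" by (rule energy_liminf[OF I(1) W(1,2)])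
  have mid: "liminf (energy W) \<le> limsup (energy W)" by (rule Liminf_le_Limsup) simp
  have "liminf (energy W) = ereal (unit_ball_vol (real (CARD('n) - 1))) * Per_open E I" by (rule antisym[OF order_trans[OF mid upper] lower])
  moreover have "limsup (energy W) = ereal (unit_ball_vol (real (CARD('n) - 1))) * Per_open E I" by (rule antisym[OF upper order_trans[OF lower mid]])
  ultimately show "energy W \<longlonglongrightarrow> ereal (unit_ball_vol (real (CARD('n) - 1))) * Per_open E I"
    using tendsto_iff_Liminf_eq_Limsup[OF trivial_limit_sequentially, of "energy W"] by blast
qed

end

section \<open>Null sets\<close>

definition ae_equal :: "'a::euclidean_space set \<Rightarrow> 'a set \<Rightarrow> bool"
  where "ae_equal A B \<longleftrightarrow> (AE x in lebesgue. x \<in> A \<longleftrightarrow> x \<in> B)"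

lemma ae_equal_refl: "ae_equal A A" and ae_equal_sym: "ae_equal A B \<Longrightarrow> ae_equal B A"
  by (auto simp: ae_equal_def elim: eventually_mono)

lemma ae_equal_Int: "ae_equal A B \<Longrightarrow> ae_equal A' B' \<Longrightarrow> ae_equal (A \<inter> A') (B \<inter> B')"
  and ae_equal_Compl: "ae_equal A B \<Longrightarrow> ae_equal (- A) (- B)"
  by (auto simp: ae_equal_def elim: eventually_elim2 eventually_mono)

lemma borel_representative:
  assumes "A \<in> sets lebesgue"
  shows "\<exists>B\<in>sets borel. ae_equal A B"
proof -
  from assms obtain S N N' where A: "A = S \<union> N" "N \<subseteq> N'" "N' \<in> null_sets lborel" "S \<in> sets lborel"
    by (rule sets_completionE)
  have "AE x in lebesgue. x \<notin> N'" by (rule AE_completion[OF AE_not_in[OF A(3)]])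
  then have "ae_equal A S" unfolding ae_equal_def by (rule eventually_mono) (use A(1,2) in blast)
  then show ?thesis using A(4) by auto
qed

text \<open>A representative with the topological bounds of the original set: membership is
  corrected on the interior and outside the closure, where it is known.\<close>

lemma borel_representative_between:
  assumes "K \<in> sets lebesgue"
  shows "\<exists>W\<in>sets borel. ae_equal K W \<and> interior K \<subseteq> W \<and> W \<subseteq> closure K"
proof -
  obtain B where B: "B \<in> sets borel" "ae_equal K B" using borel_representative[OF assms] by blast
  let ?W = "(B \<union> interior K) \<inter> closure K"
  have "?W \<in> sets borel" using B(1) by auto
  moreover have "ae_equal K ?W"
    using B(2) unfolding ae_equal_def by (rule eventually_mono) (use interior_subset closure_subset in blast)
  moreover have "interior K \<subseteq> ?W" using interior_subset closure_subset by blast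
  ultimately show ?thesis by blast
qed

lemma interaction_ae_equal:
  assumes "ae_equal A A'" "ae_equal B B'"
  shows "interaction s A B = interaction s A' B'"
  unfolding interaction_def
proof (rule nn_integral_cong_AE)
  have B: "(\<integral>\<^sup>+y\<in>B. f y \<partial>lebesgue) = (\<integral>\<^sup>+y\<in>B'. f y \<partial>lebesgue)" for f :: "_ \<Rightarrow> ennreal"
    by (rule nn_integral_cong_AE) (use assms(2)[unfolded ae_equal_def] in eventually_elim, simp add: indicator_def)
  show "AE x in lebesgue. (\<integral>\<^sup>+y\<in>B. ennreal (1 / norm (x - y) powr (real CARD('a) + 2 * s)) \<partial>lebesgue) * indicator A x
      = (\<integral>\<^sup>+y\<in>B'. ennreal (1 / norm (x - y) powr (real CARD('a) + 2 * s)) \<partial>lebesgue) * indicator A' x"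
    unfolding B using assms(1)[unfolded ae_equal_def] by eventually_elim (simp add: indicator_def)
qed

lemma Per_s_ae_equal:
  assumes "ae_equal E F" "ae_equal A B"
  shows "Per_s s E A = Per_s s F B"
  unfolding Per_s_def by (intro arg_cong2[where f="(+)"] interaction_ae_equal ae_equal_Int ae_equal_Compl assms)

lemma set_integral_ae_equal:
  fixes f :: "'a::euclidean_space \<Rightarrow> real"
  assumes f: "f \<in> borel_measurable (lebesgue_on \<Omega>)" "\<Omega> \<in> sets lebesgue"
    and X: "X \<in> sets lebesgue" "X \<subseteq> \<Omega>" and Y: "Y \<in> sets lebesgue" "Y \<subseteq> \<Omega>" and XY: "ae_equal X Y"
  shows "(LINT x:X|lebesgue. f x) = (LINT x:Y|lebesgue. f x)"
  unfolding set_lebesgue_integral_def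
proof (rule integral_cong_AE)
  have m: "(\<lambda>x. indicator \<Omega> x *\<^sub>R f x) \<in> borel_measurable lebesgue"
    using f by (subst (asm) borel_measurable_restrict_space_iff) auto
  have "(\<lambda>x. indicator Z x *\<^sub>R f x) \<in> borel_measurable lebesgue" if Z: "Z \<in> sets lebesgue" "Z \<subseteq> \<Omega>" for Z
  proof -
    have eq: "indicator Z x *\<^sub>R f x = indicator Z x *\<^sub>R (indicator \<Omega> x *\<^sub>R f x)" for x
      using Z(2) by (auto simp: indicator_def)
    show ?thesis unfolding eq by (intro borel_measurable_scaleR borel_measurable_indicator Z m)
  qed
  then show "(\<lambda>x. indicator X x *\<^sub>R f x) \<in> borel_measurable lebesgue" "(\<lambda>x. indicator Y x *\<^sub>R f x) \<in> borel_measurable lebesgue"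
    using X Y by auto
  show "AE x in lebesgue. indicator X x *\<^sub>R f x = indicator Y x *\<^sub>R f x"
    using XY[unfolded ae_equal_def] by eventually_elim (simp add: indicator_def)
qed

lemma Per_open_ae_equal:
  fixes E F :: "(real^'n) set"
  assumes E: "E \<in> sets lebesgue" "F \<in> sets lebesgue" and EF: "ae_equal E F"
  shows "Per_open E U = Per_open F U"
  unfolding Per_open_def
proof (rule SUP_cong[OF refl])
  fix \<phi> :: "real^'n \<Rightarrow> real^'n" assume "\<phi> \<in> {\<phi> \<in> C1_compact_support U. \<forall>x. norm (\<phi> x) \<le> 1}"
  then have "divergence \<phi> \<in> borel_measurable borel"
    by (intro borel_measurable_continuous_onI divergence_continuous[of _ U]) simp
  then have "divergence \<phi> \<in> borel_measurable (lebesgue_on UNIV)"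
    by (simp add: lebesgue_on_UNIV_eq measurable_completion)
  then show "ereal (LINT x:E|lebesgue. divergence \<phi> x) = ereal (LINT x:F|lebesgue. divergence \<phi> x)"
    using set_integral_ae_equal[OF _ _ E(1) _ E(2) _ EF, of "divergence \<phi>" UNIV] by simp
qed

lemma Massari_ae_equal:
  fixes E F :: "(real^'n) set"
  assumes H: "H \<in> borel_measurable (lebesgue_on \<Omega>)" "\<Omega> \<in> sets lebesgue" and A: "A \<in> sets lebesgue" "A \<subseteq> \<Omega>"
    and E: "E \<in> sets lebesgue" "F \<in> sets lebesgue" and EF: "ae_equal E F"
  shows "Massari H A E = Massari H A F"
proof -
  have "(LINT x:A \<inter> E|lebesgue. H x) = (LINT x:A \<inter> F|lebesgue. H x)"
    using A E by (intro set_integral_ae_equal[OF H] ae_equal_Int ae_equal_refl EF) auto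
  moreover have "Per_open E = Per_open F" by (rule ext) (rule Per_open_ae_equal[OF E EF])
  ultimately show ?thesis unfolding Massari_def Per_def by (simp only:)
qed

lemma Massari_s_ae_equal:
  fixes E F :: "(real^'n) set"
  assumes H: "H \<in> borel_measurable (lebesgue_on \<Omega>)" "\<Omega> \<in> sets lebesgue"
    and A: "A \<in> sets lebesgue" "A \<subseteq> \<Omega>" "B \<in> sets lebesgue" "B \<subseteq> \<Omega>" "ae_equal A B"
    and E: "E \<in> sets lebesgue" "F \<in> sets lebesgue" and EF: "ae_equal E F"
  shows "Massari_s s H A E = Massari_s s H B F"
proof -
  have "(LINT x:A \<inter> E|lebesgue. H x) = (LINT x:B \<inter> F|lebesgue. H x)"
    using A E by (intro set_integral_ae_equal[OF H] ae_equal_Int EF) auto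
  then show ?thesis unfolding Massari_s_def by (simp only: Per_s_ae_equal[OF EF A(5)])
qed

lemma splice_ae_equal:
  assumes "ae_equal E E'" "ae_equal F F'" "sym_diff E' F \<subseteq> K"
  shows "ae_equal F ((F' \<inter> K) \<union> (E - K))"
  using assms(1,2) unfolding ae_equal_def by eventually_elim (use assms(3) in blast)

text \<open>Changing a set on a null set can destroy compact containment of its symmetric difference
  with a competitor. The competitor is therefore kept on the closure of the difference and replaced
  by the original minimizer off it, which alters it by a null set only.\<close>

lemma local_minimizer_ae_equal:
  assumes min: "local_minimizer J \<Omega> E" and E: "E \<in> sets lebesgue" "E' \<in> sets lebesgue" "ae_equal E E'"
    and J: "\<And>\<Omega>' F F'. open \<Omega>' \<Longrightarrow> \<Omega>' \<subseteq> \<Omega> \<Longrightarrow> F \<in> sets lebesgue \<Longrightarrow> F' \<in> sets lebesgue \<Longrightarrow> ae_equal F F' \<Longrightarrow> J \<Omega>' F = J \<Omega>' F'"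
  shows "local_minimizer J \<Omega> E'"
  unfolding local_minimizer_def
proof (intro allI impI conjI ballI)
  fix \<Omega>' assume O: "open \<Omega>' \<and> compactly_contained \<Omega>' \<Omega>"
  then have sub: "\<Omega>' \<subseteq> \<Omega>" using closure_subset[of \<Omega>'] by (auto simp: compactly_contained_def)
  have eq: "J \<Omega>' E = J \<Omega>' E'" using O sub E by (intro J) auto
  then show "J \<Omega>' E' < \<infinity>" using min O unfolding local_minimizer_def by metis
  fix F assume F: "F \<in> sets lebesgue" and c: "compactly_contained (sym_diff E' F) \<Omega>'"
  let ?K = "closure (sym_diff E' F)"
  let ?F = "(F \<inter> ?K) \<union> (E - ?K)"
  have "?K \<in> sets lebesgue" by (intro sets_completionI_sets) (simp only: sets_lborel borel_closed closed_closure)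
  then have Fs: "?F \<in> sets lebesgue" using F E by (intro sets.Un sets.Int sets.Diff)
  have "compactly_contained ?K \<Omega>'" using c by (simp add: compactly_contained_def)
  then have "compactly_contained (sym_diff E ?F) \<Omega>'" by (rule compactly_contained_subset) auto
  then have "J \<Omega>' E \<le> J \<Omega>' ?F" using min O Fs unfolding local_minimizer_def by blast
  also have "J \<Omega>' ?F = J \<Omega>' F"
    using O sub F Fs by (intro J[symmetric] splice_ae_equal[OF E(3) ae_equal_refl closure_subset]) auto
  finally show "J \<Omega>' E' \<le> J \<Omega>' F" unfolding eq .
qed

section \<open>Minimality of the limit and convergence of the functionals\<close>

context massari_sequence
begin

lemma Omega_subset: "compactly_contained K \<Omega> \<Longrightarrow> K \<subseteq> \<Omega>"
  using closure_subset[of K] by (auto simp: compactly_contained_def)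

text \<open>The energies compare \<open>E\<close> with \<open>F\<close> on a sublevel {d < a} only,
  and with an excess. As the sets agree outside a compact part of \<open>V\<close>, subadditivity
  for \<open>E\<close> and superadditivity for \<open>F\<close> carry the comparison to all of
  \<open>V\<close>.\<close>

lemma Per_open_minimal:
  assumes V: "open V" "compactly_contained V \<Omega>" and F: "F \<in> sets borel" and K: "compact K" "K \<subseteq> V" "sym_diff F E \<subseteq> K"
    and q: "Per_open F V = ereal q"
  shows "ereal (unit_ball_vol (real (CARD('n) - 1))) * Per_open E V
    \<le> ereal (unit_ball_vol (real (CARD('n) - 1)) * q + ((LINT x:V \<inter> F|lebesgue. H x) - (LINT x:V \<inter> E|lebesgue. H x)))"
proof -
  let ?o = "unit_ball_vol (real (CARD('n) - 1))"
  define D where "D = (LINT x:V \<inter> F|lebesgue. H x) - (LINT x:V \<inter> E|lebesgue. H x)"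
  have VO: "V \<subseteq> \<Omega>" by (rule Omega_subset[OF V(2)])
  obtain d t0 where d: "level_function d t0 V" and K0: "\<forall>x\<in>K. d x \<le> 0"
    using level_function_exists[OF K(1,2) V(1)] by blast
  have dO: "level_function d t0 \<Omega>" using d VO by (auto simp: level_function_def)
  obtain p where p: "Per_open E V = ereal p"
    using Per_open_finite[OF V] Per_open_nonneg[of E V] by (cases "Per_open E V") auto
  have finF: "\<exists>r. Per_open F X = ereal r" if "X \<subseteq> V" for X
    using Per_open_mono[OF that, of F] Per_open_nonneg[of F X] unfolding q by (cases "Per_open F X") auto
  have finE: "\<exists>r. Per_open E X = ereal r" if "X \<subseteq> V" for X
    using Per_open_mono[OF that, of E] Per_open_nonneg[of E X] unfolding p by (cases "Per_open E X") auto
  have "?o * p \<le> (?o * q + D) + e" if e: "0 < e" for e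
  proof -
    define \<eta> where "\<eta> = e / (2 * ?o)"
    have eta: "0 < \<eta>" using e omega_pos by (simp only: \<eta>_def zero_less_divide_iff zero_less_mult_iff) simp
    have dV: "{x. d x < t0} \<subseteq> V" by (rule level_subset[OF d order_refl])
    have "Per_open F V < \<infinity>" by (simp add: q)
    then obtain \<alpha> \<beta> where ab: "0 < \<alpha>" "\<alpha> < \<beta>" "\<beta> < t0" and sh: "Per_open F {x. \<alpha> < d x \<and> d x < \<beta>} \<le> ereal \<eta>"
      using small_shell[OF F _ dV level_pos[OF d] eta] by blast
    define a where "a = (2 * \<alpha> + \<beta>) / 3"
    \<comment> \<open>A level below a, so that {d < a} and {m < d} overlap and cover
      \<open>V\<close>, and above \<alpha>, so that the sets agree on {m < d} and {d < m} together
      with the shell covers {d < \<beta>}.\<close>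
    define m where "m = (\<alpha> + a) / 2"
    have m: "\<alpha> < m" "m < a" "a < \<beta>" using ab(2) by (simp_all add: m_def a_def)
    define U2 where "U2 = V \<inter> {x. m < d x}"
    have U2: "open U2" "U2 \<subseteq> V" unfolding U2_def using V(1) level_open(3)[OF d] by auto
    have sub: "{x. d x < \<beta>} \<subseteq> V" "{x. \<alpha> < d x \<and> d x < \<beta>} \<subseteq> V" "{x. d x < m} \<subseteq> V" "{x. d x < a} \<subseteq> V"
      using dV ab(3) m by auto
    obtain P1 P2 Pm p2 pa where P: "Per_open F {x. d x < \<beta>} = ereal P1" "Per_open F {x. \<alpha> < d x \<and> d x < \<beta>} = ereal P2"
      "Per_open F {x. d x < m} = ereal Pm" "Per_open F U2 = ereal p2" "Per_open E {x. d x < a} = ereal pa"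
      using finF[OF sub(1)] finF[OF sub(2)] finF[OF sub(3)] finF[OF U2(2)] finE[OF sub(4)] by blast
    have P2: "P2 \<le> \<eta>" using sh unfolding P by simp
    have FE: "sym_diff F E \<subseteq> {x. d x \<le> \<alpha>}" using K(3) K0 ab(1) by force
    have pa: "?o * pa \<le> ?o * (P1 + P2) + D"
    proof -
      obtain z where z: "z \<longlonglongrightarrow> ?o * (P1 + P2) + ((LINT x:{x. d x < a} \<inter> F|lebesgue. H x) - (LINT x:{x. d x < a} \<inter> E|lebesgue. H x))"
        "\<forall>j. energy {x. d x < a} j \<le> ereal (z j)"
        using energy_upper_bound[OF dO ab a_def F FE P(1,2)] by blast
      have leb: "V \<in> sets lebesgue" "{x. d x < a} \<in> sets lebesgue" "E \<in> sets lebesgue" "F \<in> sets lebesgue"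
        using V(1) level_borel[OF d] E_borel F by auto
      have sp: "(LINT x:V \<inter> X|lebesgue. H x) = (LINT x:{x. d x < a} \<inter> X|lebesgue. H x) + (LINT x:V \<inter> X - {x. d x < a}|lebesgue. H x)"
        if "X \<in> sets lebesgue" for X
      proof -
        have "V \<inter> X \<inter> {x. d x < a} = {x. d x < a} \<inter> X" using sub(4) by auto
        then show ?thesis using set_integral_split[OF H_int, of "V \<inter> X" "{x. d x < a}"] leb that VO by auto
      qed
      have "V \<inter> F - {x. d x < a} = V \<inter> E - {x. d x < a}" using FE m by auto
      then have D: "(LINT x:{x. d x < a} \<inter> F|lebesgue. H x) - (LINT x:{x. d x < a} \<inter> E|lebesgue. H x) = D"
        using sp[OF leb(3)] sp[OF leb(4)] by (simp add: D_def)
      have "ereal ?o * Per_open E {x. d x < a} \<le> liminf (energy {x. d x < a})"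
        by (rule energy_liminf[OF level_open(1)[OF d] level_borel[OF d] order_refl])
      also have "\<dots> \<le> liminf (\<lambda>j. ereal (z j))" using z(2) by (intro Liminf_mono) auto
      also have "\<dots> = ereal (?o * (P1 + P2) + D)" using z(1) unfolding D by (intro lim_imp_Liminf) auto
      finally show ?thesis unfolding P by simp
    qed
    \<comment> \<open>The inequalities p \<le> pa + p2, P1 \<le> Pm + P2 and Pm + p2 \<le> q,
      combined with the bound for pa, pay for the shell twice; this is the 2 in the choice of
      \<eta>.\<close>
    have "V \<subseteq> {x. d x < a} \<union> U2" using m by (auto simp: U2_def)
    then have "Per_open E V \<le> Per_open E {x. d x < a} + Per_open E U2"
      by (rule Per_open_subadditive[OF E_borel level_open(1)[OF d] U2(1)])
    also have "Per_open E U2 = Per_open F U2"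
      using FE m by (intro Per_open_local[OF E_borel F]) (auto simp: U2_def)
    finally have i1: "p \<le> pa + p2" unfolding P p by simp
    have "{x. d x < \<beta>} \<subseteq> {x. d x < m} \<union> {x. \<alpha> < d x \<and> d x < \<beta>}" using m by auto
    then have "Per_open F {x. d x < \<beta>} \<le> Per_open F {x. d x < m} + Per_open F {x. \<alpha> < d x \<and> d x < \<beta>}"
      by (rule Per_open_subadditive[OF F level_open(1)[OF d] level_open(2)[OF d]])
    then have i2: "P1 \<le> Pm + P2" unfolding P by simp
    have "Per_open F {x. d x < m} + Per_open F U2 \<le> Per_open F V"
      using sub(3) U2(2) by (intro Per_open_superadditive[OF F]) (auto simp: U2_def)
    then have i3: "Pm + p2 \<le> q" unfolding P q by simp
    have "?o * p \<le> ?o * pa + ?o * p2" using mult_left_mono[OF i1, of ?o] omega_pos by (simp only: distrib_left less_imp_le)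
    also have "\<dots> \<le> ?o * (P1 + P2 + p2) + D" using pa by (simp only: distrib_left)
    also have "\<dots> \<le> ?o * (q + 2 * \<eta>) + D"
      using i2 i3 P2 omega_pos by (intro add_right_mono mult_left_mono) linarith+
    also have "\<dots> = ?o * q + D + e"
    proof -
      have "?o * (2 * \<eta>) = e" unfolding \<eta>_def using omega_pos' by simp
      then show ?thesis by (simp only: distrib_left)
    qed
    finally show ?thesis .
  qed
  then have "?o * p \<le> ?o * q + D" by (rule field_le_epsilon)
  then show ?thesis unfolding p D_def by (simp only: times_ereal.simps ereal_less_eq)
qed

lemma limit_minimizer: "local_minimizer (Massari H) \<Omega> E"
  unfolding local_minimizer_def
proof (intro allI impI conjI ballI)
  fix V assume V': "open V \<and> compactly_contained V \<Omega>"
  then have V: "open V" "compactly_contained V \<Omega>" by auto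
  have VO: "V \<subseteq> \<Omega>" by (rule Omega_subset[OF V(2)])
  let ?o = "unit_ball_vol (real (CARD('n) - 1))"
  obtain p where p: "Per_open E V = ereal p"
    using Per_open_finite[OF V] Per_open_nonneg[of E V] by (cases "Per_open E V") auto
  show "Massari H V E < \<infinity>" by (simp add: Massari_def Per_eq_Per_open[OF V(1)] p)
  fix F assume F: "F \<in> sets lebesgue" and c: "compactly_contained (sym_diff E F) V"
  let ?K = "closure (sym_diff E F)"
  \<comment> \<open>The representative may differ from \<open>E\<close> on a null set outside
    \<open>?K\<close>; splicing it with \<open>E\<close> confines the perturbation to
    \<open>?K\<close> exactly.\<close>
  obtain B where B: "B \<in> sets borel" "ae_equal F B" using borel_representative[OF F] by blast
  let ?F = "(B \<inter> ?K) \<union> (E - ?K)"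
  have Fb: "?F \<in> sets borel" using B E_borel by auto
  have ae: "ae_equal F ?F" by (rule splice_ae_equal[OF ae_equal_refl B(2) closure_subset])
  have "Massari H V F = Massari H V ?F"
    using V(1) VO F Fb by (intro Massari_ae_equal[OF borel_measurable_integrable[OF H_int] Omega_sets] ae) auto
  moreover have "Massari H V E \<le> Massari H V ?F"
  proof (cases "Per_open ?F V")
    case PInf
    then show ?thesis by (simp add: Massari_def Per_eq_Per_open[OF V(1)])
  next
    case MInf
    then show ?thesis using Per_open_nonneg[of ?F V] by simp
  next
    case (real q)
    define IF where "IF = (LINT x:V \<inter> ?F|lebesgue. H x)"
    define IE where "IE = (LINT x:V \<inter> E|lebesgue. H x)"
    have K: "compact ?K" "?K \<subseteq> V" "sym_diff ?F E \<subseteq> ?K" using c by (auto simp: compactly_contained_def)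
    have "ereal ?o * Per_open E V \<le> ereal (?o * q + (IF - IE))"
      unfolding IF_def IE_def by (rule Per_open_minimal[OF V Fb K real])
    then have "?o * p \<le> ?o * q + (IF - IE)" unfolding p by simp
    then have "?o * (p + IE / ?o) \<le> ?o * (q + IF / ?o)"
      using omega_pos by (simp only: distrib_left times_divide_eq_right nonzero_mult_div_cancel_left[OF less_imp_neq[OF omega_pos, symmetric]])
    then have "p + IE / ?o \<le> q + IF / ?o" using omega_pos by (rule mult_left_le_imp_le)
    then show ?thesis
      unfolding Massari_def Per_eq_Per_open[OF V(1)] p real IF_def[symmetric] IE_def[symmetric] by simp
  qed
  ultimately show "Massari H V E \<le> Massari H V F" by simp
qed

lemma scaled_Massari_s:
  "ereal (1 - 2 * s j) * Massari_s (s j) (Hj j) K (Ej j) = energy K j + ereal (LINT x:K \<inter> Ej j|lebesgue. Hj j x)"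
  using s_less[of j] unfolding Massari_s_def by (simp add: ereal_mult_add_real)

lemma limsup_finite:
  assumes K: "K \<in> sets lebesgue" "compactly_contained K \<Omega>"
  shows "limsup (\<lambda>j. ereal (1 - 2 * s j) * Massari_s (s j) (Hj j) K (Ej j)) < \<infinity>"
proof -
  obtain W where W: "W \<in> sets borel" "ae_equal K W" "W \<subseteq> closure K" using borel_representative_between[OF K(1)] by blast
  have "compactly_contained (closure K) \<Omega>" using K(2) by (simp add: compactly_contained_def)
  then have "compactly_contained W \<Omega>" using W(3) by (rule compactly_contained_subset)
  then obtain u u0 where u: "u \<longlonglongrightarrow> u0" "\<And>j. energy W j \<le> ereal (u j)" using energy_bounded[OF W(1)] by blast
  have "ereal (1 - 2 * s j) * Massari_s (s j) (Hj j) K (Ej j) \<le> ereal (u j + M * measure lebesgue \<Omega>)" for j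
  proof -
    have KE: "K \<inter> Ej j \<in> sets lebesgue" "K \<inter> Ej j \<subseteq> \<Omega>" using K(1) Ej_borel[of j] Omega_subset[OF K(2)] by auto
    have "energy K j + ereal (LINT x:K \<inter> Ej j|lebesgue. Hj j x) \<le> ereal (u j) + ereal (M * measure lebesgue \<Omega>)"
      using u(2)[of j] integral_bound[OF KE, of j] unfolding Per_s_ae_equal[OF ae_equal_refl W(2)] by (intro add_mono) auto
    then show ?thesis unfolding scaled_Massari_s by simp
  qed
  then have "limsup (\<lambda>j. ereal (1 - 2 * s j) * Massari_s (s j) (Hj j) K (Ej j)) \<le> limsup (\<lambda>j. ereal (u j + M * measure lebesgue \<Omega>))"
    by (intro Limsup_mono always_eventually allI)
  also have "\<dots> = ereal (u0 + M * measure lebesgue \<Omega>)"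
  proof (rule lim_imp_Limsup)
    show "(\<lambda>j. ereal (u j + M * measure lebesgue \<Omega>)) \<longlonglongrightarrow> ereal (u0 + M * measure lebesgue \<Omega>)"
      unfolding lim_ereal by (rule tendsto_add[OF u(1) tendsto_const])
  qed simp
  also have "\<dots> < \<infinity>" by simp
  finally show ?thesis .
qed

text \<open>The sets are exchanged first, under the uniform bound \<open>M\<close>, and only then
  the functions, by convergence in L1 over a fixed set.\<close>

lemma integral_sets_tendsto:
  assumes K: "K \<in> sets lebesgue" "K \<subseteq> \<Omega>"
  shows "(\<lambda>j. LINT x:K \<inter> Ej j|lebesgue. Hj j x) \<longlonglongrightarrow> (LINT x:K \<inter> E|lebesgue. H x)"
proof -
  obtain R where R: "\<And>x. x \<in> \<Omega> \<Longrightarrow> norm x \<le> R" using bounded_Omega by (auto simp: bounded_iff)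
  define m where "m j = measure lborel (cball 0 R \<inter> sym_diff (Ej j) E)" for j
  have m0: "(\<lambda>j. M * m j) \<longlonglongrightarrow> 0" using tendsto_mult[OF tendsto_const E_lim, of M R] by (simp add: m_def)
  have KE: "K \<inter> Ej j \<in> sets lebesgue" "K \<inter> Ej j \<subseteq> \<Omega>" "K \<inter> E \<in> sets lebesgue" "K \<inter> E \<subseteq> \<Omega>" for j
    using K Ej_borel[of j] E_borel by auto
  have "(\<lambda>j. (LINT x:K \<inter> Ej j|lebesgue. Hj j x) - (LINT x:K \<inter> E|lebesgue. Hj j x)) \<longlonglongrightarrow> 0"
  proof (rule Lim_null_comparison[OF _ m0], rule always_eventually, rule allI)
    fix j
    have B: "cball 0 R \<inter> sym_diff (Ej j) E \<in> sets borel" using Ej_borel[of j] E_borel by auto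
    have fin: "emeasure lborel (cball 0 R \<inter> sym_diff (Ej j) E) < \<infinity>" by (intro emeasure_bounded_finite bounded_Int) simp
    have "measure lebesgue (sym_diff (K \<inter> Ej j) (K \<inter> E)) \<le> measure lebesgue (cball 0 R \<inter> sym_diff (Ej j) E)"
    proof (rule measure_mono_fmeasurable)
      show "sym_diff (K \<inter> Ej j) (K \<inter> E) \<subseteq> cball 0 R \<inter> sym_diff (Ej j) E" using K(2) R by auto
      show "sym_diff (K \<inter> Ej j) (K \<inter> E) \<in> sets lebesgue" using KE by blast
      show "cball 0 R \<inter> sym_diff (Ej j) E \<in> lmeasurable"
        using B fin by (intro fmeasurableI) auto
    qed
    also have "\<dots> = m j" unfolding m_def using B by (intro measure_completion) simp
    finally have "M * measure lebesgue (sym_diff (K \<inter> Ej j) (K \<inter> E)) \<le> M * m j" using M_nonneg by (intro mult_left_mono)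
    then show "norm ((LINT x:K \<inter> Ej j|lebesgue. Hj j x) - (LINT x:K \<inter> E|lebesgue. Hj j x)) \<le> M * m j"
      using integral_difference_bound[OF KE, of j j] unfolding real_norm_def by (rule order_trans[rotated])
  qed
  from tendsto_add[OF this integral_tendsto[OF KE(3,4)]] show ?thesis by simp
qed

lemma energy_limit_Massari:
  assumes K: "K \<in> sets lebesgue" "compactly_contained K \<Omega>" and null: "Per E (frontier K) = 0"
  shows "(\<lambda>j. ereal (1 - 2 * s j) * Massari_s (s j) (Hj j) K (Ej j))
    \<longlonglongrightarrow> ereal (unit_ball_vol (real (CARD('n) - 1))) * Massari H K E"
proof -
  let ?o = "unit_ball_vol (real (CARD('n) - 1))"
  obtain W where W: "W \<in> sets borel" "ae_equal K W" "interior K \<subseteq> W" "W \<subseteq> closure K"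
    using borel_representative_between[OF K(1)] by blast
  have C: "compact (closure K)" "closure K \<subseteq> \<Omega>" using K(2) by (auto simp: compactly_contained_def)
  have I: "open (interior K)" "interior K \<subseteq> closure K" using interior_subset closure_subset by blast+
  have null': "Per E (closure K - interior K) = 0" using null by (simp add: frontier_def)
  have "energy K = energy W" unfolding Per_s_ae_equal[OF ae_equal_refl W(2)] by (rule refl)
  then have lim: "energy K \<longlonglongrightarrow> ereal ?o * Per_open E (interior K)" using energy_limit(1)[OF C I W(1,3,4) null'] by simp
  have PerK: "Per E K = Per_open E (interior K)"
    by (rule energy_limit(2)[OF C I W(1,3,4) null' interior_subset closure_subset])
  \<comment> \<open>Finite perimeter on the interior makes both limits real, so that they can be
    added in \<open>ereal\<close>.\<close>
  have "compactly_contained (interior K) \<Omega>" using K(2) interior_subset by (rule compactly_contained_subset)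
  then obtain p where p: "Per_open E (interior K) = ereal p"
    using Per_open_finite[OF I(1)] Per_open_nonneg[of E "interior K"] by (cases "Per_open E (interior K)") auto
  have "(\<lambda>j. energy K j + ereal (LINT x:K \<inter> Ej j|lebesgue. Hj j x)) \<longlonglongrightarrow> ereal (?o * p) + ereal (LINT x:K \<inter> E|lebesgue. H x)"
  proof (rule tendsto_add_ereal)
    show "energy K \<longlonglongrightarrow> ereal (?o * p)" using lim unfolding p by simp
    show "(\<lambda>j. ereal (LINT x:K \<inter> Ej j|lebesgue. Hj j x)) \<longlonglongrightarrow> ereal (LINT x:K \<inter> E|lebesgue. H x)"
      unfolding lim_ereal by (rule integral_sets_tendsto[OF K(1) Omega_subset[OF K(2)]])
  qed simp_all
  moreover have "ereal ?o * Massari H K E = ereal (?o * p) + ereal (LINT x:K \<inter> E|lebesgue. H x)"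
  proof -
    have "?o * (1 / ?o * x) = x" for x using omega_pos by (metis less_irrefl mult.assoc mult_1 nonzero_mult_div_cancel_left times_divide_eq_right)
    then show ?thesis unfolding Massari_def PerK p by (simp only: ereal_mult_add_real times_ereal.simps)
  qed
  ultimately show ?thesis unfolding scaled_Massari_s by simp
qed

end

theorem theorem2p4:
  fixes \<Omega> :: "(real^'n) set"
    and s :: "nat \<Rightarrow> real"
    and Hj :: "nat \<Rightarrow> real^'n \<Rightarrow> real"
    and H :: "real^'n \<Rightarrow> real"
    and Ej :: "nat \<Rightarrow> (real^'n) set"
    and E :: "(real^'n) set"
  assumes "bounded \<Omega>" and "lipschitz_open \<Omega>"
    and "\<And>j. s j \<in> {0<..<1/2}" and "s \<longlonglongrightarrow> 1/2"
    and "\<And>j. Hj j \<in> Linfty \<Omega>" and "(SUP j. Linfty_norm \<Omega> (Hj j)) < \<infinity>"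
    and "L1_convergent_on \<Omega> Hj H"
    and "\<And>j. Ej j \<in> sets lebesgue" and "E \<in> sets lebesgue"
    and "\<And>j. local_minimizer (Massari_s (s j) (Hj j)) \<Omega> (Ej j)"
    and "L1_loc_convergent_sets Ej E"
  shows "(\<forall>K\<in>sets lebesgue. compactly_contained K \<Omega> \<longrightarrow>
           limsup (\<lambda>j. ereal (1 - 2 * s j) * Massari_s (s j) (Hj j) K (Ej j)) < \<infinity>)
       \<and> local_minimizer (Massari H) \<Omega> E
       \<and> (\<forall>K\<in>sets lebesgue. compactly_contained K \<Omega> \<and> Per E (frontier K) = 0 \<longrightarrow>
           (\<lambda>j. ereal (1 - 2 * s j) * Massari_s (s j) (Hj j) K (Ej j))
             \<longlonglongrightarrow> ereal (unit_ball_vol (real (CARD('n) - 1))) * Massari H K E)"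
proof -
  have Omega: "open \<Omega>" "\<Omega> \<in> sets lebesgue" using assms(2) by (auto simp: lipschitz_open_def)
  have H: "integrable (lebesgue_on \<Omega>) (Hj j)" "integrable (lebesgue_on \<Omega>) H"
    "(\<lambda>j. \<integral>x. \<bar>Hj j x - H x\<bar> \<partial>lebesgue_on \<Omega>) \<longlonglongrightarrow> 0" for j
    using assms(7) by (auto simp: L1_convergent_on_def)
  obtain M where M: "0 \<le> M" "\<And>j. Linfty_norm \<Omega> (Hj j) \<le> ereal M"
  proof -
    define S where "S = (SUP j. Linfty_norm \<Omega> (Hj j))"
    \<comment> \<open>The maximum makes \<open>M\<close> nonnegative and covers the value
      -\<infinity> of the essential supremum on an empty domain.\<close>
    have "S \<le> ereal (max 0 (real_of_ereal S))" using assms(6) unfolding S_def[symmetric] by (cases S) auto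
    moreover have "Linfty_norm \<Omega> (Hj j) \<le> S" for j unfolding S_def by (rule SUP_upper) simp
    ultimately show ?thesis by (intro that[of "max 0 (real_of_ereal S)"]) (auto intro: order_trans)
  qed
  have bound: "AE x in lebesgue_on \<Omega>. \<bar>Hj j x\<bar> \<le> M" for j
    using esssup_AE[of "\<lambda>x. ereal \<bar>Hj j x\<bar>" "lebesgue_on \<Omega>"]
  proof eventually_elim
    case (elim x)
    then have "ereal \<bar>Hj j x\<bar> \<le> ereal M" using M(2)[of j] unfolding Linfty_norm_def by (rule order_trans)
    then show ?case by simp
  qed
  \<comment> \<open>Passing to Borel representatives keeps the perimeters, the energies and the
    measure of symmetric differences, so the locale applies and its conclusions can be carried
    back.\<close>
  obtain E' where E': "E' \<in> sets borel" "ae_equal E E'" using borel_representative[OF assms(9)] by blast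
  have "\<forall>j. \<exists>B. B \<in> sets borel \<and> ae_equal (Ej j) B" using borel_representative[OF assms(8)] by blast
  then obtain F where F: "\<And>j. F j \<in> sets borel" "\<And>j. ae_equal (Ej j) (F j)" by metis
  have leb: "E' \<in> sets lebesgue" "F j \<in> sets lebesgue" for j using E'(1) F(1)[of j] by auto
  have "(\<lambda>j. measure lborel (cball 0 R \<inter> sym_diff (F j) E')) \<longlonglongrightarrow> 0" for R
  proof -
    have C: "cball 0 R \<in> sets (lebesgue :: (real^'n) measure)" by simp
    have "(\<lambda>j. \<integral>x. \<bar>indicator (Ej j) x - indicator E x :: real\<bar> \<partial>lebesgue_on (cball 0 R)) \<longlonglongrightarrow> 0"
      using assms(11) by (simp add: L1_loc_convergent_sets_def L1_convergent_on_def)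
    moreover have "(\<integral>x. \<bar>indicator (Ej j) x - indicator E x :: real\<bar> \<partial>lebesgue_on (cball 0 R))
        = measure lborel (cball 0 R \<inter> sym_diff (F j) E')" for j
    proof -
      let ?S = "cball 0 R \<inter> sym_diff (Ej j) E" and ?T = "cball 0 R \<inter> sym_diff (F j) E'"
      have "(\<integral>x. \<bar>indicator (Ej j) x - indicator E x :: real\<bar> \<partial>lebesgue_on (cball 0 R))
          = (\<integral>x. indicator (cball 0 R) x *\<^sub>R \<bar>indicator (Ej j) x - indicator E x :: real\<bar> \<partial>lebesgue)"
        using C by (intro integral_restrict_space) simp
      also have "\<dots> = (\<integral>x. (indicator ?S x :: real) \<partial>lebesgue)"
        by (intro Bochner_Integration.integral_cong refl) (auto simp: indicator_def)
      also have "\<dots> = (\<integral>x. (indicator ?T x :: real) \<partial>lebesgue)"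
      proof (rule integral_cong_AE)
        show "(\<lambda>x. indicator ?S x :: real) \<in> borel_measurable lebesgue"
          using C assms(8)[of j] assms(9) by (intro borel_measurable_indicator) blast
        show "(\<lambda>x. indicator ?T x :: real) \<in> borel_measurable lebesgue"
          using C leb by (intro borel_measurable_indicator) blast
        show "AE x in lebesgue. indicator ?S x = (indicator ?T x :: real)"
          using F(2)[of j] E'(2) unfolding ae_equal_def by eventually_elim (simp add: indicator_def)
      qed
      also have "\<dots> = measure lebesgue ?T" by simp
      also have "\<dots> = measure lborel ?T" using F(1)[of j] E'(1) by (intro measure_completion) auto
      finally show ?thesis .
    qed
    ultimately show ?thesis by (simp only:)
  qed
  moreover have "local_minimizer (Massari_s (s j) (Hj j)) \<Omega> (F j)" for j
    using assms(10)[of j] assms(8)[of j] leb(2)[of j] F(2)[of j]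
  proof (rule local_minimizer_ae_equal)
    fix \<Omega>' A B :: "(real^'n) set" assume "open \<Omega>'" "\<Omega>' \<subseteq> \<Omega>" "A \<in> sets lebesgue" "B \<in> sets lebesgue" "ae_equal A B"
    then show "Massari_s (s j) (Hj j) \<Omega>' A = Massari_s (s j) (Hj j) \<Omega>' B"
      by (intro Massari_s_ae_equal[OF borel_measurable_integrable[OF H(1)] Omega(2)] ae_equal_refl) auto
  qed
  ultimately interpret massari_sequence \<Omega> s Hj H F E' M
    using assms(1,3,4) Omega(1) H bound M(1) F(1) E'(1) by unfold_locales auto
  have same: "Massari_s (s j) (Hj j) K (Ej j) = Massari_s (s j) (Hj j) K (F j)"
    if K: "K \<in> sets lebesgue" "compactly_contained K \<Omega>" for K j
    using Omega_subset[OF K(2)] K(1) assms(8)[of j] leb(2)[of j] F(2)[of j]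
    by (intro Massari_s_ae_equal[OF borel_measurable_integrable[OF H(1)] Omega(2)] ae_equal_refl) auto
  have Per: "Per E = Per E'"
    by (rule ext) (simp only: Per_def Per_open_ae_equal[OF assms(9) leb(1) E'(2)])
  have "local_minimizer (Massari H) \<Omega> E"
    using limit_minimizer leb(1) assms(9) ae_equal_sym[OF E'(2)]
  proof (rule local_minimizer_ae_equal)
    fix \<Omega>' A B :: "(real^'n) set" assume "open \<Omega>'" "\<Omega>' \<subseteq> \<Omega>" "A \<in> sets lebesgue" "B \<in> sets lebesgue" "ae_equal A B"
    then show "Massari H \<Omega>' A = Massari H \<Omega>' B"
      by (intro Massari_ae_equal[OF borel_measurable_integrable[OF H(2)] Omega(2)]) auto
  qed
  moreover have "Massari H K E = Massari H K E'" if K: "K \<in> sets lebesgue" "compactly_contained K \<Omega>" for K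
    using Omega_subset[OF K(2)] K(1) assms(9) leb(1) E'(2)
    by (intro Massari_ae_equal[OF borel_measurable_integrable[OF H(2)] Omega(2)]) auto
  ultimately show ?thesis
    using limsup_finite energy_limit_Massari by (simp add: same Per)
qed

end
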